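(* Let $\mathcal H$ be the separable infinite-dimensional Hilbert space. Neither of the following equivalence relations is Borel reducible to the orbit equivalence relation of a Borel action of a CLI group on a standard Borel space: (1) unitary equivalence of unitary operators on $\mathcal H$ (i.e. $u\sim v$ iff $v=wuw^*$ for some unitary $w$); (2) unitary equivalence of (bounded) selfadjoint operators on $\mathcal H$.
   Context: The unitary group $\mathcal U(\mathcal H)$ is a Polish group in the weak operator topology and acts by conjugation on itself and on the space $\mathcal B(\mathcal H)_{sa}$ of bounded selfadjoint operators; these spaces carry their standard Borel structures (generated by the weak operator topology). A CLI group is a Polish group admitting a compatible complete left-invariant metric. *)

theory Defs
  imports "HOL-Analysis.Analysis" "HOL-Algebra.Group_Action"
begin

section \<open>Complex Hilbert spaces\<close>

text \<open>Completeness, and the agreement of the topology with the norm, come from \<open>banach\<close>.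
  The inner product is linear in its first argument.\<close>

class complex_hilbert = banach +
  fixes scaleC :: "complex \<Rightarrow> 'a \<Rightarrow> 'a"  (infixr "*\<^sub>C" 75)
    and cinner :: "'a \<Rightarrow> 'a \<Rightarrow> complex"
  assumes scaleC_add_right: "c *\<^sub>C (x + y) = c *\<^sub>C x + c *\<^sub>C y"
    and scaleC_add_left: "(b + c) *\<^sub>C x = b *\<^sub>C x + c *\<^sub>C x"
    and scaleC_scaleC: "b *\<^sub>C c *\<^sub>C x = (b * c) *\<^sub>C x"
    and scaleR_eq_scaleC: "r *\<^sub>R x = complex_of_real r *\<^sub>C x"
    and cinner_commute: "cinner x y = cnj (cinner y x)"
    and cinner_add_left: "cinner (x + y) z = cinner x z + cinner y z"
    and cinner_scaleC_left: "cinner (c *\<^sub>C x) y = c * cinner x y"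
    and cinner_self_nonneg: "0 \<le> Re (cinner x x)"
    and norm_eq_sqrt_cinner: "norm x = sqrt (Re (cinner x x))"

lemma module_scaleC: "module (scaleC :: complex \<Rightarrow> 'h \<Rightarrow> 'h::complex_hilbert)"
  by unfold_locales
    (simp_all add: scaleC_add_right scaleC_add_left scaleC_scaleC flip: scaleR_eq_scaleC [of 1, simplified])

definition infinite_dimensional :: "'h::complex_hilbert itself \<Rightarrow> bool" where
  "infinite_dimensional _ \<longleftrightarrow>
     (\<nexists>B :: 'h set. finite B \<and> module.span scaleC B = UNIV)"

section \<open>Bounded operators\<close>

text \<open>The type \<open>'h \<Rightarrow>\<^sub>L 'h\<close> consists of the bounded real-linear maps, so complex
  homogeneity has to be imposed.\<close>

definition bounded_operators :: "('h::complex_hilbert \<Rightarrow>\<^sub>L 'h) set" where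
  "bounded_operators = {A. \<forall>c x. blinfun_apply A (c *\<^sub>C x) = c *\<^sub>C blinfun_apply A x}"

text \<open>On \<open>bounded_operators\<close> the description below is satisfied by exactly one operator
  (Riesz representation).\<close>

definition cadjoint :: "('h::complex_hilbert \<Rightarrow>\<^sub>L 'h) \<Rightarrow> ('h \<Rightarrow>\<^sub>L 'h)" where
  "cadjoint A = (THE B. B \<in> bounded_operators \<and>
     (\<forall>x y. cinner (blinfun_apply A x) y = cinner x (blinfun_apply B y)))"

definition unitaries :: "('h::complex_hilbert \<Rightarrow>\<^sub>L 'h) set" where
  "unitaries = {u \<in> bounded_operators.
     cadjoint u o\<^sub>L u = id_blinfun \<and> u o\<^sub>L cadjoint u = id_blinfun}"

definition selfadjoints :: "('h::complex_hilbert \<Rightarrow>\<^sub>L 'h) set" where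
  "selfadjoints = {A \<in> bounded_operators. cadjoint A = A}"

definition weak_operator_topology :: "('h::complex_hilbert \<Rightarrow>\<^sub>L 'h) topology" where
  "weak_operator_topology = topology_generated_by
     {{A \<in> bounded_operators. cinner (blinfun_apply A x) y \<in> U} | x y U. open U}"

definition unitary_equivalence ::
    "('h::complex_hilbert \<Rightarrow>\<^sub>L 'h) set \<Rightarrow> (('h \<Rightarrow>\<^sub>L 'h) \<times> ('h \<Rightarrow>\<^sub>L 'h)) set" where
  "unitary_equivalence S =
     {(u, v). u \<in> S \<and> v \<in> S \<and> (\<exists>w \<in> unitaries. v = w o\<^sub>L u o\<^sub>L cadjoint w)}"

section \<open>Polish and standard Borel spaces, Borel reducibility\<close>

definition polish_space :: "'a topology \<Rightarrow> bool" where
  "polish_space T \<longleftrightarrow> separable_space T \<and> completely_metrizable_space T"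

definition borel_of :: "'a topology \<Rightarrow> 'a measure" where
  "borel_of T = sigma (topspace T) {U. openin T U}"

text \<open>The type \<open>measure\<close> serves only as a carrier of a measurable space here; the measure
  itself is irrelevant.\<close>

definition standard_borel_space :: "'a measure \<Rightarrow> bool" where
  "standard_borel_space M \<longleftrightarrow>
     (\<exists>T. polish_space T \<and> topspace T = space M \<and> sets M = sets (borel_of T))"

definition borel_reducible ::
    "'a measure \<Rightarrow> ('a \<times> 'a) set \<Rightarrow> 'b measure \<Rightarrow> ('b \<times> 'b) set \<Rightarrow> bool" where
  "borel_reducible M E N F \<longleftrightarrow>
     (\<exists>f \<in> M \<rightarrow>\<^sub>M N. \<forall>x \<in> space M. \<forall>y \<in> space M. (x, y) \<in> E \<longleftrightarrow> (f x, f y) \<in> F)"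

section \<open>CLI groups and their Borel actions\<close>

definition topological_group :: "('g, 'm) monoid_scheme \<Rightarrow> 'g topology \<Rightarrow> bool" where
  "topological_group G T \<longleftrightarrow> group G \<and> topspace T = carrier G \<and>
     continuous_map (prod_topology T T) T (\<lambda>(g, h). g \<otimes>\<^bsub>G\<^esub> h) \<and>
     continuous_map T T (\<lambda>g. inv\<^bsub>G\<^esub> g)"

definition polish_group :: "('g, 'm) monoid_scheme \<Rightarrow> 'g topology \<Rightarrow> bool" where
  "polish_group G T \<longleftrightarrow> topological_group G T \<and> polish_space T"

definition cli_group :: "('g, 'm) monoid_scheme \<Rightarrow> 'g topology \<Rightarrow> bool" where
  "cli_group G T \<longleftrightarrow> polish_group G T \<and>
     (\<exists>d. Metric_space (carrier G) d \<and>
          Metric_space.mtopology (carrier G) d = T \<and>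
          Metric_space.mcomplete (carrier G) d \<and>
          (\<forall>g \<in> carrier G. \<forall>x \<in> carrier G. \<forall>y \<in> carrier G.
             d (g \<otimes>\<^bsub>G\<^esub> x) (g \<otimes>\<^bsub>G\<^esub> y) = d x y))"

definition borel_action ::
    "('g, 'm) monoid_scheme \<Rightarrow> 'g topology \<Rightarrow> 'x measure \<Rightarrow> ('g \<Rightarrow> 'x \<Rightarrow> 'x) \<Rightarrow> bool" where
  "borel_action G T X \<phi> \<longleftrightarrow> group_action G (space X) \<phi> \<and>
     (\<lambda>(g, x). \<phi> g x) \<in> borel_of T \<Otimes>\<^sub>M X \<rightarrow>\<^sub>M X"

definition orbit_equivalence ::
    "('g, 'm) monoid_scheme \<Rightarrow> ('g \<Rightarrow> 'x \<Rightarrow> 'x) \<Rightarrow> 'x set \<Rightarrow> ('x \<times> 'x) set" where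
  "orbit_equivalence G \<phi> E = {(x, y). x \<in> E \<and> y \<in> E \<and> y \<in> orbit G \<phi> x}"

end

theory Submission
  imports Defs
begin

text \<open>
  Fix an orthonormal sequence and let every sequence \<open>e\<close> of reals define a diagonal operator whose
  eigenvalues encode the terms of \<open>e\<close>, each with infinite multiplicity. Two such operators are
  unitarily equivalent iff the sequences have the same range, so a reduction \<open>f\<close> to a CLI group \<open>G\<close>
  would classify countable sets of reals by \<open>G\<close>-orbits.

  For a countable set \<open>A\<close> of reals consider a sequence that is Cohen generic over \<open>A\<close>. The forcing
  relation for analytic sets is defined on finite sequences of reals, hence does not depend on \<open>A\<close>,
  and it computes category in \<open>A\<close>-valued sequences for all \<open>A\<close> in a closed unbounded family of
  countable sets. Consequently, for every neighbourhood \<open>W\<close> of the identity, densely many finite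
  sequences force \<open>f e' \<in> W (f e)\<close> for generic \<open>e\<close>, \<open>e'\<close> extending them.

  Take two such sets with \<open>A0\<close> a proper subset of \<open>A\<close>, a generic enumeration \<open>e0\<close> of \<open>A0\<close>, and generic
  enumerations \<open>e k\<close> of \<open>A\<close> that agree with longer and longer initial segments of \<open>e0\<close>. Then
  \<open>f (e k) = v k (f (e 0))\<close> where \<open>v k\<close> converges to some \<open>v\<close> because \<open>G\<close> is CLI. For generic \<open>h\<close> in
  \<open>G\<close>, every Borel property of \<open>h (f e0)\<close> from a countable separating family is forced by an initial
  segment of \<open>e0\<close> and a neighbourhood of \<open>h\<close>, so it holds for \<open>(h v (v k)\<^sup>-\<^sup>1) (f (e k)) = h v (f (e 0))\<close>
  with \<open>k\<close> large. Hence \<open>f e0 = v (f (e 0))\<close>, although \<open>e0\<close> and \<open>e 0\<close> have different ranges.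
\<close>

section \<open>Closed unbounded families of countable sets\<close>

text \<open>The obstacle is that no model is at hand over which a sequence could be generic.
  Genericity over \<open>A\<close> becomes comeagerness among the sequences over \<open>A\<close>,
  with \<open>A\<close> discrete; this space is Polish because \<open>A\<close> is countable.
  Elementarity becomes closure: \<open>club P\<close> says that, for some function from finite
  sequences to countable sets, all nonempty countable sets closed under it satisfy \<open>P\<close>.
  Reals are atoms throughout; their topology enters only when the operators are shown to depend
  measurably on the sequence. Nearness of \<open>f e\<close> and \<open>f e'\<close> quantifies over
  the group, so it is merely analytic, and Suslin schemes treat it uniformly with the Borel
  conditions on translates of \<open>f e\<close>. Two sets are needed because the limit has to leave
  the set: finite conditions over \<open>A0\<close> are also conditions over \<open>A\<close>, so
  what they force holds over both, although a limit of enumerations of \<open>A\<close> may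
  enumerate no more than \<open>A0\<close>.\<close>

definition club :: "('a set \<Rightarrow> bool) \<Rightarrow> bool" where
  "club P \<longleftrightarrow> (\<exists>F :: 'a list \<Rightarrow> 'a set. (\<forall>l. countable (F l)) \<and>
     (\<forall>A. countable A \<and> A \<noteq> {} \<and> (\<forall>l \<in> lists A. F l \<subseteq> A) \<longrightarrow> P A))"

lemma club_mono:
  assumes "club P" "\<And>A. countable A \<Longrightarrow> A \<noteq> {} \<Longrightarrow> P A \<Longrightarrow> Q A"
  shows "club Q"
proof -
  obtain F where "\<forall>l. countable (F l)"
    "\<forall>A. countable A \<and> A \<noteq> {} \<and> (\<forall>l \<in> lists A. F l \<subseteq> A) \<longrightarrow> P A"
    using assms(1) unfolding club_def by blast
  then show ?thesis
    using assms(2) unfolding club_def by (intro exI[of _ F]) blast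
qed

lemma club_const: "P \<Longrightarrow> club (\<lambda>A. P)"
  unfolding club_def by (rule exI[of _ "\<lambda>_. {}"]) simp

lemma club_all:
  fixes P :: "'i::countable \<Rightarrow> 'a set \<Rightarrow> bool"
  assumes "\<And>i. club (P i)"
  shows "club (\<lambda>A. \<forall>i. P i A)"
proof -
  have "\<forall>i. \<exists>F :: 'a list \<Rightarrow> 'a set. (\<forall>l. countable (F l)) \<and>
     (\<forall>A. countable A \<and> A \<noteq> {} \<and> (\<forall>l \<in> lists A. F l \<subseteq> A) \<longrightarrow> P i A)"
    using assms unfolding club_def by blast
  then obtain F :: "'i \<Rightarrow> 'a list \<Rightarrow> 'a set" where F: "\<And>i l. countable (F i l)"
    "\<And>i A. countable A \<Longrightarrow> A \<noteq> {} \<Longrightarrow> (\<forall>l \<in> lists A. F i l \<subseteq> A) \<Longrightarrow> P i A"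
    by metis
  show ?thesis
    unfolding club_def
    by (rule exI[of _ "\<lambda>l. \<Union>i. F i l"]) (auto intro!: F simp: UN_subset_iff)
qed

lemma club_conj:
  assumes "club P" "club Q"
  shows "club (\<lambda>A. P A \<and> Q A)"
proof -
  have "club (\<lambda>A. \<forall>b. (if b then P else Q) A)"
    using assms by (intro club_all) auto
  then show ?thesis
    by (rule club_mono) (metis (full_types))
qed

text \<open>A diagonal intersection: the parameter ranges over finite sequences from
  \<open>A\<close> itself, so possibly uncountably many requirements are met at once. One closure
  function suffices, since a finite sequence can be read, at every cut point, as a parameter
  followed by an argument.\<close>

lemma club_diagonal:
  assumes "\<And>l. club (P l)"
  shows "club (\<lambda>A. \<forall>l \<in> lists A. P l A)"
proof -
  have "\<forall>l. \<exists>F :: 'a list \<Rightarrow> 'a set. (\<forall>l. countable (F l)) \<and>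
     (\<forall>A. countable A \<and> A \<noteq> {} \<and> (\<forall>l \<in> lists A. F l \<subseteq> A) \<longrightarrow> P l A)"
    using assms unfolding club_def by blast
  then obtain F :: "'a list \<Rightarrow> 'a list \<Rightarrow> 'a set" where F: "\<And>i l. countable (F i l)"
    "\<And>i A. countable A \<Longrightarrow> A \<noteq> {} \<Longrightarrow> (\<forall>l \<in> lists A. F i l \<subseteq> A) \<Longrightarrow> P i A"
    by metis
  let ?F = "\<lambda>l. \<Union>j \<le> length l. F (take j l) (drop j l)"
  have "P l A" if A: "countable A" "A \<noteq> {}" "\<forall>l \<in> lists A. ?F l \<subseteq> A" and l: "l \<in> lists A" for l A
  proof (rule F(2)[OF A(1,2)], intro ballI)
    fix l' assume "l' \<in> lists A"
    then have "l @ l' \<in> lists A" using l by simp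
    then have "?F (l @ l') \<subseteq> A" using A(3) by blast
    moreover have "F (take (length l) (l @ l')) (drop (length l) (l @ l')) \<subseteq> ?F (l @ l')"
      by (rule UN_upper) simp
    ultimately show "F l l' \<subseteq> A" by simp
  qed
  moreover have "countable (?F l)" for l
    by (intro countable_UN F) simp
  ultimately show ?thesis
    unfolding club_def by (intro exI[of _ ?F]) blast
qed

lemma club_superset: "countable B \<Longrightarrow> club (\<lambda>A. B \<subseteq> A)"
  unfolding club_def by (rule exI[of _ "\<lambda>_. B"]) auto

lemma club_lists: "club (\<lambda>A. t \<in> lists A)"
  by (rule club_mono[OF club_superset[of "set t"]]) (simp_all add: countable_finite in_lists_conv_set subset_iff)

text \<open>Closing off in \<omega> steps: each stage adds the values on finite sequences from the
  previous stage, and a finite sequence from the union already lies in one stage because the stages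
  increase.\<close>

lemma club_exists:
  fixes B :: "'a set"
  assumes "club P" "countable B"
  obtains A where "B \<subseteq> A" "countable A" "A \<noteq> {}" "P A"
proof -
  obtain F where "(\<forall>l. countable (F l)) \<and>
      (\<forall>A. countable A \<and> A \<noteq> {} \<and> (\<forall>l \<in> lists A. F l \<subseteq> A) \<longrightarrow> P A)"
    using assms(1) unfolding club_def ..
  then have F: "\<And>l. countable (F l)"
    "\<And>A. countable A \<Longrightarrow> A \<noteq> {} \<Longrightarrow> (\<forall>l \<in> lists A. F l \<subseteq> A) \<Longrightarrow> P A"
    by simp_all
  \<comment> \<open>\<open>undefined\<close> only guarantees that the result is nonempty.\<close>
  define C where "C = rec_nat (insert undefined B) (\<lambda>_ S. S \<union> (\<Union>l \<in> lists S. F l))"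
  have C0: "C 0 = insert undefined B" and CS: "C (Suc n) = C n \<union> (\<Union>l \<in> lists (C n). F l)" for n
    unfolding C_def by simp_all
  have cnt: "countable (C n)" for n
    by (induction n) (auto simp: C0 CS assms F intro!: countable_UN countable_lists)
  have mono: "mono C"
    by (rule mono_iff_le_Suc[THEN iffD2]) (auto simp: CS)
  let ?A = "\<Union>n. C n"
  have "\<exists>n. l \<in> lists (C n)" if "l \<in> lists ?A" for l
    using that
  proof (induction l)
    case (Cons a l)
    then obtain n m where "l \<in> lists (C n)" "a \<in> C m" by auto
    then have "a # l \<in> lists (C (max n m))"
      using monoD[OF mono, of n "max n m"] monoD[OF mono, of m "max n m"] by auto
    then show ?case by blast
  qed simp
  then have "\<forall>l \<in> lists ?A. F l \<subseteq> ?A"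
    by (metis (no_types, lifting) CS UN_upper UN_I UnI2 subsetI UNIV_I)
  moreover have "countable ?A" "?A \<noteq> {}" "B \<subseteq> ?A"
    using cnt C0 by blast+
  ultimately show thesis
    using that F(2) by blast
qed

section \<open>Category\<close>

definition dense_open :: "'a topology \<Rightarrow> 'a set \<Rightarrow> bool" where
  "dense_open T U \<longleftrightarrow> openin T U \<and> (\<forall>V. openin T V \<longrightarrow> V \<noteq> {} \<longrightarrow> U \<inter> V \<noteq> {})"

text \<open>\<open>C\<close> may contain points outside the space. Thus
  \<open>comeager T (- U \<union> C)\<close> can be used below to say that \<open>C\<close> is
  comeager in the open set \<open>U\<close>.\<close>

definition comeager :: "'a topology \<Rightarrow> 'a set \<Rightarrow> bool" where
  "comeager T C \<longleftrightarrow> (\<exists>U :: nat \<Rightarrow> 'a set. (\<forall>n. dense_open T (U n)) \<and>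
     (\<forall>x \<in> topspace T. (\<forall>n. x \<in> U n) \<longrightarrow> x \<in> C))"

lemma comeagerE:
  assumes "comeager T C"
  obtains U :: "nat \<Rightarrow> 'a set" where "\<And>n. openin T (U n)"
    "\<And>n V. openin T V \<Longrightarrow> V \<noteq> {} \<Longrightarrow> U n \<inter> V \<noteq> {}"
    "\<And>x. x \<in> topspace T \<Longrightarrow> (\<And>n. x \<in> U n) \<Longrightarrow> x \<in> C"
proof -
  obtain U :: "nat \<Rightarrow> 'a set" where U: "\<forall>n. dense_open T (U n)"
    "\<forall>x \<in> topspace T. (\<forall>n. x \<in> U n) \<longrightarrow> x \<in> C"
    using assms unfolding comeager_def by blast
  then show thesis
    using that[of U] by (simp add: dense_open_def)
qed

lemma comeagerI:
  fixes U :: "nat \<Rightarrow> 'a set"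
  assumes "\<And>n. openin T (U n)" "\<And>n V. openin T V \<Longrightarrow> V \<noteq> {} \<Longrightarrow> U n \<inter> V \<noteq> {}"
    "\<And>x. x \<in> topspace T \<Longrightarrow> (\<And>n. x \<in> U n) \<Longrightarrow> x \<in> C"
  shows "comeager T C"
  unfolding comeager_def dense_open_def using assms by (intro exI[of _ U] conjI) simp_all

lemma comeager_mono:
  assumes "comeager T C" "\<And>x. x \<in> topspace T \<Longrightarrow> x \<in> C \<Longrightarrow> x \<in> D"
  shows "comeager T D"
  using assms unfolding comeager_def by blast

lemma comeager_dense_open:
  assumes "openin T U" "\<And>V. openin T V \<Longrightarrow> V \<noteq> {} \<Longrightarrow> U \<inter> V \<noteq> {}"
  shows "comeager T U"
  using assms by (intro comeagerI[of T "\<lambda>_. U"]) auto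

lemma comeager_UNIV: "comeager T UNIV"
  by (rule comeagerI[of T "\<lambda>_. topspace T"]) (auto dest: openin_subset)

lemma comeager_all:
  fixes C :: "'i::countable \<Rightarrow> 'a set"
  assumes "\<And>i. comeager T (C i)"
  shows "comeager T (\<Inter>i. C i)"
proof -
  have "\<forall>i. \<exists>U :: nat \<Rightarrow> 'a set. (\<forall>n. dense_open T (U n)) \<and>
     (\<forall>x \<in> topspace T. (\<forall>n. x \<in> U n) \<longrightarrow> x \<in> C i)"
    using assms unfolding comeager_def by blast
  then obtain U :: "'i \<Rightarrow> nat \<Rightarrow> 'a set"
    where U: "\<And>i n. dense_open T (U i n)"
      "\<And>i x. x \<in> topspace T \<Longrightarrow> (\<forall>n. x \<in> U i n) \<Longrightarrow> x \<in> C i"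
    by metis
  define V where "V n = case_prod U (from_nat n :: 'i \<times> nat)" for n
  have "x \<in> C i" if "x \<in> topspace T" "\<forall>n. x \<in> V n" for x i
  proof (rule U(2)[OF that(1)], rule allI)
    fix m :: nat
    have "x \<in> V (to_nat (i, m))" using that(2) by blast
    then show "x \<in> U i m" by (simp add: V_def)
  qed
  moreover have "dense_open T (V n)" for n
    by (simp add: V_def U(1) split_beta)
  ultimately show ?thesis
    unfolding comeager_def by blast
qed

lemma comeager_INT:
  assumes "countable I" "\<And>i. i \<in> I \<Longrightarrow> comeager T (C i)"
  shows "comeager T (\<Inter>i\<in>I. C i)"
proof -
  let ?C = "\<lambda>n::nat. if n \<in> to_nat_on I ` I then C (from_nat_into I n) else UNIV"
  have "comeager T (?C n)" for n
    using assms comeager_UNIV by auto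
  then have "comeager T (\<Inter>n. ?C n)"
    by (rule comeager_all)
  then show ?thesis
  proof (rule comeager_mono)
    fix x assume x: "x \<in> (\<Inter>n. ?C n)"
    show "x \<in> (\<Inter>i\<in>I. C i)"
    proof
      fix i assume "i \<in> I"
      moreover have "x \<in> ?C (to_nat_on I i)" using x by blast
      ultimately show "x \<in> C i" using assms(1) by simp
    qed
  qed
qed

lemma comeager_Int:
  assumes "comeager T C" "comeager T D"
  shows "comeager T (C \<inter> D)"
proof -
  have "comeager T (\<Inter>b. if b then C else D)"
    using assms by (intro comeager_all) auto
  then show ?thesis
    by (rule comeager_mono) (metis (full_types) INT_E IntI UNIV_I)
qed

text \<open>The union of the family together with its exterior is dense open, and a point of
  \<open>U\<close> in this set lies in some member, as a nonempty open subset of \<open>U\<close>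
  cannot miss them all. This glues statements about single conditions into one about
  \<open>U\<close>.\<close>

lemma comeager_localize:
  assumes "countable \<V>" "\<And>V. V \<in> \<V> \<Longrightarrow> openin T V"
    and "\<And>V. V \<in> \<V> \<Longrightarrow> comeager T (- V \<union> C)"
    and "openin T U" "\<And>V. openin T V \<Longrightarrow> V \<noteq> {} \<Longrightarrow> V \<subseteq> U \<Longrightarrow> \<Union>\<V> \<inter> V \<noteq> {}"
  shows "comeager T (- U \<union> C)"
proof -
  let ?D = "\<Union>\<V> \<union> \<Union>{V. openin T V \<and> \<Union>\<V> \<inter> V = {}}"
  have "comeager T ?D"
    by (rule comeager_dense_open) (use assms(2) in blast)+
  moreover have "comeager T (\<Inter>V\<in>\<V>. - V \<union> C)"
    using assms by (intro comeager_INT)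
  ultimately have "comeager T (?D \<inter> (\<Inter>V\<in>\<V>. - V \<union> C))"
    by (rule comeager_Int)
  then show ?thesis
  proof (rule comeager_mono)
    fix x assume x: "x \<in> ?D \<inter> (\<Inter>V\<in>\<V>. - V \<union> C)"
    show "x \<in> - U \<union> C"
    proof (cases "x \<in> \<Union>\<V>")
      case False
      then obtain V where V: "openin T V" "\<Union>\<V> \<inter> V = {}" "x \<in> V" using x by blast
      then have "openin T (V \<inter> U)" "\<Union>\<V> \<inter> (V \<inter> U) = {}" using assms(4) by auto
      then show ?thesis using assms(5)[of "V \<inter> U"] V(3) by blast
    qed (use x in blast)
  qed
qed

lemma comeager_meets_open:
  assumes "completely_metrizable_space T" "comeager T C" "openin T U" "U \<noteq> {}"
  obtains x where "x \<in> U" "x \<in> C"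
proof -
  obtain V :: "nat \<Rightarrow> 'a set" where V: "\<And>n. openin T (V n)"
    "\<And>n W. openin T W \<Longrightarrow> W \<noteq> {} \<Longrightarrow> V n \<inter> W \<noteq> {}"
    "\<And>x. x \<in> topspace T \<Longrightarrow> (\<And>n. x \<in> V n) \<Longrightarrow> x \<in> C"
    using assms(2) by (rule comeagerE) blast
  have "Abstract_Topology.closure_of T (\<Inter>(range V)) = topspace T"
  proof (rule Baire_category)
    have "Abstract_Topology.closure_of T (V n) = topspace T" for n
      using V(2)[of _ n] unfolding closure_of_def by blast
    then show "openin T W \<and> Abstract_Topology.closure_of T W = topspace T" if "W \<in> range V" for W
      using that V(1) by blast
  qed (use assms in auto)
  then have "U \<inter> \<Inter>(range V) \<noteq> {}"
    using assms(3,4) openin_subset[OF assms(3)] unfolding closure_of_def by blast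
  then obtain x where "x \<in> U" "\<And>n. x \<in> V n" by blast
  then show thesis
    using that V(3) openin_subset[OF assms(3)] by blast
qed

lemma comeager_preimage:
  assumes f: "continuous_map S T f" "open_map S T f" and C: "comeager T C"
  shows "comeager S {x. f x \<in> C}"
proof -
  obtain U :: "nat \<Rightarrow> 'b set" where U: "\<And>n. openin T (U n)"
    "\<And>n V. openin T V \<Longrightarrow> V \<noteq> {} \<Longrightarrow> U n \<inter> V \<noteq> {}"
    "\<And>x. x \<in> topspace T \<Longrightarrow> (\<And>n. x \<in> U n) \<Longrightarrow> x \<in> C"
    using C by (rule comeagerE) blast
  show ?thesis
  proof (rule comeagerI)
    show "openin S {x \<in> topspace S. f x \<in> U n}" for n
      using f(1) U(1) by (rule openin_continuous_map_preimage)
    show "{x \<in> topspace S. f x \<in> U n} \<inter> V \<noteq> {}" if "openin S V" "V \<noteq> {}" for n V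
    proof -
      have "U n \<inter> f ` V \<noteq> {}"
        using that f(2) by (intro U(2)) (auto simp: open_map_def)
      then show ?thesis using openin_subset[OF that(1)] by blast
    qed
    show "x \<in> {x. f x \<in> C}"
      if "x \<in> topspace S" "\<And>n. x \<in> {x \<in> topspace S. f x \<in> U n}" for x
      using that f(1) U(3)[of "f x"] by (auto simp: continuous_map_def)
  qed
qed

text \<open>For a dense open set and a nonempty basic open \<open>B\<close>, the points whose
  section meets \<open>B\<close> form a dense open set. Second countability of the fibre leaves
  countably many such requirements.\<close>

theorem Kuratowski_Ulam:
  fixes S :: "'a topology" and T :: "'b topology"
  assumes "second_countable T" "comeager (prod_topology S T) C"
  shows "comeager S {x. comeager T {y. (x, y) \<in> C}}"
proof -
  obtain U :: "nat \<Rightarrow> ('a \<times> 'b) set" where U: "\<And>n. openin (prod_topology S T) (U n)"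
    "\<And>n V. openin (prod_topology S T) V \<Longrightarrow> V \<noteq> {} \<Longrightarrow> U n \<inter> V \<noteq> {}"
    "\<And>x. x \<in> topspace (prod_topology S T) \<Longrightarrow> (\<And>n. x \<in> U n) \<Longrightarrow> x \<in> C"
    using assms(2) by (rule comeagerE) blast
  obtain \<B> where "countable \<B> \<and> (\<forall>V \<in> \<B>. openin T V) \<and>
      (\<forall>V x. openin T V \<and> x \<in> V \<longrightarrow> (\<exists>B \<in> \<B>. x \<in> B \<and> B \<subseteq> V))"
    using assms(1) unfolding second_countable_def by blast
  then have \<B>: "countable \<B>" "\<And>V. V \<in> \<B> \<Longrightarrow> openin T V"
    "\<And>V x. openin T V \<Longrightarrow> x \<in> V \<Longrightarrow> \<exists>B \<in> \<B>. x \<in> B \<and> B \<subseteq> V"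
    by blast+
  define P where "P (n::nat) B = {x. \<exists>y \<in> B. (x, y) \<in> U n}" for n B
  have P: "comeager S (P n B)" if B: "B \<in> \<B>" "B \<noteq> {}" for n B
  proof (rule comeager_dense_open)
    have "P n B = fst ` (U n \<inter> (topspace S \<times> B))"
      using openin_subset[OF U(1)[of n]] by (force simp: P_def)
    moreover have "openin (prod_topology S T) (U n \<inter> (topspace S \<times> B))"
      using U(1) \<B>(2)[OF B(1)] by (intro openin_Int) (simp_all add: openin_prod_Times_iff)
    ultimately show "openin S (P n B)"
      using open_map_fst unfolding open_map_def by metis
    show "P n B \<inter> V \<noteq> {}" if "openin S V" "V \<noteq> {}" for V
    proof -
      have "openin (prod_topology S T) (V \<times> B)" "V \<times> B \<noteq> {}"
        using that B \<B>(2)[OF B(1)] by (auto simp: openin_prod_Times_iff)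
      then have "U n \<inter> V \<times> B \<noteq> {}" by (rule U(2))
      then show ?thesis by (auto simp: P_def)
    qed
  qed
  have "comeager S (\<Inter>z \<in> UNIV \<times> (\<B> - {{}}). P (fst z) (snd z))"
    using \<B>(1) P by (intro comeager_INT) fastforce+
  then show ?thesis
  proof (rule comeager_mono)
    fix x assume x: "x \<in> topspace S" and xP': "x \<in> (\<Inter>z \<in> UNIV \<times> (\<B> - {{}}). P (fst z) (snd z))"
    have xP: "x \<in> P n B" if "B \<in> \<B>" "B \<noteq> {}" for n B
      using INT_D[OF xP', of "(n, B)"] that by simp
    have "comeager T {y. (x, y) \<in> C}"
    proof (rule comeagerI)
      have "continuous_map T (prod_topology S T) (\<lambda>y. (x, y))"
        using x by (intro continuous_map_pairedI) auto
      then show "openin T {y \<in> topspace T. (x, y) \<in> U n}" for n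
        using U(1) by (rule openin_continuous_map_preimage)
      show "{y \<in> topspace T. (x, y) \<in> U n} \<inter> V \<noteq> {}" if V: "openin T V" "V \<noteq> {}" for n V
      proof -
        obtain y where "y \<in> V" using V(2) by blast
        then obtain B where B: "B \<in> \<B>" "y \<in> B" "B \<subseteq> V" using \<B>(3)[OF V(1)] by blast
        then obtain y' where "y' \<in> B" "(x, y') \<in> U n"
          using xP[of B n] by (auto simp: P_def)
        then show ?thesis using B(3) openin_subset[OF V(1)] by blast
      qed
      show "y \<in> {y. (x, y) \<in> C}"
        if "y \<in> topspace T" "\<And>n. y \<in> {y \<in> topspace T. (x, y) \<in> U n}" for y
        using that x U(3)[of "(x, y)"] by auto
    qed
    then show "x \<in> {x. comeager T {y. (x, y) \<in> C}}" by simp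
  qed
qed

lemma separable_metrizable_imp_second_countable:
  assumes "separable_space T" "metrizable_space T"
  shows "second_countable T"
proof -
  obtain M d where M: "Metric_space M d" "T = Metric_space.mtopology M d"
    using assms(2) unfolding metrizable_space_def by blast
  interpret Metric_space M d by fact
  obtain D where D: "countable D" "D \<subseteq> M" "Abstract_Topology.closure_of mtopology D = M"
    using assms(1) unfolding separable_space_def M by auto
  let ?\<B> = "(\<lambda>(a, n). mball a (inverse (Suc n))) ` (D \<times> (UNIV :: nat set))"
  have "\<exists>B \<in> ?\<B>. x \<in> B \<and> B \<subseteq> U" if "openin mtopology U" "x \<in> U" for U x
  proof -
    have "x \<in> M" using that openin_subset by fastforce
    moreover have "\<exists>r>0. mball x r \<subseteq> U" using that openin_mtopology[of U] by simp
    ultimately obtain r where r: "r > 0" "mball x r \<subseteq> U" "x \<in> M" by auto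
    obtain n where n: "inverse (Suc n) < r / 2"
      using reals_Archimedean r(1) by (metis half_gt_zero)
    have "x \<in> Abstract_Topology.closure_of mtopology D" using D r by simp
    then have "\<exists>a\<in>D. a \<in> mball x (inverse (Suc n))"
      unfolding metric_closure_of by (simp del: in_mball)
    then obtain a where a: "a \<in> D" "a \<in> mball x (inverse (Suc n))"
      by blast
    then have "x \<in> mball a (inverse (Suc n))"
      using D by (auto simp: commute)
    moreover have "mball a (inverse (Suc n)) \<subseteq> mball x r"
    proof
      fix y assume y: "y \<in> mball a (inverse (Suc n))"
      then have "d x y \<le> d x a + d a y" "d a y < r / 2" "d x a < r / 2"
        using a n r triangle by auto
      then show "y \<in> mball x r" using y r(3) by auto
    qed
    ultimately show ?thesis using a r(2) by blast
  qed
  then show ?thesis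
    unfolding second_countable_def M using D(1)
    by (intro exI[of _ ?\<B>]) (auto intro!: countable_image)
qed

section \<open>Suslin schemes\<close>

text \<open>The Suslin operation: some infinite branch has \<open>z\<close> in the sets at all its
  nodes. Over closed rectangles it represents analytic sets.\<close>

definition suslin :: "'z set set \<Rightarrow> 'z set \<Rightarrow> bool" where
  "suslin \<R> D \<longleftrightarrow> (\<exists>R :: nat list \<Rightarrow> 'z set. (\<forall>u. R u \<in> \<R>) \<and>
     D = {z. \<exists>x. \<forall>k. z \<in> R (map x [0..<k])})"

lemma suslin_basic: "C \<in> \<R> \<Longrightarrow> suslin \<R> C"
  unfolding suslin_def by (rule exI[of _ "\<lambda>_. C"]) auto

text \<open>The first entry of a branch selects the set, the remaining ones follow its scheme.
  \<open>Z\<close> stands at the root, where nothing has been selected yet, so it has to contain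
  every \<open>D i\<close>.\<close>

lemma suslin_UN:
  fixes D :: "nat \<Rightarrow> 'z set"
  assumes "Z \<in> \<R>" and D: "\<And>i. suslin \<R> (D i)" "\<And>i. D i \<subseteq> Z"
  shows "suslin \<R> (\<Union>i. D i)"
proof -
  have "\<forall>i. \<exists>R :: nat list \<Rightarrow> 'z set. (\<forall>u. R u \<in> \<R>) \<and> D i = {z. \<exists>x. \<forall>k. z \<in> R (map x [0..<k])}"
    using D(1) unfolding suslin_def by simp
  from choice[OF this] obtain R :: "nat \<Rightarrow> nat list \<Rightarrow> 'z set" where R: "\<And>i u. R i u \<in> \<R>"
    and DR: "\<And>i. D i = {z. \<exists>x. \<forall>k. z \<in> R i (map x [0..<k])}"
    by blast
  define S where "S u = (case u of [] \<Rightarrow> Z | i # v \<Rightarrow> R i v)" for u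
  have "(\<Union>i. D i) = {z. \<exists>x. \<forall>k. z \<in> S (map x [0..<k])}"
  proof (rule Set.set_eqI, rule iffI)
    fix z assume "z \<in> (\<Union>i. D i)"
    then obtain i x where z: "z \<in> Z" "\<And>k. z \<in> R i (map x [0..<k])"
      using D(2) DR by blast
    have "z \<in> S (map (case_nat i x) [0..<k])" for k
      using z by (cases k) (simp_all add: S_def map_upt_Suc del: upt_Suc)
    then show "z \<in> {z. \<exists>x. \<forall>k. z \<in> S (map x [0..<k])}" by blast
  next
    fix z assume "z \<in> {z. \<exists>x. \<forall>k. z \<in> S (map x [0..<k])}"
    then obtain x where x: "\<And>k. z \<in> S (map x [0..<k])" by blast
    have "z \<in> R (x 0) (map (\<lambda>i. x (Suc i)) [0..<k])" for k
      using x[of "Suc k"] by (simp add: S_def map_upt_Suc del: upt_Suc)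
    then show "z \<in> (\<Union>i. D i)" using DR by blast
  qed
  moreover have "S u \<in> \<R>" for u
    using assms(1) R by (simp add: S_def split: list.split)
  ultimately show ?thesis unfolding suslin_def by blast
qed

text \<open>One branch codes branches for all \<open>i\<close> by pairing. The node of length
  \<open>prod_encode (i, j)\<close> tests level \<open>j\<close> of the scheme for
  \<open>D i\<close>; by \<open>less\<close>, all entries which that test reads have been chosen
  before.\<close>

lemma suslin_INT:
  fixes D :: "nat \<Rightarrow> 'z set"
  assumes D: "\<And>i. suslin \<R> (D i)"
  shows "suslin \<R> (\<Inter>i. D i)"
proof -
  have "\<forall>i. \<exists>R :: nat list \<Rightarrow> 'z set. (\<forall>u. R u \<in> \<R>) \<and> D i = {z. \<exists>x. \<forall>k. z \<in> R (map x [0..<k])}"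
    using D(1) unfolding suslin_def by simp
  from choice[OF this] obtain R :: "nat \<Rightarrow> nat list \<Rightarrow> 'z set" where R: "\<And>i u. R i u \<in> \<R>"
    and DR: "\<And>i. D i = {z. \<exists>x. \<forall>k. z \<in> R i (map x [0..<k])}"
    by blast
  define S where "S u = (case prod_decode (length u) of
    (i, j) \<Rightarrow> R i (map (\<lambda>l. u ! prod_encode (i, l)) [0..<j]))" for u
  have less: "prod_encode (i, l) < prod_encode (i, j)" if "l < j" for i l j
  proof -
    have "triangle (i + l) < triangle (i + j)"
      using that by (induction j) (auto simp: less_Suc_eq)
    then show ?thesis by (simp add: prod_encode_def)
  qed
  have S: "S (map x [0..<prod_encode (i, j)]) = R i (map (\<lambda>l. x (prod_encode (i, l))) [0..<j])"
    for x i j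
    using less by (auto simp: S_def intro!: arg_cong[of _ _ "R i"])
  have "(\<Inter>i. D i) = {z. \<exists>x. \<forall>k. z \<in> S (map x [0..<k])}"
  proof (rule Set.set_eqI, rule iffI)
    fix z assume "z \<in> (\<Inter>i. D i)"
    then have "\<forall>i. \<exists>x. \<forall>k. z \<in> R i (map x [0..<k])"
      using DR by blast
    then obtain x where x: "\<And>i k. z \<in> R i (map (x i) [0..<k])" by metis
    have "z \<in> S (map (\<lambda>n. case prod_decode n of (i, l) \<Rightarrow> x i l) [0..<prod_encode (i, j)])" for i j
      using x by (simp add: S)
    then have "z \<in> S (map (\<lambda>n. case prod_decode n of (i, l) \<Rightarrow> x i l) [0..<k])" for k
      by (metis prod.collapse prod_decode_inverse)
    then show "z \<in> {z. \<exists>x. \<forall>k. z \<in> S (map x [0..<k])}" by blast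
  next
    fix z assume "z \<in> {z. \<exists>x. \<forall>k. z \<in> S (map x [0..<k])}"
    then obtain x where x: "\<And>k. z \<in> S (map x [0..<k])" by blast
    have "z \<in> R i (map (\<lambda>l. x (prod_encode (i, l))) [0..<j])" for i j
      using x[of "prod_encode (i, j)"] by (simp add: S)
    then show "z \<in> (\<Inter>i. D i)" using DR by blast
  qed
  moreover have "S u \<in> \<R>" for u
    using R by (simp add: S_def split: prod.split)
  ultimately show ?thesis unfolding suslin_def by blast
qed

definition clopen_seq :: "(nat \<Rightarrow> 'a) set \<Rightarrow> bool" where
  "clopen_seq C \<longleftrightarrow> (\<forall>e. \<exists>n. \<forall>e'. (\<forall>i<n. e' i = e i) \<longrightarrow> (e' \<in> C \<longleftrightarrow> e \<in> C))"

definition closed_rects :: "'g topology \<Rightarrow> ((nat \<Rightarrow> 'a) \<times> 'g) set set" where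
  "closed_rects T = {C \<times> L | C L. clopen_seq C \<and> closedin T L}"

lemma clopen_seq_UNIV [simp]: "clopen_seq UNIV" and clopen_seq_empty [simp]: "clopen_seq {}"
  by (simp_all add: clopen_seq_def)

lemma clopen_seq_component: "clopen_seq {e. e i \<in> S}"
  unfolding clopen_seq_def by (intro allI exI[of _ "Suc i"]) auto

lemma closed_rects_empty: "{} \<in> closed_rects T"
  unfolding closed_rects_def by (force intro!: exI[of _ "{}"])

lemma closed_rectsI: "clopen_seq C \<Longrightarrow> closedin T L \<Longrightarrow> C \<times> L \<in> closed_rects T"
  unfolding closed_rects_def by blast

text \<open>The sets that are Suslin together with their complements form a \<sigma>-algebra. Both
  projections are measurable for it, the second one because open sets of a metrizable space are
  countable unions of closed sets.\<close>

lemma borel_imp_suslin: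
  fixes T :: "'g topology" and D :: "((nat \<Rightarrow> 'a) \<times> 'g) set"
  assumes "metrizable_space T" and "D \<in> sets (Pi\<^sub>M UNIV (\<lambda>_. count_space UNIV) \<Otimes>\<^sub>M borel_of T)"
  shows "suslin (closed_rects T) D"
proof -
  let ?Z = "(UNIV :: (nat \<Rightarrow> 'a) set) \<times> topspace T"
  let ?\<R> = "closed_rects T :: ((nat \<Rightarrow> 'a) \<times> 'g) set set"
  define \<S> where "\<S> = {D. D \<subseteq> ?Z \<and> suslin ?\<R> D \<and> suslin ?\<R> (?Z - D)}"
  have Z: "?Z \<in> ?\<R>" by (rule closed_rectsI) auto
  have sig: "sigma_algebra ?Z \<S>"
    unfolding sigma_algebra_iff2
  proof (intro conjI ballI allI impI)
    show "\<S> \<subseteq> Pow ?Z" by (auto simp: \<S>_def)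
    show "{} \<in> \<S>" using Z closed_rects_empty by (auto simp: \<S>_def intro: suslin_basic)
    show "?Z - D \<in> \<S>" if "D \<in> \<S>" for D
      using that by (auto simp: \<S>_def double_diff)
    show "\<Union>(range D) \<in> \<S>" if "range D \<subseteq> \<S>" for D :: "nat \<Rightarrow> _"
    proof -
      have D: "D i \<subseteq> ?Z" "suslin ?\<R> (D i)" "suslin ?\<R> (?Z - D i)" for i
        using that by (auto simp: \<S>_def)
      have "?Z - \<Union>(range D) = (\<Inter>i. ?Z - D i)" by blast
      moreover have "suslin ?\<R> (\<Inter>i. ?Z - D i)" by (intro suslin_INT D)
      moreover have "suslin ?\<R> (\<Union>(range D))" by (intro suslin_UN[OF Z] D)
      moreover have "\<Union>(range D) \<subseteq> ?Z" using D(1) by blast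
      ultimately show ?thesis by (simp add: \<S>_def)
    qed
  qed
  define N where "N = sigma ?Z \<S>"
  have N: "space N = ?Z" "sets N = \<S>"
    using sig by (simp_all add: N_def sigma_algebra.sets_measure_of_eq space_measure_of_conv)
  have "fst \<in> N \<rightarrow>\<^sub>M Pi\<^sub>M UNIV (\<lambda>_. count_space UNIV)"
  proof (rule measurable_PiM_single)
    fix S :: "'a set" and i :: nat
    have "{z \<in> space N. fst z i \<in> S} = {e. e i \<in> S} \<times> topspace T"
      "?Z - {z \<in> space N. fst z i \<in> S} = {e. e i \<in> - S} \<times> topspace T"
      by (auto simp: N)
    moreover have "suslin ?\<R> ({e. e i \<in> U} \<times> topspace T)" for U
      by (intro suslin_basic closed_rectsI clopen_seq_component) auto
    moreover have "{e. e i \<in> S} \<times> topspace T \<subseteq> ?Z" by blast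
    ultimately show "{z \<in> space N. fst z i \<in> S} \<in> sets N"
      unfolding N(2) \<S>_def mem_Collect_eq by metis
  qed (auto simp: space_PiM)
  moreover have "snd \<in> N \<rightarrow>\<^sub>M borel_of T"
    unfolding borel_of_def
  proof (rule measurable_measure_of)
    fix U assume "U \<in> {U. openin T U}"
    then have U: "openin T U" by simp
    then have "fsigma_in T U"
      using assms(1) open_imp_fsigma_in by blast
    then obtain L where L: "\<And>n::nat. closedin T (L n)" "U = \<Union>(range L)"
      unfolding fsigma_in_ascending by blast
    have "snd -` U \<inter> space N = (\<Union>n. UNIV \<times> L n)"
      using L closedin_subset by (fastforce simp: N)
    moreover have "suslin ?\<R> (\<Union>n. UNIV \<times> L n)"
      using L(1) closedin_subset
      by (intro suslin_UN[OF Z] suslin_basic closed_rectsI) auto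
    moreover have "?Z - (snd -` U \<inter> space N) = UNIV \<times> (topspace T - U)"
      by (auto simp: N)
    moreover have "suslin ?\<R> (UNIV \<times> (topspace T - U))"
      using U by (intro suslin_basic closed_rectsI) auto
    ultimately show "snd -` U \<inter> space N \<in> sets N"
      unfolding N(2) \<S>_def N(1) by auto
  qed (use openin_subset in \<open>auto simp: N\<close>)
  ultimately have "(\<lambda>z. (fst z, snd z)) \<in> N \<rightarrow>\<^sub>M Pi\<^sub>M UNIV (\<lambda>_. count_space UNIV) \<Otimes>\<^sub>M borel_of T"
    by (rule measurable_Pair)
  from measurable_sets[OF this assms(2)] have "D \<inter> ?Z \<in> \<S>"
    by (simp add: N)
  moreover have "D \<subseteq> ?Z"
    using sets.sets_into_space[OF assms(2)]
    by (auto simp: space_pair_measure borel_of_def space_measure_of_conv)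
  ultimately show ?thesis by (simp add: \<S>_def Int_absorb2)
qed

text \<open>A branch of the new scheme codes a branch of the old one and a sequence of shrinking
  balls around a witness. A node survives as long as the closed sets collected for the witness meet,
  and completeness turns an infinite path of surviving nodes back into a witness.\<close>

lemma (in Metric_space) suslin_projection:
  fixes D :: "((nat \<Rightarrow> 'b) \<times> 'a) set" and h :: "nat \<Rightarrow> 'a"
  assumes "mcomplete" and h: "\<And>w \<epsilon>. w \<in> M \<Longrightarrow> \<epsilon> > 0 \<Longrightarrow> \<exists>i. w \<in> mcball (h i) \<epsilon>"
    and D: "suslin (closed_rects mtopology) D"
  shows "suslin {C. clopen_seq C} (fst ` D)"
proof -
  obtain R :: "nat list \<Rightarrow> _" where R: "(\<forall>u. R u \<in> closed_rects mtopology) \<and>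
      D = {z. \<exists>x. \<forall>k. z \<in> R (map x [0..<k])}"
    using D unfolding suslin_def by blast
  then have DR: "D = {z. \<exists>x. \<forall>k. z \<in> R (map x [0..<k])}" ..
  have "\<forall>u. \<exists>C L. R u = C \<times> L \<and> clopen_seq C \<and> closedin mtopology L"
    using R unfolding closed_rects_def by blast
  then obtain C L where CL: "\<And>u. R u = C u \<times> L u" "\<And>u. clopen_seq (C u)"
    "\<And>u. closedin mtopology (L u)" by metis
  let ?a = "\<lambda>n. fst (prod_decode n)" and ?b = "\<lambda>n. snd (prod_decode n)"
  \<comment> \<open>All requirements on the witness up to level \<open>k\<close> are collected so
    that these sets decrease; the radii \<open>1 / 2 ^ j\<close> make them small enough for the
    nested-set form of completeness.\<close>
  define N where "N y k = (\<Inter>j\<in>{..k}. L (map (?a \<circ> y) [0..<j])) \<inter>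
    (\<Inter>j\<in>{..<k}. mcball (h (?b (y j))) (1 / 2 ^ j))" for y and k :: nat
  \<comment> \<open>Whether the witness sets meet depends on the node and not on the sequence, so
    the value of the scheme stays clopen: it is empty or an old first factor.\<close>
  define S where "S u = (if N (\<lambda>i. u ! i) (length u) = {} then {} else C (map ?a u))" for u
  have NS: "N (\<lambda>i. map y [0..<k] ! i) (length (map y [0..<k])) = N y k" for y k
  proof -
    have "map (?a \<circ> (\<lambda>i. map y [0..<k] ! i)) [0..<j] = map (?a \<circ> y) [0..<j]" if "j \<le> k" for j
      using that by simp
    then have "(\<Inter>j\<in>{..k}. L (map (?a \<circ> (\<lambda>i. map y [0..<k] ! i)) [0..<j])) =
        (\<Inter>j\<in>{..k}. L (map (?a \<circ> y) [0..<j]))"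
      by (intro INF_cong) (simp_all only: atMost_iff)
    moreover have "(\<Inter>j\<in>{..<k}. mcball (h (?b (map y [0..<k] ! j))) (1 / 2 ^ j)) =
        (\<Inter>j\<in>{..<k}. mcball (h (?b (y j))) (1 / 2 ^ j))"
      by (intro INF_cong) simp_all
    ultimately show ?thesis by (simp only: N_def length_map length_upt diff_zero)
  qed
  have "fst ` D = {e. \<exists>y. \<forall>k. e \<in> S (map y [0..<k])}"
  proof (rule Set.set_eqI, rule iffI)
    fix e assume "e \<in> fst ` D"
    then obtain w x where "\<And>k. (e, w) \<in> R (map x [0..<k])" using DR by fastforce
    then have w: "e \<in> C (map x [0..<k])" "w \<in> L (map x [0..<k])" for k
      using CL(1) by auto
    then have "w \<in> M" using CL(3) closedin_subset by fastforce
    then have "\<forall>j::nat. \<exists>i. w \<in> mcball (h i) (1 / 2 ^ j)" using h by simp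
    then obtain c where c: "\<And>j::nat. w \<in> mcball (h (c j)) (1 / 2 ^ j)" by metis
    let ?y = "\<lambda>j. prod_encode (x j, c j)"
    have "?a \<circ> ?y = x" by auto
    then have "w \<in> N ?y k" for k
      using w(2) c by (auto simp: N_def)
    then have "N ?y k \<noteq> {}" for k by blast
    then have "e \<in> S (map ?y [0..<k])" for k
      using w(1)[of k] unfolding S_def NS by (simp add: comp_def)
    then show "e \<in> {e. \<exists>y. \<forall>k. e \<in> S (map y [0..<k])}"
      by (intro CollectI exI[of _ ?y]) blast
  next
    fix e assume "e \<in> {e. \<exists>y. \<forall>k. e \<in> S (map y [0..<k])}"
    then obtain y where y: "\<And>k. e \<in> S (map y [0..<k])" by blast
    have Ny: "N y k \<noteq> {}" "e \<in> C (map (?a \<circ> y) [0..<k])" for k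
      using y[of k] unfolding S_def NS by (simp_all split: if_splits)
    have "closedin mtopology (N y k)" for k
      unfolding N_def using CL(3)
      by (cases "k = 0") (auto intro!: closedin_Int closedin_INT)
    moreover have "decseq (N y)"
      by (auto simp: N_def decseq_def)
    moreover have "\<exists>n a. N y n \<subseteq> mcball a \<epsilon>" if "\<epsilon> > 0" for \<epsilon>
    proof -
      obtain j where j: "(1 / 2) ^ j < \<epsilon>"
        using real_arch_pow_inv[of \<epsilon> "1/2"] \<open>\<epsilon> > 0\<close> by auto
      have "N y (Suc j) \<subseteq> mcball (h (?b (y j))) (1 / 2 ^ j)"
        by (auto simp: N_def)
      also have "\<dots> \<subseteq> mcball (h (?b (y j))) \<epsilon>"
        using j by (intro mcball_subset_concentric) (simp add: power_one_over)
      finally show ?thesis by blast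
    qed
    ultimately have "(\<Inter>n. N y n) \<noteq> {}"
      using assms(1) Ny(1) unfolding mcomplete_nest by blast
    then obtain w where "\<And>n. w \<in> N y n" by blast
    then have "w \<in> L (map (?a \<circ> y) [0..<k])" for k
      by (auto simp: N_def)
    then have "(e, w) \<in> D"
      using Ny(2) by (auto simp: DR CL(1))
    then show "e \<in> fst ` D" by force
  qed
  moreover have "clopen_seq (S u)" for u
    using CL(2) by (simp add: S_def)
  ultimately show ?thesis unfolding suslin_def by blast
qed

section \<open>Sequence spaces over countable sets\<close>

definition cyl :: "'a list \<Rightarrow> (nat \<Rightarrow> 'a) set" where
  "cyl t = {e. \<forall>i < length t. e i = t ! i}"

definition seqs :: "'a set \<Rightarrow> (nat \<Rightarrow> 'a) topology" where
  "seqs A = product_topology (\<lambda>_. discrete_topology A) UNIV"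

lemma topspace_seqs [simp]: "topspace (seqs A) = {e. range e \<subseteq> A}"
  by (auto simp: seqs_def PiE_def)

lemma cyl_prefix [simp]: "e \<in> cyl (map e [0..<n])"
  by (simp add: cyl_def)

lemma cyl_map_iff: "e' \<in> cyl (map e [0..<n]) \<longleftrightarrow> (\<forall>i<n. e' i = e i)"
  by (auto simp: cyl_def)

lemma cyl_append_subset: "cyl (t @ s) \<subseteq> cyl t"
  by (auto simp: cyl_def nth_append)

lemma prefix_in_lists: "range e \<subseteq> A \<Longrightarrow> map e [0..<n] \<in> lists A"
  by (auto simp: in_lists_conv_set)

lemma cyl_nonempty:
  assumes "t \<in> lists A" "A \<noteq> {}"
  obtains e where "e \<in> cyl t" "range e \<subseteq> A"
proof -
  obtain a where "a \<in> A" using assms by blast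
  then have "range (\<lambda>i. if i < length t then t ! i else a) \<subseteq> A"
    using assms(1) by (auto simp: in_lists_conv_set)
  then show thesis
    using that[of "\<lambda>i. if i < length t then t ! i else a"] by (simp add: cyl_def)
qed

lemma openin_seqs:
  "openin (seqs A) U \<longleftrightarrow> U \<subseteq> {e. range e \<subseteq> A} \<and>
     (\<forall>e \<in> U. \<exists>n. \<forall>e'. range e' \<subseteq> A \<longrightarrow> (\<forall>i<n. e' i = e i) \<longrightarrow> e' \<in> U)"
  (is "?L \<longleftrightarrow> ?R")
proof
  assume L: ?L
  show ?R
  proof (intro conjI ballI)
    show "U \<subseteq> {e. range e \<subseteq> A}" using openin_subset[OF L] by simp
    fix e assume "e \<in> U"
    then obtain V where V: "finite {i. V i \<noteq> A}" "e \<in> Pi\<^sub>E UNIV V" "Pi\<^sub>E UNIV V \<subseteq> U"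
      using L unfolding seqs_def openin_product_topology_alt by auto
    obtain n where n: "\<And>i. V i \<noteq> A \<Longrightarrow> i < n"
      using finite_nat_set_iff_bounded[THEN iffD1, OF V(1)] by auto
    have "e' \<in> U" if "range e' \<subseteq> A" "\<forall>i<n. e' i = e i" for e'
    proof -
      have "e' i \<in> V i" for i
        using n[of i] V(2) that by (cases "V i = A") (auto simp: PiE_def)
      then show ?thesis using V(3) by (auto simp: PiE_def)
    qed
    then show "\<exists>n. \<forall>e'. range e' \<subseteq> A \<longrightarrow> (\<forall>i<n. e' i = e i) \<longrightarrow> e' \<in> U" by blast
  qed
next
  assume R: ?R
  show ?L
    unfolding seqs_def openin_product_topology_alt
  proof
    fix e assume e: "e \<in> U"
    then have eA: "range e \<subseteq> A" using R by blast
    obtain n where n: "\<And>e'. range e' \<subseteq> A \<Longrightarrow> (\<forall>i<n. e' i = e i) \<Longrightarrow> e' \<in> U"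
      using R e by blast
    let ?V = "\<lambda>i. if i < n then {e i} else A"
    have "finite {i \<in> UNIV. ?V i \<noteq> topspace (discrete_topology A)}"
      by (rule finite_subset[of _ "{..<n}"]) auto
    moreover have "Pi\<^sub>E UNIV ?V \<subseteq> U"
    proof
      fix e' assume "e' \<in> Pi\<^sub>E UNIV ?V"
      then have e': "e' i \<in> ?V i" for i by (rule PiE_mem) simp
      have "e' i \<in> A" for i using e'[of i] eA by (auto split: if_splits)
      moreover have "\<forall>i<n. e' i = e i" using e' by (metis singletonD)
      ultimately show "e' \<in> U" using n by blast
    qed
    moreover have "e \<in> Pi\<^sub>E UNIV ?V" "\<forall>i\<in>UNIV. openin (discrete_topology A) (?V i)"
      using eA by auto
    ultimately show "\<exists>V. finite {i \<in> UNIV. V i \<noteq> topspace (discrete_topology A)} \<and>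
        (\<forall>i\<in>UNIV. openin (discrete_topology A) (V i)) \<and> e \<in> Pi\<^sub>E UNIV V \<and> Pi\<^sub>E UNIV V \<subseteq> U"
      by (intro exI[of _ ?V] conjI)
  qed
qed

lemma openin_seqs_cyl: "openin (seqs A) (cyl t \<inter> {e. range e \<subseteq> A})"
  unfolding openin_seqs
proof (intro conjI ballI)
  fix e assume "e \<in> cyl t \<inter> {e. range e \<subseteq> A}"
  then show "\<exists>n. \<forall>e'. range e' \<subseteq> A \<longrightarrow> (\<forall>i<n. e' i = e i) \<longrightarrow> e' \<in> cyl t \<inter> {e. range e \<subseteq> A}"
    by (intro exI[of _ "length t"]) (simp add: cyl_def)
qed blast

lemma openin_seqs_cylE:
  assumes "openin (seqs A) U" "e \<in> U"
  obtains n where "\<And>m. n \<le> m \<Longrightarrow> cyl (map e [0..<m]) \<inter> {e. range e \<subseteq> A} \<subseteq> U"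
proof -
  obtain n where n: "\<forall>e'. range e' \<subseteq> A \<longrightarrow> (\<forall>i<n. e' i = e i) \<longrightarrow> e' \<in> U"
    using assms unfolding openin_seqs by blast
  have "cyl (map e [0..<m]) \<inter> {e. range e \<subseteq> A} \<subseteq> U" if "n \<le> m" for m
    using that n by (auto simp: cyl_map_iff)
  then show thesis by (rule that)
qed

lemma completely_metrizable_seqs: "completely_metrizable_space (seqs A)"
proof -
  have "countable {i::nat. P i}" for P by (rule countableI_type)
  then show ?thesis
    unfolding seqs_def completely_metrizable_space_product_topology
    by (auto intro: completely_metrizable_space_discrete_topology)
qed

lemma second_countable_seqs:
  assumes "countable A"
  shows "second_countable (seqs A)"
  unfolding second_countable_def
proof (intro exI conjI allI ballI impI)
  let ?B = "(\<lambda>t. cyl t \<inter> {e. range e \<subseteq> A}) ` lists A"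
  show "countable ?B" using assms by (intro countable_image countable_lists)
  show "openin (seqs A) V" if "V \<in> ?B" for V
    using that openin_seqs_cyl by blast
  fix U e assume U: "openin (seqs A) U \<and> e \<in> U"
  then obtain n where n: "cyl (map e [0..<n]) \<inter> {e. range e \<subseteq> A} \<subseteq> U"
    by (metis openin_seqs_cylE order_refl)
  moreover have "range e \<subseteq> A" using U openin_subset by fastforce
  ultimately show "\<exists>V \<in> ?B. e \<in> V \<and> V \<subseteq> U"
    by (intro bexI[of _ "cyl (map e [0..<n]) \<inter> {e. range e \<subseteq> A}"]) (auto simp: prefix_in_lists)
qed

text \<open>Every finite initial segment can be continued by a given element of \<open>A\<close>, so
  hitting that element is dense open. Generic sequences over \<open>A\<close> are therefore pairwise
  equivalent for equality of ranges.\<close>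

lemma comeager_range_eq:
  fixes A :: "'a set"
  assumes "countable A"
  shows "comeager (seqs A) {e. range e = A}"
proof -
  let ?S = "\<lambda>a. {e :: nat \<Rightarrow> 'a. range e \<subseteq> A \<and> a \<in> range e}"
  have "comeager (seqs A) (?S a)" if a: "a \<in> A" for a
  proof (rule comeager_dense_open)
    show "openin (seqs A) (?S a)"
      unfolding openin_seqs
    proof (intro conjI ballI)
      fix e assume "e \<in> ?S a"
      then obtain i where "a = e i" by blast
      then show "\<exists>n. \<forall>e'. range e' \<subseteq> A \<longrightarrow> (\<forall>i<n. e' i = e i) \<longrightarrow> e' \<in> ?S a"
        by (intro exI[of _ "Suc i"]) (metis (mono_tags, lifting) lessI mem_Collect_eq rangeI)
    qed blast
    fix V assume V: "openin (seqs A) V" "V \<noteq> {}"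
    then obtain e where e: "e \<in> V" by blast
    then have eA: "range e \<subseteq> A" using V(1) openin_subset by fastforce
    obtain n where n: "cyl (map e [0..<n]) \<inter> {e. range e \<subseteq> A} \<subseteq> V"
      using V(1) e by (metis openin_seqs_cylE order_refl)
    have "range (e(n := a)) \<subseteq> A" "a \<in> range (e(n := a))" using eA a by auto
    moreover have "e(n := a) \<in> cyl (map e [0..<n])" by (simp add: cyl_map_iff)
    ultimately show "?S a \<inter> V \<noteq> {}" using n by blast
  qed
  then have "comeager (seqs A) (\<Inter>a\<in>A. ?S a)"
    by (intro comeager_INT assms)
  then show ?thesis by (rule comeager_mono) auto
qed

section \<open>Forcing along Suslin schemes\<close>

locale countable_base =
  fixes T :: "'g topology" and B :: "nat \<Rightarrow> 'g set"
  assumes base_open: "openin T (B n)" and base_nonempty: "B n \<noteq> {}"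
    and base: "openin T U \<Longrightarrow> x \<in> U \<Longrightarrow> \<exists>n. x \<in> B n \<and> B n \<subseteq> U"
begin

text \<open>A condition is a finite sequence with the index of a basic open set. Its box consists of
  sequences over the whole type, so that no set \<open>A\<close> enters the forcing
  relation.\<close>

definition box :: "'a list \<times> nat \<Rightarrow> ((nat \<Rightarrow> 'a) \<times> 'g) set" where
  "box p = cyl (fst p) \<times> B (snd p)"

definition below :: "'a list \<times> nat \<Rightarrow> 'a list \<times> nat \<Rightarrow> bool" where
  "below q p \<longleftrightarrow> (\<exists>s. fst q = fst p @ s) \<and> B (snd q) \<subseteq> B (snd p)"

definition space_over :: "'a set \<Rightarrow> ((nat \<Rightarrow> 'a) \<times> 'g) topology" where
  "space_over A = prod_topology (seqs A) T"

lemma topspace_space_over: "topspace (space_over A) = {e. range e \<subseteq> A} \<times> topspace T"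
  by (simp add: space_over_def)

lemma below_refl: "below p p"
  by (simp add: below_def)

lemma below_trans: "below r q \<Longrightarrow> below q p \<Longrightarrow> below r p"
  by (fastforce simp: below_def)

lemma box_mono: "below q p \<Longrightarrow> box q \<subseteq> box p"
  using cyl_append_subset by (fastforce simp: below_def box_def)

lemma open_box: "openin (space_over A) (box p \<inter> topspace (space_over A))"
proof -
  have "box p \<inter> topspace (space_over A) = (cyl (fst p) \<inter> {e. range e \<subseteq> A}) \<times> B (snd p)"
    using base_open openin_subset by (fastforce simp: box_def topspace_space_over)
  then show ?thesis
    by (simp add: space_over_def openin_prod_Times_iff openin_seqs_cyl base_open)
qed

lemma box_nonempty:
  assumes "fst p \<in> lists A" "A \<noteq> {}"
  shows "box p \<inter> topspace (space_over A) \<noteq> {}"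
proof -
  obtain e where "e \<in> cyl (fst p)" "range e \<subseteq> A" using cyl_nonempty[OF assms] .
  moreover obtain h where "h \<in> B (snd p)" using base_nonempty by blast
  moreover have "h \<in> topspace T" using base_open openin_subset \<open>h \<in> B (snd p)\<close> by blast
  ultimately have "(e, h) \<in> box p \<inter> topspace (space_over A)"
    by (simp add: box_def topspace_space_over)
  then show ?thesis by blast
qed

lemma below_exists:
  assumes "openin (space_over A) U" "z \<in> U" "z \<in> box p"
  obtains q where "below q p" "fst q \<in> lists A" "z \<in> box q" "box q \<inter> topspace (space_over A) \<subseteq> U"
proof -
  obtain e h where z: "z = (e, h)" by force
  obtain U1 U2 where U: "openin (seqs A) U1" "openin T U2" "e \<in> U1" "h \<in> U2" "U1 \<times> U2 \<subseteq> U"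
    using assms(1,2) openin_prod_topology_alt[of "seqs A" T U] by (metis space_over_def z)
  obtain n where n: "\<And>m. n \<le> m \<Longrightarrow> cyl (map e [0..<m]) \<inter> {e. range e \<subseteq> A} \<subseteq> U1"
    using U(1,3) by (rule openin_seqs_cylE) blast
  have eA: "range e \<subseteq> A" using U openin_subset by fastforce
  have e: "e \<in> cyl (fst p)" "h \<in> B (snd p)" using assms(3) by (auto simp: z box_def)
  have "openin T (U2 \<inter> B (snd p))" using U(2) base_open by (rule openin_Int)
  then obtain m where m: "h \<in> B m" "B m \<subseteq> U2 \<inter> B (snd p)"
    using base U(4) e(2) by blast
  define l where "l = max n (length (fst p))"
  have "map e [0..<l] = fst p @ map e [length (fst p)..<l]"
  proof -
    have "[0..<l] = [0..<length (fst p)] @ [length (fst p)..<l]"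
      using upt_add_eq_append[of 0 "length (fst p)" "l - length (fst p)"] by (simp add: l_def)
    moreover have "map e [0..<length (fst p)] = fst p"
      using e(1) by (auto simp: cyl_def intro: nth_equalityI)
    ultimately show ?thesis by simp
  qed
  then have "below (map e [0..<l], m) p" using m by (auto simp: below_def)
  moreover have "box (map e [0..<l], m) \<inter> topspace (space_over A) \<subseteq> U"
    using n[of l] m(2) U(5) by (fastforce simp: box_def topspace_space_over l_def)
  moreover have "z \<in> box (map e [0..<l], m)" using m(1) by (simp add: z box_def)
  ultimately show thesis
    using that[of "(map e [0..<l], m)"] eA by (simp add: prefix_in_lists)
qed

text \<open>Two conditions that contain a common point are compatible: a long enough initial segment
  of its sequence extends both lists, and a basic set fits into the intersection of the two open
  sets.\<close>

lemma below_both: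
  assumes "z \<in> box p" "z \<in> box q"
  shows "\<exists>r. below r p \<and> below r q"
proof -
  obtain e h where eh: "z = (e, h)" by force
  have h: "h \<in> B (snd q) \<inter> B (snd p)" "e \<in> cyl (fst q)" "e \<in> cyl (fst p)"
    using assms by (auto simp: eh box_def)
  obtain m where m: "h \<in> B m" "B m \<subseteq> B (snd q) \<inter> B (snd p)"
    using base[OF openin_Int[OF base_open base_open] h(1)] by blast
  let ?l = "length (fst p) + length (fst q)"
  have "map e [0..<?l] = t @ map e [length t..<?l]" if "e \<in> cyl t" "length t \<le> ?l" for t
    using that by (auto simp: cyl_def nth_append intro!: nth_equalityI)
  from this[OF h(2)] this[OF h(3)] have "below (map e [0..<?l], m) p \<and> below (map e [0..<?l], m) q"
    using m unfolding below_def fst_conv snd_conv by (metis Int_subset_iff le_add1 le_add2)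
  then show ?thesis by blast
qed

lemma countable_conditions: "countable A \<Longrightarrow> countable {p :: 'a list \<times> nat. fst p \<in> lists A}"
proof -
  assume "countable A"
  then have "countable (lists A \<times> (UNIV :: nat set))" by simp
  moreover have "{p :: 'a list \<times> nat. fst p \<in> lists A} = lists A \<times> UNIV" by auto
  ultimately show ?thesis by simp
qed

text \<open>The part of the Suslin set with a witness passing through \<open>u\<close>, tested from
  level \<open>length u\<close> on. These parts are what the recursion for the forcing relation runs
  through.\<close>

definition branch :: "(nat list \<Rightarrow> 'z set) \<Rightarrow> nat list \<Rightarrow> 'z set" where
  "branch R u = {z. \<exists>x. (\<forall>i<length u. x i = u ! i) \<and> (\<forall>k\<ge>length u. z \<in> R (map x [0..<k]))}"

lemma branch_subset: "branch R u \<subseteq> R u"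
proof
  fix z assume "z \<in> branch R u"
  then obtain x where x: "\<forall>i<length u. x i = u ! i" "z \<in> R (map x [0..<length u])"
    by (auto simp: branch_def)
  moreover have "map x [0..<length u] = u" using x(1) by (auto intro: nth_equalityI)
  ultimately show "z \<in> R u" by simp
qed

lemma branch_step: "branch R u \<subseteq> (\<Union>i. branch R (u @ [i]))"
proof
  fix z assume "z \<in> branch R u"
  then obtain x where x: "\<forall>i<length u. x i = u ! i" "\<forall>k\<ge>length u. z \<in> R (map x [0..<k])"
    by (auto simp: branch_def)
  then have "z \<in> branch R (u @ [x (length u)])"
    by (auto simp: branch_def nth_append less_Suc_eq intro!: exI[of _ x])
  then show "z \<in> (\<Union>i. branch R (u @ [i]))" by blast
qed

lemma branch_Nil: "branch R [] = {z. \<exists>x. \<forall>k. z \<in> R (map x [0..<k])}"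
  by (simp add: branch_def)

text \<open>\<open>negl R p u\<close> is the statement that \<open>p\<close> forces the generic point to lie outside \<open>branch R u\<close>;
  being an inductive predicate on all finite sequences, it does not refer to any countable set.\<close>

inductive negl :: "(nat list \<Rightarrow> ((nat \<Rightarrow> 'a) \<times> 'g) set) \<Rightarrow> 'a list \<times> nat \<Rightarrow> nat list \<Rightarrow> bool"
  for R where
  disjoint: "box p \<inter> R u = {} \<Longrightarrow> negl R p u"
| step: "(\<And>q i. below q p \<Longrightarrow> \<exists>r. below r q \<and> negl R r (u @ [i])) \<Longrightarrow> negl R p u"

text \<open>Weak forcing of a positive statement: no stronger condition forces the negation. Hence
  every condition has a stronger one that decides.\<close>

definition forces :: "(nat list \<Rightarrow> ((nat \<Rightarrow> 'a) \<times> 'g) set) \<Rightarrow> 'a list \<times> nat \<Rightarrow> nat list \<Rightarrow> bool" where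
  "forces R p u \<longleftrightarrow> (\<forall>q. below q p \<longrightarrow> \<not> negl R q u)"

lemma forces_mono: "forces R p u \<Longrightarrow> below q p \<Longrightarrow> forces R q u"
  unfolding forces_def using below_trans by blast

text \<open>Induction on \<open>negl\<close>. In the recursive case the strengthenings
  \<open>r q i\<close> are fixed by choice before any \<open>A\<close>. If \<open>A\<close> is
  closed under \<open>r\<close>, their boxes are dense in the box of \<open>p\<close> for each
  \<open>i\<close>, and the sets \<open>branch R (u @ [i])\<close> cover
  \<open>branch R u\<close>.\<close>

lemma negl_imp_comeager:
  assumes "negl R p u"
  shows "club (\<lambda>A. fst p \<in> lists A \<longrightarrow> comeager (space_over A) (- box p \<union> - branch R u))"
  using assms
proof (induction p u rule: negl.induct)
  case (disjoint p u)
  then have "- box p \<union> - branch R u = UNIV" using branch_subset[of R u] by blast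
  then have "fst p \<in> lists A \<longrightarrow> comeager (space_over A) (- box p \<union> - branch R u)" for A
    by (simp add: comeager_UNIV)
  then show ?case by (intro club_mono[OF club_const[of True]]) simp_all
next
  case (step p u)
  let ?good = "\<lambda>r i A. fst r \<in> lists A \<and> comeager (space_over A) (- box r \<union> - branch R (u @ [i]))"
  define P where "P q i r \<longleftrightarrow> (below q p \<longrightarrow> below r q \<and> club (\<lambda>A. fst r \<in> lists A \<longrightarrow>
      comeager (space_over A) (- box r \<union> - branch R (u @ [i]))))" for q i r
  have "\<forall>q i. \<exists>r. P q i r"
    using step.IH unfolding P_def by blast
  then obtain r where "\<And>q i. P q i (r q i)" by metis
  then have r: "\<And>q i. below q p \<Longrightarrow> below (r q i) q"
    "\<And>q i. below q p \<Longrightarrow> club (\<lambda>A. fst (r q i) \<in> lists A \<longrightarrow>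
      comeager (space_over A) (- box (r q i) \<union> - branch R (u @ [i])))"
    by (simp_all add: P_def)
  have "club (\<lambda>A. below q p \<longrightarrow> ?good (r q i) i A)" for q i
  proof (cases "below q p")
    case True
    have "club (\<lambda>A. fst (r q i) \<in> lists A)" by (rule club_lists)
    from club_conj[OF this r(2)[OF True, of i]] show ?thesis
      by (rule club_mono) simp
  qed (simp add: club_const)
  \<comment> \<open>Conditions over \<open>A\<close> are as numerous as \<open>lists A\<close>,
    hence the diagonal intersection over the list component; the base index and \<open>i\<close>
    range over countable types.\<close>
  then have "club (\<lambda>A. \<forall>t \<in> lists A. \<forall>m i. below (t, m) p \<longrightarrow> ?good (r (t, m) i) i A)"
    by (intro club_diagonal club_all)
  then show ?case
  proof (rule club_mono, intro impI)
    fix A assume A: "countable A" "A \<noteq> {}" and p: "fst p \<in> lists A"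
      and *: "\<forall>t \<in> lists A. \<forall>m i. below (t, m) p \<longrightarrow> ?good (r (t, m) i) i A"
    have good: "?good (r q i) i A" if "below q p" "fst q \<in> lists A" for q i
      using * that by (metis prod.collapse)
    have "comeager (space_over A) (- (box p \<inter> topspace (space_over A)) \<union> - branch R (u @ [i]))" for i
    proof (rule comeager_localize)
      let ?Q = "{q. fst q \<in> lists A \<and> below q p}"
      let ?V = "(\<lambda>q. box (r q i) \<inter> topspace (space_over A)) ` ?Q"
      have "countable ?Q" using countable_conditions[OF A(1)] by (rule countable_subset[rotated]) blast
      then show "countable ?V" by (rule countable_image)
      show "openin (space_over A) V" if "V \<in> ?V" for V
        using that open_box by blast
      show "comeager (space_over A) (- V \<union> - branch R (u @ [i]))" if V: "V \<in> ?V" for V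
      proof -
        obtain q where "fst q \<in> lists A" "below q p" "V = box (r q i) \<inter> topspace (space_over A)"
          using V by blast
        moreover from this have "comeager (space_over A) (- box (r q i) \<union> - branch R (u @ [i]))"
          using good by blast
        ultimately show ?thesis by (auto elim: comeager_mono)
      qed
      show "openin (space_over A) (box p \<inter> topspace (space_over A))" by (rule open_box)
      fix V assume V: "openin (space_over A) V" "V \<noteq> {}" "V \<subseteq> box p \<inter> topspace (space_over A)"
      then obtain z where "z \<in> V" "z \<in> box p" by blast
      then obtain q where q: "below q p" "fst q \<in> lists A" "box q \<inter> topspace (space_over A) \<subseteq> V"
        using below_exists[OF V(1)] by metis
      have "box (r q i) \<inter> topspace (space_over A) \<noteq> {}"
        using good[OF q(1,2)] A(2) by (intro box_nonempty) auto
      moreover have "box (r q i) \<inter> topspace (space_over A) \<subseteq> V"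
        using box_mono[OF r(1)[OF q(1)]] q(3) by blast
      ultimately show "\<Union>?V \<inter> V \<noteq> {}" using q by blast
    qed
    then have "comeager (space_over A)
        (\<Inter>i. - (box p \<inter> topspace (space_over A)) \<union> - branch R (u @ [i]))"
      by (rule comeager_all)
    then show "comeager (space_over A) (- box p \<union> - branch R u)"
      by (rule comeager_mono) (use branch_step[of R u] in blast)
  qed
qed

text \<open>Otherwise the recursive rule of \<open>negl\<close> would apply to \<open>p\<close>
  itself.\<close>

lemma forces_step:
  assumes "forces R p u"
  obtains q i where "below q p" "forces R q (u @ [i])"
proof -
  have "\<not> negl R p u" using assms below_refl unfolding forces_def by blast
  then obtain q i where "below q p" "\<And>r. below r q \<Longrightarrow> \<not> negl R r (u @ [i])"
    using negl.step[of p R u] by blast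
  then show thesis using that unfolding forces_def by blast
qed

text \<open>For \<open>A\<close> closed under the chosen strengthenings, a generic point in the box
  of a condition that forces \<open>u\<close> meets one that forces some \<open>u @ [i]\<close>.
  Iterating this, the point produces its own witnessing branch. The hypothesis expresses in terms of
  boxes that each \<open>R u\<close> is closed.\<close>

lemma forces_imp_comeager:
  fixes R :: "nat list \<Rightarrow> ((nat \<Rightarrow> 'a) \<times> 'g) set"
  assumes closed: "\<And>u z. z \<in> UNIV \<times> topspace T \<Longrightarrow> z \<notin> R u \<Longrightarrow> \<exists>p. z \<in> box p \<and> box p \<inter> R u = {}"
  shows "club (\<lambda>A. \<forall>p u. fst p \<in> lists A \<longrightarrow> forces R p u \<longrightarrow>
    comeager (space_over A) (- box p \<union> branch R u))"
proof -
  have "\<forall>q u. \<exists>r. forces R q u \<longrightarrow> below r q \<and> (\<exists>i. forces R r (u @ [i]))"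
    using forces_step by metis
  then obtain r where r: "\<And>q u. forces R q u \<Longrightarrow> below (r q u) q"
    "\<And>q u. forces R q u \<Longrightarrow> \<exists>i. forces R (r q u) (u @ [i])"
    by metis
  have "club (\<lambda>A. \<forall>t \<in> lists A. \<forall>m u. fst (r (t, m) u) \<in> lists A)"
    by (intro club_diagonal club_all club_lists)
  then show ?thesis
  proof (rule club_mono, intro allI impI)
    fix A p u assume A: "countable A" "A \<noteq> {}" and p: "fst p \<in> lists A" and f: "forces R p u"
      and rA': "\<forall>t \<in> lists A. \<forall>m u. fst (r (t, m) u) \<in> lists A"
    have rA: "fst (r q u) \<in> lists A" if "fst q \<in> lists A" for q u
      using rA' that by (metis prod.collapse)
    let ?Z = "topspace (space_over A)"
    \<comment> \<open>The points captured by a condition over \<open>A\<close> that settles the next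
      entry of the branch after \<open>u\<close>.\<close>
    define G where "G u = (\<Union>q \<in> {q. fst q \<in> lists A \<and> (\<exists>i. forces R q (u @ [i]))}. box q)" for u
    have com: "comeager (space_over A) (- (box q \<inter> ?Z) \<union> G u)" if q: "fst q \<in> lists A" "forces R q u" for q u
    proof (rule comeager_localize)
      let ?Q = "{q. fst q \<in> lists A \<and> (\<exists>i. forces R q (u @ [i]))}"
      let ?V = "(\<lambda>q. box q \<inter> ?Z) ` ?Q"
      have "countable ?Q" using countable_conditions[OF A(1)] by (rule countable_subset[rotated]) blast
      then show "countable ?V" by (rule countable_image)
      show "openin (space_over A) V" if "V \<in> ?V" for V
        using that open_box by blast
      show "comeager (space_over A) (- V \<union> G u)" if "V \<in> ?V" for V
      proof -
        have "- V \<union> G u = UNIV" using that by (auto simp: G_def)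
        then show ?thesis by (simp add: comeager_UNIV)
      qed
      show "openin (space_over A) (box q \<inter> ?Z)" by (rule open_box)
      fix V assume V: "openin (space_over A) V" "V \<noteq> {}" "V \<subseteq> box q \<inter> ?Z"
      then obtain z where "z \<in> V" "z \<in> box q" by blast
      then obtain q' where q': "below q' q" "fst q' \<in> lists A" "box q' \<inter> ?Z \<subseteq> V"
        using below_exists[OF V(1)] by metis
      have f': "forces R q' u" using forces_mono q(2) q'(1) .
      have "box (r q' u) \<inter> ?Z \<noteq> {}" by (rule box_nonempty[OF rA[OF q'(2)] A(2)])
      moreover have "box (r q' u) \<inter> ?Z \<subseteq> V" using box_mono[OF r(1)[OF f']] q'(3) by blast
      moreover have "r q' u \<in> ?Q" using rA[OF q'(2)] r(2)[OF f'] by blast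
      ultimately show "\<Union>?V \<inter> V \<noteq> {}" by blast
    qed
    have "comeager (space_over A) (\<Inter>z \<in> {(q, u). fst q \<in> lists A \<and> forces R q u}.
        - (box (fst z) \<inter> ?Z) \<union> G (snd z))"
    proof (intro comeager_INT)
      have "countable ({q :: 'a list \<times> nat. fst q \<in> lists A} \<times> (UNIV :: nat list set))"
        using countable_conditions[OF A(1)] by (intro countable_SIGMA) auto
      then show "countable {(q, u). fst q \<in> lists A \<and> forces R q u}"
        by (rule countable_subset[rotated]) auto
    qed (use com in force)
    then show "comeager (space_over A) (- box p \<union> branch R u)"
    proof (rule comeager_mono)
      fix z assume z: "z \<in> ?Z" and z': "z \<in> (\<Inter>z \<in> {(q, u). fst q \<in> lists A \<and> forces R q u}.
        - (box (fst z) \<inter> ?Z) \<union> G (snd z))"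
      have G: "z \<in> G u" if "fst q \<in> lists A" "forces R q u" "z \<in> box q" for q u
        using INT_D[OF z', of "(q, u)"] that z by simp
      show "z \<in> - box p \<union> branch R u"
      proof (cases "z \<in> box p")
        case True
        \<comment> \<open>The branch runs through nodes that are forced by some condition over
          \<open>A\<close> containing \<open>z\<close>; the condition may change from node to node
          without regard to its predecessor.\<close>
        let ?P = "\<lambda>v. \<exists>q. fst q \<in> lists A \<and> forces R q v \<and> z \<in> box q"
        have "\<exists>i. ?P (v @ [i])" if "?P v" for v
          using that G unfolding G_def by blast
        then obtain next' where nx: "\<And>v. ?P v \<Longrightarrow> ?P (v @ [next' v])" by metis
        define w where "w = rec_nat u (\<lambda>_ v. v @ [next' v])"
        have w0: "w 0 = u" and wS: "w (Suc n) = w n @ [next' (w n)]" for n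
          by (simp_all add: w_def)
        have wP: "?P (w n)" for n
        proof (induction n)
          case 0
          then show ?case using True p f unfolding w0 by blast
        next
          case (Suc n)
          then show ?case unfolding wS by (rule nx)
        qed
        have wl: "length (w n) = length u + n" for n
          by (induction n) (auto simp: w0 wS)
        have wpre: "i < length (w n) \<Longrightarrow> w (n + m) ! i = w n ! i" for n m i
          by (induction m) (auto simp: wS nth_append wl)
        define x where "x i = w (Suc i) ! i" for i
        have "w n ! i = x i" if "i < length (w n)" for n i
        proof -
          have "w (n + Suc i) ! i = w n ! i" "w (Suc i + n) ! i = w (Suc i) ! i"
            using that by (intro wpre; simp add: wl)+
          then show ?thesis by (simp add: x_def add.commute)
        qed
        then have wx: "w n = map x [0..<length u + n]" for n
          by (intro nth_equalityI) (auto simp: wl)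
        \<comment> \<open>If \<open>z\<close> were outside \<open>R v\<close>, some box around it
          would miss \<open>R v\<close>. A common strengthening of that condition and of one forcing
          \<open>v\<close> would be negligible by the base rule.\<close>
        have zR: "z \<in> R v" if v: "?P v" for v
        proof (rule ccontr)
          assume "z \<notin> R v"
          moreover have "z \<in> UNIV \<times> topspace T" using z by (auto simp: topspace_space_over)
          ultimately obtain q where q: "z \<in> box q" "box q \<inter> R v = {}" using closed by blast
          obtain q' where q': "forces R q' v" "z \<in> box q'" using v by blast
          obtain q'' where "below q'' q" "below q'' q'"
            using below_both[OF q(1) q'(2)] by blast
          then show False
            using q(2) q'(1) negl.disjoint[of q'' R v] box_mono[of q'' q] unfolding forces_def by blast
        qed
        have "z \<in> R (map x [0..<k])" if "k \<ge> length u" for k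
          using zR[OF wP[of "k - length u"]] wx[of "k - length u"] that by simp
        moreover have "\<forall>i<length u. x i = u ! i"
          using wx[of 0] w0 by (metis add.right_neutral add.left_neutral diff_zero length_upt nth_map nth_upt)
        ultimately have "z \<in> branch R u" unfolding branch_def by blast
        then show ?thesis by blast
      qed blast
    qed
  qed
qed

lemma suslin_schemeE:
  fixes D :: "((nat \<Rightarrow> 'a) \<times> 'g) set"
  assumes "suslin (closed_rects T) D"
  obtains R where "branch R [] = D"
    "\<And>u z. z \<in> UNIV \<times> topspace T \<Longrightarrow> z \<notin> R u \<Longrightarrow> \<exists>p. z \<in> box p \<and> box p \<inter> R u = {}"
proof -
  obtain R :: "nat list \<Rightarrow> ((nat \<Rightarrow> 'a) \<times> 'g) set" where R: "(\<forall>u. R u \<in> closed_rects T) \<and>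
      D = {z. \<exists>x. \<forall>k. z \<in> R (map x [0..<k])}"
    using assms unfolding suslin_def by blast
  have "\<exists>p. z \<in> box p \<and> box p \<inter> R u = {}" if z: "z \<in> UNIV \<times> topspace T" "z \<notin> R u" for u z
  proof -
    obtain C L where CL: "R u = C \<times> L" "clopen_seq C" "closedin T L"
      using R unfolding closed_rects_def by blast
    obtain e h where eh: "z = (e, h)" "h \<in> topspace T" using z by auto
    consider "e \<notin> C" | "h \<notin> L" using z CL eh by blast
    then show ?thesis
    proof cases
      case 1
      obtain n where "\<And>e'. (\<forall>i<n. e' i = e i) \<Longrightarrow> (e' \<in> C \<longleftrightarrow> e \<in> C)"
        using CL(2) unfolding clopen_seq_def by blast
      then have "cyl (map e [0..<n]) \<inter> C = {}" using 1 by (auto simp: cyl_map_iff)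
      moreover obtain m where "h \<in> B m" using base[OF openin_topspace eh(2)] by blast
      ultimately have "z \<in> box (map e [0..<n], m) \<and> box (map e [0..<n], m) \<inter> R u = {}"
        by (auto simp: box_def eh CL)
      then show ?thesis ..
    next
      case 2
      then have "h \<in> topspace T - L" "openin T (topspace T - L)" using eh CL by auto
      then obtain m where "h \<in> B m" "B m \<subseteq> topspace T - L" using base by blast
      then have "z \<in> box ([], m) \<and> box ([], m) \<inter> R u = {}"
        by (auto simp: box_def eh CL cyl_def)
      then show ?thesis ..
    qed
  qed
  moreover have "branch R [] = D" using R by (simp add: branch_Nil)
  ultimately show thesis using that by blast
qed

text \<open>The forcing theorem: \<open>K p\<close> means that \<open>p\<close> forces the generic
  pair into \<open>D\<close>. What is forced is true of almost every point of the box, and what is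
  true of a generic point is forced by a condition containing it. The quantifiers matter: one
  \<open>K\<close> serves club many sets \<open>A\<close>.\<close>

theorem suslin_forcing:
  fixes D :: "((nat \<Rightarrow> 'a) \<times> 'g) set"
  assumes "suslin (closed_rects T) D"
  obtains K where "\<And>p q. K p \<Longrightarrow> below q p \<Longrightarrow> K q"
    and "club (\<lambda>A. (\<forall>p. fst p \<in> lists A \<longrightarrow> K p \<longrightarrow> comeager (space_over A) (- box p \<union> D)) \<and>
      comeager (space_over A) {z. z \<in> D \<longrightarrow> (\<exists>p. fst p \<in> lists A \<and> K p \<and> z \<in> box p)})"
proof -
  obtain R where R: "branch R [] = D"
    "\<And>u z. z \<in> UNIV \<times> topspace T \<Longrightarrow> z \<notin> R u \<Longrightarrow> \<exists>p. z \<in> box p \<and> box p \<inter> R u = {}"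
    using suslin_schemeE[OF assms] by blast
  define K where "K p \<longleftrightarrow> forces R p []" for p
  have K: "K q" if "K p" "below q p" for p q
    using that forces_mono by (simp add: K_def)
  \<comment> \<open>\<open>r\<close> strengthens every condition to a deciding one. Closure of
    \<open>A\<close> under \<open>r\<close> makes the deciding conditions over \<open>A\<close>
    dense.\<close>
  have "\<forall>p. \<exists>q. below q p \<and> (K q \<or> negl R q [])"
    using below_refl unfolding K_def forces_def by blast
  then obtain r where r: "\<And>p. below (r p) p" "\<And>p. K (r p) \<or> negl R (r p) []" by metis
  have 1: "club (\<lambda>A. \<forall>p. fst p \<in> lists A \<longrightarrow> K p \<longrightarrow> comeager (space_over A) (- box p \<union> D))"
    using forces_imp_comeager[of R, OF R(2)]
    by (rule club_mono) (use R(1) in \<open>auto simp: K_def\<close>)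
  have "club (\<lambda>A. fst p \<in> lists A \<longrightarrow> negl R p [] \<longrightarrow> comeager (space_over A) (- box p \<union> - D))" for p
    using negl_imp_comeager[of R p "[]"]
    by (cases "negl R p []") (simp_all add: R(1) club_const)
  then have 2: "club (\<lambda>A. \<forall>t \<in> lists A. \<forall>m. fst (r (t, m)) \<in> lists A \<and> (fst (t, m) \<in> lists A \<longrightarrow>
      negl R (t, m) [] \<longrightarrow> comeager (space_over A) (- box (t, m) \<union> - D)))"
    by (intro club_diagonal club_all club_conj club_lists)
  have "club (\<lambda>A. comeager (space_over A)
      {z. z \<in> D \<longrightarrow> (\<exists>p. fst p \<in> lists A \<and> K p \<and> z \<in> box p)})"
    using 2
  proof (rule club_mono)
    fix A :: "'a set" assume A: "countable A" "A \<noteq> {}"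
      and *: "\<forall>t \<in> lists A. \<forall>m. fst (r (t, m)) \<in> lists A \<and> (fst (t, m) \<in> lists A \<longrightarrow>
      negl R (t, m) [] \<longrightarrow> comeager (space_over A) (- box (t, m) \<union> - D))"
    have rA: "fst (r p) \<in> lists A" if "fst p \<in> lists A" for p
      using * that by (metis prod.collapse)
    have neg: "comeager (space_over A) (- box p \<union> - D)" if "fst p \<in> lists A" "negl R p []" for p
      using * that by (metis prod.collapse)
    let ?C = "{z. z \<in> D \<longrightarrow> (\<exists>p. fst p \<in> lists A \<and> K p \<and> z \<in> box p)}"
    let ?Z = "topspace (space_over A)"
    have "comeager (space_over A) (- ?Z \<union> ?C)"
    proof (rule comeager_localize)
      let ?Q = "{p. fst p \<in> lists A \<and> (K p \<or> negl R p [])}"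
      let ?V = "(\<lambda>p. box p \<inter> ?Z) ` ?Q"
      have "countable ?Q" using countable_conditions[OF A(1)] by (rule countable_subset[rotated]) blast
      then show "countable ?V" by (rule countable_image)
      show "openin (space_over A) V" if "V \<in> ?V" for V
        using that open_box by blast
      show "comeager (space_over A) (- V \<union> ?C)" if V: "V \<in> ?V" for V
      proof -
        obtain p where p: "fst p \<in> lists A" "K p \<or> negl R p []" "V = box p \<inter> ?Z" using V by blast
        from p(2) show ?thesis
        proof
          assume "K p"
          then have "- V \<union> ?C = UNIV" using p(1,3) by blast
          then show ?thesis by (simp add: comeager_UNIV)
        next
          assume "negl R p []"
          from neg[OF p(1) this] show ?thesis by (rule comeager_mono) (use p(3) in auto)
        qed
      qed
      fix V assume V: "openin (space_over A) V" "V \<noteq> {}"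
      then obtain z where z: "z \<in> V" by blast
      then have "z \<in> ?Z" using openin_subset[OF V(1)] by blast
      then obtain m where "snd z \<in> B m"
        using base[OF openin_topspace, of "snd z"] by (auto simp: topspace_space_over)
      then have "z \<in> box ([], m)" by (cases z) (simp add: box_def cyl_def)
      then obtain q where q: "fst q \<in> lists A" "box q \<inter> ?Z \<subseteq> V"
        using below_exists[OF V(1) z] by metis
      have "box (r q) \<inter> ?Z \<noteq> {}" by (rule box_nonempty[OF rA[OF q(1)] A(2)])
      moreover have "box (r q) \<inter> ?Z \<subseteq> V" using box_mono[OF r(1)[of q]] q(2) by blast
      moreover have "r q \<in> ?Q" using rA[OF q(1)] r(2)[of q] by blast
      ultimately show "\<Union>?V \<inter> V \<noteq> {}" by blast
    qed (rule openin_topspace)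
    then show "comeager (space_over A) ?C" by (rule comeager_mono) blast
  qed
  from club_conj[OF 1 this] show thesis using that K by blast
qed

end

section \<open>Interleaving\<close>

definition evens :: "(nat \<Rightarrow> 'a) \<Rightarrow> nat \<Rightarrow> 'a" where
  "evens x = (\<lambda>i. x (2 * i))"

definition odds :: "(nat \<Rightarrow> 'a) \<Rightarrow> nat \<Rightarrow> 'a" where
  "odds x = (\<lambda>i. x (2 * i + 1))"

text \<open>Codes a pair of sequences as one, so that a relation between two sequences becomes a set
  to which the forcing theorem for single sequences applies.\<close>

definition interleave :: "(nat \<Rightarrow> 'a) \<Rightarrow> (nat \<Rightarrow> 'a) \<Rightarrow> nat \<Rightarrow> 'a" where
  "interleave e e' = (\<lambda>i. if even i then e (i div 2) else e' (i div 2))"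

lemma evens_interleave [simp]: "evens (interleave e e') = e"
  and odds_interleave [simp]: "odds (interleave e e') = e'"
  by (auto simp: evens_def odds_def interleave_def)

lemma interleave_evens_odds [simp]: "interleave (evens x) (odds x) = x"
  by (rule ext) (auto simp: evens_def odds_def interleave_def)

lemma range_interleave: "range (interleave e e') = range e \<union> range e'"
proof
  show "range (interleave e e') \<subseteq> range e \<union> range e'"
    by (auto simp: interleave_def)
  have "e i = interleave e e' (2 * i)" "e' i = interleave e e' (2 * i + 1)" for i
    by (simp_all add: interleave_def)
  then show "range e \<union> range e' \<subseteq> range (interleave e e')" by (auto simp: image_iff)
qed

lemma range_evens_odds: "range x = range (evens x) \<union> range (odds x)"
  using range_interleave[of "evens x" "odds x"] by simp

lemma continuous_open_evens_odds:
  shows "continuous_map (seqs A) (seqs A) evens" "open_map (seqs A) (seqs A) evens"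
    and "continuous_map (seqs A) (seqs A) odds" "open_map (seqs A) (seqs A) odds"
proof -
  \<comment> \<open>What the two halves share: the first \<open>n\<close> entries of the image
    depend on \<open>2 * n\<close> entries of the argument (\<open>agree\<close>), and a new image
    that keeps \<open>n\<close> entries comes from a new argument that keeps \<open>n\<close>
    entries (\<open>lift\<close>). These give continuity and openness.\<close>
  have *: "continuous_map (seqs A) (seqs A) h \<and> open_map (seqs A) (seqs A) h"
    if h: "\<And>x. range (h x) \<subseteq> range x"
      and agree: "\<And>x x' n. (\<forall>i<2 * n. x' i = x i) \<Longrightarrow> (\<forall>i<n. h x' i = h x i)"
      and lift: "\<And>x e. \<exists>x'. h x' = e \<and> range x' \<subseteq> range x \<union> range e \<and>
        (\<forall>n. (\<forall>i<n. e i = h x i) \<longrightarrow> (\<forall>i<n. x' i = x i))" for h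
  proof
    show "continuous_map (seqs A) (seqs A) h"
      unfolding continuous_map_def
    proof (intro conjI allI impI)
      show "h \<in> topspace (seqs A) \<rightarrow> topspace (seqs A)" using h by fastforce
      fix U assume U: "openin (seqs A) U"
      show "openin (seqs A) {x \<in> topspace (seqs A). h x \<in> U}"
        unfolding openin_seqs
      proof (intro conjI ballI)
        fix x assume x: "x \<in> {x \<in> topspace (seqs A). h x \<in> U}"
        then obtain n where n: "\<And>e'. range e' \<subseteq> A \<Longrightarrow> (\<forall>i<n. e' i = h x i) \<Longrightarrow> e' \<in> U"
          using U unfolding openin_seqs by blast
        show "\<exists>n. \<forall>e'. range e' \<subseteq> A \<longrightarrow> (\<forall>i<n. e' i = x i) \<longrightarrow> e' \<in> {x \<in> topspace (seqs A). h x \<in> U}"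
        proof (intro exI[of _ "2 * n"] allI impI)
          fix e' assume e': "range e' \<subseteq> A" "\<forall>i<2 * n. e' i = x i"
          have "h e' \<in> U" using n[of "h e'"] h[of e'] agree[OF e'(2)] e'(1) by blast
          then show "e' \<in> {x \<in> topspace (seqs A). h x \<in> U}" using e'(1) by simp
        qed
      qed auto
    qed
    show "open_map (seqs A) (seqs A) h"
      unfolding open_map_def
    proof (intro allI impI)
      fix U assume U: "openin (seqs A) U"
      then have UA: "x \<in> U \<Longrightarrow> range x \<subseteq> A" for x using openin_subset by fastforce
      show "openin (seqs A) (h ` U)"
        unfolding openin_seqs
      proof (intro conjI ballI)
        show "h ` U \<subseteq> {e. range e \<subseteq> A}" using h UA by fastforce
        fix e assume "e \<in> h ` U"
        then obtain x where x: "x \<in> U" "e = h x" by blast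
        then obtain n where n: "\<And>x'. range x' \<subseteq> A \<Longrightarrow> (\<forall>i<n. x' i = x i) \<Longrightarrow> x' \<in> U"
          using U unfolding openin_seqs by blast
        have "e' \<in> h ` U" if e': "range e' \<subseteq> A" "\<forall>i<n. e' i = e i" for e'
        proof -
          obtain x' where x': "h x' = e'" "range x' \<subseteq> range x \<union> range e'" "\<forall>i<n. x' i = x i"
            using lift[of e' x] e'(2) x(2) by blast
          then have "x' \<in> U" using n[of x'] UA[OF x(1)] e'(1) by blast
          then show ?thesis using x'(1) by blast
        qed
        then show "\<exists>n. \<forall>e'. range e' \<subseteq> A \<longrightarrow> (\<forall>i<n. e' i = e i) \<longrightarrow> e' \<in> h ` U" by blast
      qed
    qed
  qed
  have "continuous_map (seqs A) (seqs A) evens \<and> open_map (seqs A) (seqs A) evens"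
  proof (rule *)
    show "range (evens x) \<subseteq> range x" for x :: "nat \<Rightarrow> 'a" using range_evens_odds[of x] by blast
    show "\<forall>i<n. evens x' i = evens x i" if "\<forall>i<2 * n. x' i = x i" for x x' :: "nat \<Rightarrow> 'a" and n
      using that by (simp add: evens_def)
    fix x e :: "nat \<Rightarrow> 'a"
    have "\<forall>i<n. interleave e (odds x) i = x i" if "\<forall>i<n. e i = evens x i" for n
    proof (intro allI impI)
      fix i assume "i < n"
      then have "e (i div 2) = evens x (i div 2)" using that by simp
      then show "interleave e (odds x) i = x i"
        by (auto simp: interleave_def evens_def odds_def)
    qed
    then show "\<exists>x'. evens x' = e \<and> range x' \<subseteq> range x \<union> range e \<and>
        (\<forall>n. (\<forall>i<n. e i = evens x i) \<longrightarrow> (\<forall>i<n. x' i = x i))"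
      using range_evens_odds[of x] by (intro exI[of _ "interleave e (odds x)"]) (auto simp: range_interleave)
  qed
  moreover have "continuous_map (seqs A) (seqs A) odds \<and> open_map (seqs A) (seqs A) odds"
  proof (rule *)
    show "range (odds x) \<subseteq> range x" for x :: "nat \<Rightarrow> 'a" using range_evens_odds[of x] by blast
    show "\<forall>i<n. odds x' i = odds x i" if "\<forall>i<2 * n. x' i = x i" for x x' :: "nat \<Rightarrow> 'a" and n
      using that by (simp add: odds_def)
    fix x e :: "nat \<Rightarrow> 'a"
    have "\<forall>i<n. interleave (evens x) e i = x i" if "\<forall>i<n. e i = odds x i" for n
    proof (intro allI impI)
      fix i assume "i < n"
      then have "e (i div 2) = odds x (i div 2)" using that by simp
      then show "interleave (evens x) e i = x i"
        by (auto simp: interleave_def evens_def odds_def)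
    qed
    then show "\<exists>x'. odds x' = e \<and> range x' \<subseteq> range x \<union> range e \<and>
        (\<forall>n. (\<forall>i<n. e i = odds x i) \<longrightarrow> (\<forall>i<n. x' i = x i))"
      using range_evens_odds[of x] by (intro exI[of _ "interleave (evens x) e"]) (auto simp: range_interleave)
  qed
  ultimately show "continuous_map (seqs A) (seqs A) evens" "open_map (seqs A) (seqs A) evens"
    "continuous_map (seqs A) (seqs A) odds" "open_map (seqs A) (seqs A) odds" by blast+
qed

text \<open>Interleaving is a homeomorphism whose inverse consists of \<open>evens\<close> and
  \<open>odds\<close>.\<close>

lemma comeager_interleave:
  assumes "comeager (seqs A) C"
  shows "comeager (prod_topology (seqs A) (seqs A)) {z. interleave (fst z) (snd z) \<in> C}"
proof (rule comeager_preimage[OF _ _ assms])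
  show "continuous_map (prod_topology (seqs A) (seqs A)) (seqs A) (\<lambda>z. interleave (fst z) (snd z))"
    unfolding continuous_map_def
  proof (intro conjI allI impI)
    have "range (interleave e e') \<subseteq> A" if "range e \<subseteq> A" "range e' \<subseteq> A" for e e'
      using that unfolding range_interleave by blast
    then show "(\<lambda>z. interleave (fst z) (snd z)) \<in> topspace (prod_topology (seqs A) (seqs A)) \<rightarrow> topspace (seqs A)"
      by (intro funcsetI) (simp add: mem_Times_iff)
    fix U assume U: "openin (seqs A) U"
    show "openin (prod_topology (seqs A) (seqs A))
        {z \<in> topspace (prod_topology (seqs A) (seqs A)). interleave (fst z) (snd z) \<in> U}"
      unfolding openin_prod_topology_alt
    proof (intro allI impI)
      fix e e' assume ee: "(e, e') \<in> {z \<in> topspace (prod_topology (seqs A) (seqs A)). interleave (fst z) (snd z) \<in> U}"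
      then have "interleave e e' \<in> U" by simp
      then obtain n where n: "\<And>x. range x \<subseteq> A \<Longrightarrow> (\<forall>i<n. x i = interleave e e' i) \<Longrightarrow> x \<in> U"
        using U unfolding openin_seqs by blast
      let ?V = "\<lambda>e. cyl (map e [0..<n]) \<inter> {e. range e \<subseteq> A}"
      have "interleave a b \<in> U" if "a \<in> ?V e" "b \<in> ?V e'" for a b
      proof (rule n)
        show "range (interleave a b) \<subseteq> A" using that by (auto simp: range_interleave)
        show "\<forall>i<n. interleave a b i = interleave e e' i"
          using that by (auto simp: interleave_def cyl_map_iff)
      qed
      then have "?V e \<times> ?V e' \<subseteq> {z \<in> topspace (prod_topology (seqs A) (seqs A)). interleave (fst z) (snd z) \<in> U}"
        by auto
      moreover have "e \<in> ?V e" "e' \<in> ?V e'" using ee by auto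
      ultimately show "\<exists>V W. openin (seqs A) V \<and> openin (seqs A) W \<and> e \<in> V \<and> e' \<in> W \<and>
          V \<times> W \<subseteq> {z \<in> topspace (prod_topology (seqs A) (seqs A)). interleave (fst z) (snd z) \<in> U}"
        using openin_seqs_cyl by blast
    qed
  qed
  show "open_map (prod_topology (seqs A) (seqs A)) (seqs A) (\<lambda>z. interleave (fst z) (snd z))"
    unfolding open_map_def
  proof (intro allI impI)
    fix U assume U: "openin (prod_topology (seqs A) (seqs A)) U"
    have eq: "(\<lambda>z. interleave (fst z) (snd z)) ` U = {x \<in> topspace (seqs A). (evens x, odds x) \<in> U}"
    proof (rule Set.set_eqI, rule iffI)
      fix x assume "x \<in> (\<lambda>z. interleave (fst z) (snd z)) ` U"
      then obtain e e' where "(e, e') \<in> U" "x = interleave e e'" by auto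
      moreover from this have "range e \<subseteq> A" "range e' \<subseteq> A" using openin_subset[OF U] by auto
      ultimately show "x \<in> {x \<in> topspace (seqs A). (evens x, odds x) \<in> U}"
        by (simp add: range_interleave)
    next
      fix x assume "x \<in> {x \<in> topspace (seqs A). (evens x, odds x) \<in> U}"
      then show "x \<in> (\<lambda>z. interleave (fst z) (snd z)) ` U"
        by (intro image_eqI[of _ _ "(evens x, odds x)"]) auto
    qed
    have "continuous_map (seqs A) (prod_topology (seqs A) (seqs A)) (\<lambda>x. (evens x, odds x))"
      by (intro continuous_map_pairedI continuous_open_evens_odds)
    from openin_continuous_map_preimage[OF this U]
    show "openin (seqs A) ((\<lambda>z. interleave (fst z) (snd z)) ` U)" unfolding eq .
  qed
qed

section \<open>A reduction to an orbit equivalence relation of a CLI group\<close>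

text \<open>The data provided by a reduction of equality of ranges, with the type of the terms left
  open; that type will turn out to be countable. \<open>S_separates\<close> is one-sided because
  forcing transfers membership in \<open>S n\<close> in one direction.\<close>

locale cli_reduction = countable_base T B + group_action G "space X" \<phi> + Metric_space "carrier G" d
  for G :: "('g, 'm) monoid_scheme" (structure) and T :: "'g topology" and B :: "nat \<Rightarrow> 'g set"
    and d :: "'g \<Rightarrow> 'g \<Rightarrow> real" and X :: "'x measure" and \<phi> +
  fixes f :: "(nat \<Rightarrow> 'a) \<Rightarrow> 'x" and S :: "nat \<Rightarrow> 'x set" and g :: "nat \<Rightarrow> 'g"
  assumes top: "topological_group G T"
    and metric: "mtopology = T"
    and complete: mcomplete
    and left_invariant: "\<And>a x y. a \<in> carrier G \<Longrightarrow> x \<in> carrier G \<Longrightarrow> y \<in> carrier G \<Longrightarrow>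
      d (a \<otimes> x) (a \<otimes> y) = d x y"
    and dense: "\<And>w \<epsilon>. w \<in> carrier G \<Longrightarrow> \<epsilon> > 0 \<Longrightarrow> \<exists>n. g n \<in> carrier G \<and> d (g n) w < \<epsilon>"
    and dense_in: "\<And>n. g n \<in> carrier G"
    and action_measurable: "(\<lambda>(a, x). \<phi> a x) \<in> borel_of T \<Otimes>\<^sub>M X \<rightarrow>\<^sub>M X"
    and S_measurable: "\<And>n. S n \<in> sets X"
    and S_separates: "\<And>x y. x \<in> space X \<Longrightarrow> y \<in> space X \<Longrightarrow> \<forall>n. x \<in> S n \<longrightarrow> y \<in> S n \<Longrightarrow> x = y"
    and f_measurable: "f \<in> Pi\<^sub>M UNIV (\<lambda>_. count_space UNIV) \<rightarrow>\<^sub>M X"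
    and f_reduction: "\<And>e e'. (\<exists>a \<in> carrier G. f e' = \<phi> a (f e)) \<longleftrightarrow> range e = range e'"
begin

sublocale group G
  using top by (simp add: topological_group_def)

lemma topspace_T [simp]: "topspace T = carrier G"
  using top by (simp add: topological_group_def)

lemma space_borel_T [simp]: "space (borel_of T) = carrier G"
  by (simp add: borel_of_def space_measure_of_conv)

lemma completely_metrizable_T: "completely_metrizable_space T"
  using complete completely_metrizable_space_mtopology metric by simp

lemma metrizable_T: "metrizable_space T"
  using metrizable_space_mtopology metric by simp

lemma second_countable_T: "second_countable T"
  unfolding second_countable_def using base_open base
  by (intro exI[of _ "range B"]) auto

lemma f_space [simp]: "f e \<in> space X"
  using measurable_space[OF f_measurable, of e] by (simp add: space_PiM)

lemma act_space [simp]: "a \<in> carrier G \<Longrightarrow> x \<in> space X \<Longrightarrow> \<phi> a x \<in> space X"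
  by (rule element_image) auto

lemma act_mult: "a \<in> carrier G \<Longrightarrow> b \<in> carrier G \<Longrightarrow> x \<in> space X \<Longrightarrow> \<phi> (a \<otimes> b) x = \<phi> a (\<phi> b x)"
  by (rule composition_rule)

lemma act_one: "x \<in> space X \<Longrightarrow> \<phi> \<one> x = x"
  using id_eq_one by (metis restrict_apply')

lemma act_inv: "a \<in> carrier G \<Longrightarrow> x \<in> space X \<Longrightarrow> \<phi> (inv a) (\<phi> a x) = x"
  by (simp flip: act_mult add: act_one)

lemma dist_one: "a \<in> carrier G \<Longrightarrow> b \<in> carrier G \<Longrightarrow> d a b = d \<one> (inv a \<otimes> b)"
  using left_invariant[of "inv a" a b] by simp

lemma measurable_orbit_map:
  assumes "h \<in> N \<rightarrow>\<^sub>M X"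
  shows "(\<lambda>z. \<phi> (snd z) (h (fst z))) \<in> N \<Otimes>\<^sub>M borel_of T \<rightarrow>\<^sub>M X"
proof -
  have "(\<lambda>z. (snd z, h (fst z))) \<in> N \<Otimes>\<^sub>M borel_of T \<rightarrow>\<^sub>M borel_of T \<Otimes>\<^sub>M X"
    using assms by measurable
  from measurable_comp[OF this action_measurable] show ?thesis
    by (simp add: comp_def split_beta)
qed

lemma measurable_act:
  assumes "a \<in> carrier G"
  shows "\<phi> a \<in> X \<rightarrow>\<^sub>M X"
proof -
  have "(\<lambda>x. (a, x)) \<in> X \<rightarrow>\<^sub>M borel_of T \<Otimes>\<^sub>M X"
    using assms by (intro measurable_Pair measurable_const) simp_all
  from measurable_comp[OF this action_measurable] show ?thesis
    by (simp add: comp_def)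
qed

section \<open>Analytic sets attached to the reduction\<close>

text \<open>The action is only Borel, so a small change of the group element need not change the
  point a little. Treating the group element as a further generic coordinate restores continuity on
  a comeager set, in the spirit of Vaught transforms.\<close>

definition orbit_in :: "nat \<Rightarrow> ((nat \<Rightarrow> 'a) \<times> 'g) set" where
  "orbit_in n = {z \<in> UNIV \<times> carrier G. \<phi> (snd z) (f (fst z)) \<in> S n}"

lemma suslin_orbit_in: "suslin (closed_rects T) (orbit_in n)"
proof (rule borel_imp_suslin[OF metrizable_T])
  have "(\<lambda>z. \<phi> (snd z) (f (fst z))) -` S n \<inter> space (Pi\<^sub>M UNIV (\<lambda>_. count_space UNIV) \<Otimes>\<^sub>M borel_of T)
      \<in> sets (Pi\<^sub>M UNIV (\<lambda>_. count_space UNIV) \<Otimes>\<^sub>M borel_of T)"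
    by (rule measurable_sets[OF measurable_orbit_map[OF f_measurable] S_measurable])
  also have "(\<lambda>z. \<phi> (snd z) (f (fst z))) -` S n \<inter> space (Pi\<^sub>M UNIV (\<lambda>_. count_space UNIV) \<Otimes>\<^sub>M borel_of T)
      = orbit_in n"
    by (auto simp: orbit_in_def space_pair_measure space_PiM)
  finally show "orbit_in n \<in> sets (Pi\<^sub>M UNIV (\<lambda>_. count_space UNIV) \<Otimes>\<^sub>M borel_of T)" .
qed

definition near :: "real \<Rightarrow> (nat \<Rightarrow> 'a) \<Rightarrow> (nat \<Rightarrow> 'a) \<Rightarrow> bool" where
  "near r e e' \<longleftrightarrow> (\<exists>w \<in> carrier G. d \<one> w < r \<and> f e' = \<phi> w (f e))"

text \<open>The connecting element of the two halves lies in the \<open>r\<close>-ball times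
  \<open>g n\<close>. Countably many \<open>n\<close> exhaust all possibilities, so one of them can
  be forced.\<close>

definition near_translate :: "real \<Rightarrow> nat \<Rightarrow> (nat \<Rightarrow> 'a) set" where
  "near_translate r n = {x. \<exists>w \<in> carrier G. d \<one> w < r \<and> f (odds x) = \<phi> w (\<phi> (g n) (f (evens x)))}"

text \<open>With the witness \<open>w\<close> as an explicit coordinate the set is measurable, since
  equality in \<open>X\<close> is tested by the countably many \<open>S k\<close>. The quantifier
  over \<open>w\<close> is then a projection along a complete separable metric space.\<close>

lemma suslin_near_translate: "suslin {C. clopen_seq C} (near_translate r n)"
proof -
  let ?P = "Pi\<^sub>M UNIV (\<lambda>_. count_space UNIV) :: (nat \<Rightarrow> 'a) measure"
  let ?D = "{z \<in> UNIV \<times> carrier G. d \<one> (snd z) < r \<and> f (odds (fst z)) = \<phi> (snd z) (\<phi> (g n) (f (evens (fst z))))}"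
  have ev: "evens \<in> ?P \<rightarrow>\<^sub>M ?P" and od: "odds \<in> ?P \<rightarrow>\<^sub>M ?P"
    unfolding evens_def odds_def
    by (rule measurable_PiM_single'; auto simp: space_PiM)+
  have "(\<lambda>x. \<phi> (g n) (f (evens x))) \<in> ?P \<rightarrow>\<^sub>M X"
    using measurable_comp[OF measurable_comp[OF ev f_measurable] measurable_act[OF dense_in]]
    by (simp add: comp_def)
  note m1 = measurable_orbit_map[OF this]
  have m2: "(\<lambda>z. f (odds (fst z))) \<in> ?P \<Otimes>\<^sub>M borel_of T \<rightarrow>\<^sub>M X"
    using measurable_comp[OF measurable_comp[OF measurable_fst od] f_measurable]
    by (simp add: comp_def)
  let ?M = "?P \<Otimes>\<^sub>M borel_of T"
  have space: "space ?M = UNIV \<times> carrier G" by (auto simp: space_pair_measure space_PiM)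
  let ?E = "\<lambda>k. {z \<in> space ?M. f (odds (fst z)) \<in> S k \<longleftrightarrow> \<phi> (snd z) (\<phi> (g n) (f (evens (fst z)))) \<in> S k}"
  have "?E k \<in> sets ?M" for k
  proof -
    let ?a = "(\<lambda>z. \<phi> (snd z) (\<phi> (g n) (f (evens (fst z))))) -` S k \<inter> space ?M"
    let ?b = "(\<lambda>z. f (odds (fst z))) -` S k \<inter> space ?M"
    have "?a \<in> sets ?M" "?b \<in> sets ?M"
      by (rule measurable_sets[OF m1 S_measurable] measurable_sets[OF m2 S_measurable])+
    then have "(?a \<inter> ?b) \<union> ((space ?M - ?a) \<inter> (space ?M - ?b)) \<in> sets ?M" by blast
    moreover have "(?a \<inter> ?b) \<union> ((space ?M - ?a) \<inter> (space ?M - ?b)) = ?E k" by blast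
    ultimately show ?thesis by simp
  qed
  then have "(\<Inter>k. ?E k) \<in> sets ?M" by blast
  moreover have "UNIV \<times> mball \<one> r \<in> sets ?M"
  proof (rule pair_measureI)
    have "openin T (mball \<one> r)" using openin_mball metric by simp
    then show "mball \<one> r \<in> sets (borel_of T)"
      unfolding borel_of_def by (intro in_measure_of) (use openin_subset[of T] in auto)
    show "UNIV \<in> sets ?P" using sets.top[of ?P] by (simp add: space_PiM)
  qed
  ultimately have "(\<Inter>k. ?E k) \<inter> (UNIV \<times> mball \<one> r) \<in> sets ?M" by (rule sets.Int)
  moreover have "(\<Inter>k. ?E k) \<inter> (UNIV \<times> mball \<one> r) = ?D"
  proof (rule Set.set_eqI, rule iffI)
    fix z assume z: "z \<in> (\<Inter>k. ?E k) \<inter> (UNIV \<times> mball \<one> r)"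
    then have "snd z \<in> carrier G" "d \<one> (snd z) < r" by auto
    moreover from this have "f (odds (fst z)) = \<phi> (snd z) (\<phi> (g n) (f (evens (fst z))))"
      using z by (intro S_separates) (auto simp: dense_in)
    ultimately show "z \<in> ?D" by (cases z) auto
  qed (auto simp: space)
  ultimately have "?D \<in> sets ?M" by simp
  then have "suslin (closed_rects mtopology) ?D"
    unfolding metric by (rule borel_imp_suslin[OF metrizable_T])
  then have "suslin {C. clopen_seq C} (fst ` ?D)"
  proof (rule suslin_projection[OF complete, rotated])
    show "\<exists>i. w \<in> mcball (g i) \<epsilon>" if "w \<in> carrier G" "\<epsilon> > 0" for w \<epsilon>
      using dense[OF that] that(1) by (auto simp: less_imp_le)
  qed
  moreover have "fst ` ?D = near_translate r n"
    unfolding near_translate_def by force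
  ultimately show ?thesis by simp
qed

text \<open>The connecting element \<open>a\<close> is to be written as a small element times
  \<open>g n\<close>. A left-invariant metric measures \<open>a \<otimes> inv (g n)\<close> as the
  distance of the inverses of \<open>a\<close> and \<open>g n\<close>, which is why continuity of
  inversion is needed.\<close>

lemma near_translate_exists:
  assumes "r > 0" "range (evens x) = range (odds x)"
  shows "\<exists>n. x \<in> near_translate r n"
proof -
  obtain a where a: "a \<in> carrier G" "f (odds x) = \<phi> a (f (evens x))"
    using f_reduction assms(2) by metis
  have "continuous_map T T (\<lambda>a. inv a)" using top by (simp add: topological_group_def)
  then have "openin T {b \<in> topspace T. inv b \<in> mball (inv a) r}"
    using openin_mball metric by (intro openin_continuous_map_preimage) auto
  then have "openin mtopology {b \<in> carrier G. inv b \<in> mball (inv a) r}" by (simp add: metric)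
  moreover have "a \<in> {b \<in> carrier G. inv b \<in> mball (inv a) r}" using a assms(1) by simp
  ultimately obtain \<epsilon> where \<epsilon>: "\<epsilon> > 0" "mball a \<epsilon> \<subseteq> {b \<in> carrier G. inv b \<in> mball (inv a) r}"
    unfolding openin_mtopology by blast
  obtain n where n: "g n \<in> carrier G" "d (g n) a < \<epsilon>" using dense[OF a(1) \<epsilon>(1)] by blast
  then have "g n \<in> mball a \<epsilon>" using a by (simp add: commute)
  then have "d (inv a) (inv (g n)) < r" using \<epsilon>(2) by auto
  then have "d \<one> (a \<otimes> inv (g n)) < r"
    using dist_one[of "inv a" "inv (g n)"] a n by simp
  moreover have "f (odds x) = \<phi> (a \<otimes> inv (g n)) (\<phi> (g n) (f (evens x)))"
    using a n by (simp add: act_mult act_inv)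
  ultimately show ?thesis
    unfolding near_translate_def using a n by (intro exI[of _ n] CollectI bexI[of _ "a \<otimes> inv (g n)"]) auto
qed

text \<open>The translate \<open>g n\<close> cancels: \<open>w2 \<otimes> inv w1\<close> takes
  \<open>f e1\<close> to \<open>f e2\<close>, and each factor contributes less than
  \<open>r / 2\<close>. Nothing has to be known about the size of \<open>g n\<close>.\<close>

lemma near_common_translate:
  assumes "interleave e e1 \<in> near_translate (r / 2) n" "interleave e e2 \<in> near_translate (r / 2) n"
  shows "near r e1 e2"
proof -
  let ?y = "\<phi> (g n) (f e)"
  obtain w1 w2 where w: "w1 \<in> carrier G" "d \<one> w1 < r / 2" "f e1 = \<phi> w1 ?y"
    "w2 \<in> carrier G" "d \<one> w2 < r / 2" "f e2 = \<phi> w2 ?y"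
    using assms by (auto simp: near_translate_def)
  have y: "?y \<in> space X" using dense_in by simp
  have "d \<one> (w2 \<otimes> inv w1) = d (inv w2) (inv w1)"
    using dist_one[of "inv w2" "inv w1"] w by simp
  also have "\<dots> \<le> d (inv w2) \<one> + d \<one> (inv w1)" using w by (intro triangle) auto
  also have "\<dots> < r" using w dist_one[of "inv w2" \<one>] dist_one[of "w1" \<one>] commute[of \<one> w1] by simp
  finally have "d \<one> (w2 \<otimes> inv w1) < r" .
  moreover have "f e2 = \<phi> (w2 \<otimes> inv w1) (f e1)"
    using w y by (simp add: act_mult act_inv)
  ultimately show ?thesis
    unfolding near_def using w by (intro bexI[of _ "w2 \<otimes> inv w1"]) auto
qed

end

section \<open>Conditions that force small connecting elements\<close>

lemma suslin_Times_topspace: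
  assumes "suslin {C. clopen_seq C} D"
  shows "suslin (closed_rects T) (D \<times> topspace T)"
proof -
  obtain R :: "nat list \<Rightarrow> (nat \<Rightarrow> 'a) set" where R: "(\<forall>u. R u \<in> {C. clopen_seq C}) \<and>
      D = {z. \<exists>x. \<forall>k. z \<in> R (map x [0..<k])}"
    using assms unfolding suslin_def by blast
  then have "D \<times> topspace T = {z. \<exists>x. \<forall>k. z \<in> R (map x [0..<k]) \<times> topspace T}" by auto
  moreover have "R u \<times> topspace T \<in> closed_rects T" for u
    using R by (intro closed_rectsI) auto
  ultimately show ?thesis
    unfolding suslin_def by (intro exI[of _ "\<lambda>u. R u \<times> topspace T"]) blast
qed

context cli_reduction
begin

text \<open>A single \<open>A\<close> and a generic interleaved pair over it yield a condition
  \<open>p\<close> that forces \<open>near_translate (r / 2) n\<close> for some \<open>n\<close>.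
  Since \<open>K\<close> does not depend on \<open>A\<close>, this \<open>p\<close> works for club
  many sets. Fixing a generic first half then leaves second halves that are pairwise near. The group
  coordinate of \<open>D n\<close> is a dummy that fits the set to the forcing machinery.\<close>

lemma near_condition_exists:
  assumes "r > 0"
  shows "\<exists>t. (\<exists>s'. t = s @ s') \<and>
    club (\<lambda>A. \<exists>E. comeager (seqs A) (- cyl t \<union> E) \<and> (\<forall>e \<in> E. \<forall>e' \<in> E. near r e e'))"
proof -
  define D where "D n = near_translate (r / 2) n \<times> carrier G" for n
  have suslin_D: "suslin (closed_rects T) (D n)" for n
    using suslin_Times_topspace[OF suslin_near_translate, of T "r / 2" n] by (simp add: D_def)
  define forced where "forced n K \<longleftrightarrow> (\<forall>p q. K p \<longrightarrow> below q p \<longrightarrow> K q) \<and>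
    club (\<lambda>A. (\<forall>p. fst p \<in> lists A \<longrightarrow> K p \<longrightarrow> comeager (space_over A) (- box p \<union> D n)) \<and>
      comeager (space_over A) {z. z \<in> D n \<longrightarrow> (\<exists>p. fst p \<in> lists A \<and> K p \<and> z \<in> box p)})" for n K
  have "\<exists>K. forced n K" for n
  proof (rule suslin_forcing[OF suslin_D[of n]])
    fix K
    assume "\<And>p q. K p \<Longrightarrow> below q p \<Longrightarrow> K q"
      and "club (\<lambda>A. (\<forall>p. fst p \<in> lists A \<longrightarrow> K p \<longrightarrow> comeager (space_over A) (- box p \<union> D n)) \<and>
        comeager (space_over A) {z. z \<in> D n \<longrightarrow> (\<exists>p. fst p \<in> lists A \<and> K p \<and> z \<in> box p)})"
    then have "forced n K" unfolding forced_def by blast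
    then show "\<exists>K. forced n K" by (rule exI[of _ K])
  qed
  then obtain K where "\<And>n. forced n (K n)" by metis
  then have K: "\<And>n p q. K n p \<Longrightarrow> below q p \<Longrightarrow> K n q"
    and Kclub: "\<And>n. club (\<lambda>A. (\<forall>p. fst p \<in> lists A \<longrightarrow> K n p \<longrightarrow> comeager (space_over A) (- box p \<union> D n)) \<and>
      comeager (space_over A) {z. z \<in> D n \<longrightarrow> (\<exists>p. fst p \<in> lists A \<and> K n p \<and> z \<in> box p)})"
    unfolding forced_def by blast+
  \<comment> \<open>Each entry of \<open>s\<close> is doubled, so that both halves of a sequence
    through \<open>s2\<close> begin with \<open>s\<close>; the odd half of the condition found will
    extend \<open>s\<close>. The base index \<open>0\<close> used with it is arbitrary.\<close>
  define s2 where "s2 = map (\<lambda>i. s ! (i div 2)) [0..<2 * length s]"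
  have "\<exists>n p. below p (s2, 0) \<and> K n p"
  proof -
    have cl: "club (\<lambda>A. s2 \<in> lists A \<and> (\<forall>n. comeager (space_over A)
        {z. z \<in> D n \<longrightarrow> (\<exists>p. fst p \<in> lists A \<and> K n p \<and> z \<in> box p)}))"
      by (intro club_conj club_all club_lists club_mono[OF Kclub]) blast
    obtain A where A: "countable A" "A \<noteq> {}" "s2 \<in> lists A \<and> (\<forall>n. comeager (space_over A)
        {z. z \<in> D n \<longrightarrow> (\<exists>p. fst p \<in> lists A \<and> K n p \<and> z \<in> box p)})"
      by (rule club_exists[OF cl countable_empty])
    have Acom: "comeager (space_over A)
        {z. z \<in> D n \<longrightarrow> (\<exists>p. fst p \<in> lists A \<and> K n p \<and> z \<in> box p)}" for n
      using A(3) by blast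
    note gen = comeager_range_eq[OF A(1)]
    note ev = comeager_preimage[OF continuous_open_evens_odds(1,2) gen]
      and od = comeager_preimage[OF continuous_open_evens_odds(3,4) gen]
    have "comeager (space_over A) {z. fst z \<in> {x. evens x \<in> {e. range e = A}} \<inter> {x. odds x \<in> {e. range e = A}}}"
      unfolding space_over_def
      by (rule comeager_preimage[OF continuous_map_fst open_map_fst comeager_Int[OF ev od]])
    from comeager_Int[OF this comeager_all[OF Acom]]
    have com: "comeager (space_over A) ({z. fst z \<in> {x. evens x \<in> {e. range e = A}} \<inter> {x. odds x \<in> {e. range e = A}}}
       \<inter> (\<Inter>n. {z. z \<in> D n \<longrightarrow> (\<exists>p. fst p \<in> lists A \<and> K n p \<and> z \<in> box p)}))" .
    have cm: "completely_metrizable_space (space_over A)"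
      unfolding space_over_def completely_metrizable_space_prod_topology
      using completely_metrizable_seqs completely_metrizable_T by blast
    have ne: "box (s2, 0) \<inter> topspace (space_over A) \<noteq> {}"
      using A by (intro box_nonempty) auto
    obtain z where z: "z \<in> box (s2, 0) \<inter> topspace (space_over A)"
      and zC: "z \<in> {z. fst z \<in> {x. evens x \<in> {e. range e = A}} \<inter> {x. odds x \<in> {e. range e = A}}}
       \<inter> (\<Inter>n. {z. z \<in> D n \<longrightarrow> (\<exists>p. fst p \<in> lists A \<and> K n p \<and> z \<in> box p)})"
      by (rule comeager_meets_open[OF cm com open_box ne])
    have z2: "range (evens (fst z)) = range (odds (fst z))"
      and z3: "\<And>n. z \<in> D n \<Longrightarrow> \<exists>p. fst p \<in> lists A \<and> K n p \<and> z \<in> box p"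
      using zC by simp_all
    obtain n where "fst z \<in> near_translate (r / 2) n"
      using near_translate_exists[of "r / 2" "fst z"] assms z2 by auto
    then have "z \<in> D n" using z by (cases z) (auto simp: D_def topspace_space_over)
    then obtain p where p: "K n p" "z \<in> box p" using z3 by blast
    obtain q where "below q p" "below q (s2, 0)" using below_both[OF p(2), of "(s2, 0)"] z by blast
    then show ?thesis using K p(1) by blast
  qed
  then obtain n p where p: "below p (s2, 0)" "K n p" by blast
  obtain s'' where s'': "fst p = s2 @ s''" using p(1) by (auto simp: below_def)
  \<comment> \<open>If the length is odd, the extra entry belongs to the even half, hence the
    rounding up.\<close>
  define te where "te = map (\<lambda>i. fst p ! (2 * i)) [0..<(length (fst p) + 1) div 2]"
  define t where "t = map (\<lambda>i. fst p ! (2 * i + 1)) [0..<length (fst p) div 2]"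
  have cyl: "interleave e e' \<in> cyl (fst p)" if "e \<in> cyl te" "e' \<in> cyl t" for e e'
    unfolding cyl_def
  proof (intro CollectI allI impI)
    fix i assume i: "i < length (fst p)"
    show "interleave e e' i = fst p ! i"
    proof (cases "even i")
      case True
      then have "i div 2 < length te" using i by (auto simp: te_def elim!: evenE)
      then have "e (i div 2) = te ! (i div 2)" using that(1) by (simp add: cyl_def)
      then show ?thesis using True \<open>i div 2 < length te\<close> by (simp add: interleave_def te_def)
    next
      case False
      then have *: "i div 2 < length t" using i by (auto simp: t_def elim!: oddE)
      then have "e' (i div 2) = t ! (i div 2)" using that(2) by (simp add: cyl_def)
      then show ?thesis using False * by (simp add: interleave_def t_def)
    qed
  qed
  have lt: "length s \<le> length t" using s'' by (simp add: t_def s2_def)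
  have "t ! i = s ! i" if "i < length s" for i
    using that lt s'' by (simp add: t_def nth_append s2_def)
  then have "take (length s) t = s"
    using lt by (intro nth_equalityI) auto
  then have "t = s @ drop (length s) t" by (metis append_take_drop_id)
  moreover have "club (\<lambda>A. \<exists>E. comeager (seqs A) (- cyl t \<union> E) \<and> (\<forall>e \<in> E. \<forall>e' \<in> E. near r e e'))"
    using club_conj[OF club_lists[of "fst p"] Kclub[of n]]
  proof (rule club_mono, elim conjE)
    fix A assume A: "countable A" "A \<noteq> {}" "fst p \<in> lists A"
      and "\<forall>p. fst p \<in> lists A \<longrightarrow> K n p \<longrightarrow> comeager (space_over A) (- box p \<union> D n)"
    then have "comeager (prod_topology (seqs A) T) (- box p \<union> D n)"
      using p(2) unfolding space_over_def by blast
    \<comment> \<open>This removes the dummy coordinate: a comeager set of group elements meets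
      \<open>B (snd p)\<close>, and one such element suffices.\<close>
    from Kuratowski_Ulam[OF second_countable_T this]
    have "comeager (seqs A) (- cyl (fst p) \<union> near_translate (r / 2) n)"
    proof (rule comeager_mono)
      fix x assume "x \<in> {x. comeager T {y. (x, y) \<in> - box p \<union> D n}}"
      then have "comeager T {y. (x, y) \<in> - box p \<union> D n}" by simp
      then obtain h where "h \<in> B (snd p)" "h \<in> {y. (x, y) \<in> - box p \<union> D n}"
        by (rule comeager_meets_open[OF completely_metrizable_T _ base_open base_nonempty])
      then show "x \<in> - cyl (fst p) \<union> near_translate (r / 2) n" by (auto simp: box_def D_def)
    qed
    \<comment> \<open>Now the sequence is split into its halves. One generic first half
      \<open>e\<close> through \<open>te\<close> is fixed and becomes the common reference point for
      almost all second halves through \<open>t\<close>.\<close>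
    from Kuratowski_Ulam[OF second_countable_seqs[OF A(1)] comeager_interleave[OF this]]
    have com: "comeager (seqs A) {e. comeager (seqs A)
        {e'. interleave e e' \<in> - cyl (fst p) \<union> near_translate (r / 2) n}}" by simp
    have "te \<in> lists A" using A(3) by (auto simp: te_def in_lists_conv_set)
    then obtain e' where "e' \<in> cyl te" "range e' \<subseteq> A" using A(2) by (rule cyl_nonempty)
    then have ne: "cyl te \<inter> {e. range e \<subseteq> A} \<noteq> {}" by blast
    obtain e where e1: "e \<in> cyl te \<inter> {e. range e \<subseteq> A}"
      and e2: "e \<in> {e. comeager (seqs A)
        {e'. interleave e e' \<in> - cyl (fst p) \<union> near_translate (r / 2) n}}"
      by (rule comeager_meets_open[OF completely_metrizable_seqs com openin_seqs_cyl ne])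
    have e: "e \<in> cyl te"
      "comeager (seqs A) {e'. interleave e e' \<in> - cyl (fst p) \<union> near_translate (r / 2) n}"
      using e1 e2 by simp_all
    let ?E = "{e'. interleave e e' \<in> near_translate (r / 2) n}"
    have "comeager (seqs A) (- cyl t \<union> ?E)"
      using e(2) by (rule comeager_mono) (use cyl[OF e(1)] in blast)
    moreover have "\<forall>e1 \<in> ?E. \<forall>e2 \<in> ?E. near r e1 e2"
      using near_common_translate by blast
    ultimately show "\<exists>E. comeager (seqs A) (- cyl t \<union> E) \<and> (\<forall>e \<in> E. \<forall>e' \<in> E. near r e e')" by blast
  qed
  ultimately show ?thesis by blast
qed

section \<open>Translations and infinite products in the group\<close>

lemma comeager_right_translate:
  assumes C: "comeager T C" and b: "b \<in> carrier G"
  shows "comeager T {h. h \<otimes> b \<in> C}"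
proof (rule comeager_preimage[OF _ _ C])
  have cont: "continuous_map T T (\<lambda>h. h \<otimes> c)" if "c \<in> carrier G" for c
  proof -
    have "continuous_map T (prod_topology T T) (\<lambda>h. (h, c))"
      using that by (intro continuous_map_pairedI) auto
    moreover have "continuous_map (prod_topology T T) T (\<lambda>(a, h). a \<otimes> h)"
      using top by (simp add: topological_group_def)
    ultimately show ?thesis
      using continuous_map_compose by (fastforce simp: comp_def)
  qed
  show "continuous_map T T (\<lambda>h. h \<otimes> b)" using b by (rule cont)
  show "open_map T T (\<lambda>h. h \<otimes> b)"
    unfolding open_map_def
  proof (intro allI impI)
    fix U assume U: "openin T U"
    then have UG: "U \<subseteq> carrier G" using openin_subset by fastforce
    have "(\<lambda>h. h \<otimes> b) ` U = {h \<in> topspace T. h \<otimes> inv b \<in> U}"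
    proof (rule Set.set_eqI, rule iffI)
      fix h assume "h \<in> (\<lambda>h. h \<otimes> b) ` U"
      then show "h \<in> {h \<in> topspace T. h \<otimes> inv b \<in> U}"
        using UG b by (auto simp: m_assoc subset_iff)
    next
      fix h assume "h \<in> {h \<in> topspace T. h \<otimes> inv b \<in> U}"
      then show "h \<in> (\<lambda>h. h \<otimes> b) ` U"
        using b by (intro image_eqI[of _ _ "h \<otimes> inv b"]) (auto simp: m_assoc)
    qed
    then show "openin T ((\<lambda>h. h \<otimes> b) ` U)"
      using openin_continuous_map_preimage[OF cont[OF inv_closed[OF b]] U] by simp
  qed
qed

text \<open>The inverses of the partial products \<open>w k \<otimes> \<dots> \<otimes> w 0\<close> form a Cauchy sequence for the
  left-invariant metric; completeness enters the argument here.\<close>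

lemma partial_products_converge:
  assumes w: "\<And>k. w k \<in> carrier G" "\<And>k. d \<one> (w k) < 1 / 2 ^ k"
    and v: "v 0 = \<one>" "\<And>k. v (Suc k) = w k \<otimes> v k"
  obtains l where "limitin mtopology (\<lambda>k. inv (v k)) l sequentially"
proof -
  have vG: "v k \<in> carrier G" for k by (induction k) (use w v in auto)
  have step: "d (inv (v k)) (inv (v (Suc k))) < 1 / 2 ^ k" for k
  proof -
    have "d (inv (v k)) (inv (v (Suc k))) = d \<one> (inv (w k))"
      using vG w(1) v(2) left_invariant[of "inv (v k)" \<one> "inv (w k)"] by (simp add: inv_mult_group)
    also have "\<dots> = d (w k) \<one>" using dist_one[of "w k" \<one>] w(1) by simp
    finally show ?thesis using w(2)[of k] commute by simp
  qed
  \<comment> \<open>The right-hand side is the exact sum of the bounds in \<open>step\<close> from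
    \<open>m\<close> to \<open>m + j - 1\<close>, so the induction closes.\<close>
  have sum: "d (inv (v m)) (inv (v (m + j))) \<le> 2 / 2 ^ m - 2 / 2 ^ (m + j)" for m j
  proof (induction j)
    case (Suc j)
    have "d (inv (v m)) (inv (v (m + Suc j))) \<le>
        d (inv (v m)) (inv (v (m + j))) + d (inv (v (m + j))) (inv (v (m + Suc j)))"
      using vG by (intro triangle) auto
    also have "\<dots> \<le> 2 / 2 ^ m - 2 / 2 ^ (m + j) + 1 / 2 ^ (m + j)"
      using Suc step[of "m + j"] by simp
    also have "\<dots> = 2 / 2 ^ m - 2 / 2 ^ (m + Suc j)" by (simp add: field_simps)
    finally show ?case .
  qed (use vG in simp)
  have "MCauchy (\<lambda>k. inv (v k))"
    unfolding MCauchy_def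
  proof (intro conjI allI impI)
    show "range (\<lambda>k. inv (v k)) \<subseteq> carrier G" using vG by auto
    fix \<epsilon> :: real assume "\<epsilon> > 0"
    then obtain N where N: "(1 / 2) ^ N < \<epsilon> / 2" using real_arch_pow_inv[of "\<epsilon> / 2" "1 / 2"] by auto
    have le: "d (inv (v m)) (inv (v n)) < \<epsilon>" if "N \<le> m" "m \<le> n" for m n
    proof -
      have "d (inv (v m)) (inv (v n)) \<le> 2 / 2 ^ m - 2 / 2 ^ n"
        using sum[of m "n - m"] that by simp
      also have "\<dots> \<le> 2 * (1 / 2) ^ m" by (simp add: power_one_over)
      also have "\<dots> \<le> 2 * (1 / 2) ^ N" using that by (intro mult_left_mono power_decreasing) auto
      finally show ?thesis using N by simp
    qed
    have "d (inv (v n)) (inv (v n')) < \<epsilon>" if "N \<le> n" "N \<le> n'" for n n'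
      using that le[of n n'] le[of n' n] commute[of "inv (v n)" "inv (v n')"] by (cases "n \<le> n'") simp_all
    then show "\<exists>N. \<forall>n n'. N \<le> n \<longrightarrow> N \<le> n' \<longrightarrow> d (inv (v n)) (inv (v n')) < \<epsilon>" by blast
  qed
  then show thesis using complete that unfolding mcomplete_def by blast
qed

section \<open>The limit argument\<close>

text \<open>The extensions \<open>\<tau> k s\<close> and the forcing predicates \<open>K n\<close>
  are chosen before any countable set; \<open>A0\<close> and \<open>A\<close> are two closure points
  of the same choices. Uncountability of the type provides an element outside
  \<open>A0\<close>.\<close>

theorem countable_UNIV: "countable (UNIV :: 'a set)"
proof (rule ccontr)
  assume unc: "uncountable (UNIV :: 'a set)"
  define near_on where "near_on k t A \<longleftrightarrow> (\<exists>E. comeager (seqs A) (- cyl t \<union> E) \<and>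
    (\<forall>e \<in> E. \<forall>e' \<in> E. near (1 / 2 ^ k) e e'))" for k :: nat and t A
  define ext where "ext k s t \<longleftrightarrow> (\<exists>s'. t = s @ s') \<and> club (near_on k t)" for k s t
  have "\<exists>t. ext k s t" for k s
    unfolding ext_def near_on_def[abs_def] by (rule near_condition_exists) simp
  then obtain \<tau> where "\<And>k s. ext k s (\<tau> k s)" by metis
  then have \<tau>: "\<And>k s. \<exists>s'. \<tau> k s = s @ s'" "\<And>k s. club (near_on k (\<tau> k s))"
    unfolding ext_def by blast+
  define decides where "decides n K A \<longleftrightarrow>
    (\<forall>p. fst p \<in> lists A \<longrightarrow> K p \<longrightarrow> comeager (space_over A) (- box p \<union> orbit_in n)) \<and>
    comeager (space_over A) {z. z \<in> orbit_in n \<longrightarrow> (\<exists>p. fst p \<in> lists A \<and> K p \<and> z \<in> box p)}" for n K A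
  have "\<exists>K. club (decides n K)" for n
  proof (rule suslin_forcing[OF suslin_orbit_in[of n]])
    fix K
    assume "club (\<lambda>A. (\<forall>p. fst p \<in> lists A \<longrightarrow> K p \<longrightarrow> comeager (space_over A) (- box p \<union> orbit_in n)) \<and>
        comeager (space_over A) {z. z \<in> orbit_in n \<longrightarrow> (\<exists>p. fst p \<in> lists A \<and> K p \<and> z \<in> box p)})"
    then have "club (decides n K)" unfolding decides_def[abs_def] .
    then show "\<exists>K. club (decides n K)" by (rule exI[of _ K])
  qed
  then obtain K where K: "\<And>n. club (decides n (K n))" by metis
  define good where "good A \<longleftrightarrow>
    (\<forall>s \<in> lists A. \<forall>k. \<tau> k s \<in> lists A \<and> near_on k (\<tau> k s) A) \<and> (\<forall>n. decides n (K n) A)" for A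
  have "club good"
    unfolding good_def[abs_def] by (intro club_conj club_diagonal club_all club_lists K \<tau>)
  note closed = club_exists[OF this]
  obtain A0 where A0: "countable A0" "A0 \<noteq> {}" and "good A0"
    by (rule closed[OF countable_empty])
  then have \<tau>0: "\<And>s k. s \<in> lists A0 \<Longrightarrow> \<tau> k s \<in> lists A0" and dec0: "\<And>n. decides n (K n) A0"
    by (simp_all add: good_def)
  obtain a where a: "a \<notin> A0" using unc A0(1) by (metis UNIV_eq_I)
  obtain A where A: "insert a A0 \<subseteq> A" "countable A" "A \<noteq> {}" and "good A"
    by (rule closed[OF countable_insert[OF A0(1)]])
  then have nearA: "\<And>s k. s \<in> lists A \<Longrightarrow> near_on k (\<tau> k s) A" and decA: "\<And>n. decides n (K n) A"
    by (simp_all add: good_def)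
  have lists_mono': "s \<in> lists A" if "s \<in> lists A0" for s
    using that A(1) by (auto simp: in_lists_conv_set)

  \<comment> \<open>Passing through some \<open>\<tau> k s\<close> is a dense requirement over
    \<open>A0\<close>, as \<open>\<tau> k s\<close> extends \<open>s\<close> and \<open>A0\<close>
    is closed under it. The sequence \<open>e0\<close> will satisfy it for all
    \<open>k\<close>.\<close>
  have "comeager (seqs A0) ({e. range e \<subseteq> A0} \<inter> (\<Union>s \<in> lists A0. cyl (\<tau> k s)))" for k
  proof (rule comeager_dense_open)
    have "openin (seqs A0) (\<Union>s \<in> lists A0. cyl (\<tau> k s) \<inter> {e. range e \<subseteq> A0})"
      using openin_seqs_cyl by (intro openin_Union) blast
    moreover have "{e. range e \<subseteq> A0} \<inter> (\<Union>s \<in> lists A0. cyl (\<tau> k s)) =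
        (\<Union>s \<in> lists A0. cyl (\<tau> k s) \<inter> {e. range e \<subseteq> A0})" by blast
    ultimately show "openin (seqs A0) ({e. range e \<subseteq> A0} \<inter> (\<Union>s \<in> lists A0. cyl (\<tau> k s)))" by simp
    fix V assume V: "openin (seqs A0) V" "V \<noteq> {}"
    then obtain e where e: "e \<in> V" by blast
    obtain n where n: "cyl (map e [0..<n]) \<inter> {e. range e \<subseteq> A0} \<subseteq> V"
      using V(1) e by (metis openin_seqs_cylE order_refl)
    let ?s = "map e [0..<n]"
    have s: "?s \<in> lists A0" using openin_subset[OF V(1)] e by (intro prefix_in_lists) auto
    obtain e' where e': "e' \<in> cyl (\<tau> k ?s)" "range e' \<subseteq> A0"
      using cyl_nonempty[OF \<tau>0[OF s] A0(2)] by blast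
    have "cyl (\<tau> k ?s) \<subseteq> cyl ?s" using \<tau>(1)[of k ?s] cyl_append_subset by metis
    then show "{e. range e \<subseteq> A0} \<inter> (\<Union>s \<in> lists A0. cyl (\<tau> k s)) \<inter> V \<noteq> {}"
      using n e' s by blast
  qed
  then have "comeager (seqs A0) (\<Inter>k. {e. range e \<subseteq> A0} \<inter> (\<Union>s \<in> lists A0. cyl (\<tau> k s)))"
    by (rule comeager_all)
  then have com1: "comeager (seqs A0) {e. range e \<subseteq> A0 \<and> (\<forall>k. \<exists>s \<in> lists A0. e \<in> cyl (\<tau> k s))}"
    by (rule comeager_mono) blast
  \<comment> \<open>\<open>H0\<close> and the later \<open>H\<close> are the two halves of the
    forcing theorem on sections: for \<open>h \<in> H0 e\<close> each basic property of
    \<open>h (f e)\<close> that holds is forced over \<open>A0\<close>, for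
    \<open>h \<in> H e\<close> each one forced over \<open>A\<close> at that point holds.\<close>
  define H0 where "H0 e = {h. (e, h) \<in> (\<Inter>n. {z. z \<in> orbit_in n \<longrightarrow>
    (\<exists>p. fst p \<in> lists A0 \<and> K n p \<and> z \<in> box p)})}" for e
  have "comeager (prod_topology (seqs A0) T)
      (\<Inter>n. {z. z \<in> orbit_in n \<longrightarrow> (\<exists>p. fst p \<in> lists A0 \<and> K n p \<and> z \<in> box p)})"
    using dec0 by (intro comeager_all) (simp add: space_over_def decides_def)
  from Kuratowski_Ulam[OF second_countable_T this]
  have com2: "comeager (seqs A0) {e. comeager T (H0 e)}" unfolding H0_def .
  have ne: "topspace (seqs A0) \<noteq> {}"
  proof -
    obtain e where "e \<in> cyl []" "range e \<subseteq> A0" by (rule cyl_nonempty[OF lists.Nil A0(2)])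
    then show ?thesis by auto
  qed
  obtain e0 where "e0 \<in> {e. range e \<subseteq> A0 \<and> (\<forall>k. \<exists>s \<in> lists A0. e \<in> cyl (\<tau> k s))} \<inter>
      {e. comeager T (H0 e)}"
    by (rule comeager_meets_open[OF completely_metrizable_seqs comeager_Int[OF com1 com2] openin_topspace ne])
  then have e0: "range e0 \<subseteq> A0" "\<And>k. \<exists>s \<in> lists A0. e0 \<in> cyl (\<tau> k s)" "comeager T (H0 e0)"
    by simp_all
  from e0(2) obtain s where s: "\<And>k. s k \<in> lists A0" "\<And>k. e0 \<in> cyl (\<tau> k (s k))" by metis
  define t where "t k = \<tau> k (s k)" for k
  have "near_on k (t k) A" for k
    unfolding t_def using nearA lists_mono' s(1) by blast
  then obtain E where E: "\<And>k. comeager (seqs A) (- cyl (t k) \<union> E k)"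
    "\<And>k e e'. e \<in> E k \<Longrightarrow> e' \<in> E k \<Longrightarrow> near (1 / 2 ^ k) e e'"
    unfolding near_on_def by metis

  define H where "H e = {h. \<forall>n p. fst p \<in> lists A \<longrightarrow> K n p \<longrightarrow> (e, h) \<in> box p \<longrightarrow> (e, h) \<in> orbit_in n}" for e
  have "comeager (prod_topology (seqs A) T)
      (\<Inter>z \<in> UNIV \<times> {p. fst p \<in> lists A}. if K (fst z) (snd z) then - box (snd z) \<union> orbit_in (fst z) else UNIV)"
  proof (rule comeager_INT)
    show "countable ((UNIV :: nat set) \<times> {p :: 'a list \<times> nat. fst p \<in> lists A})"
      using countable_conditions[OF A(2)] by (intro countable_SIGMA) auto
    fix z :: "nat \<times> 'a list \<times> nat" assume "z \<in> UNIV \<times> {p. fst p \<in> lists A}"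
    then show "comeager (prod_topology (seqs A) T)
        (if K (fst z) (snd z) then - box (snd z) \<union> orbit_in (fst z) else UNIV)"
      using decA[of "fst z"] by (auto simp: space_over_def comeager_UNIV decides_def)
  qed
  from Kuratowski_Ulam[OF second_countable_T this]
  have "comeager (seqs A) {e. comeager T (H e)}"
  proof (rule comeager_mono, intro CollectI)
    fix e assume "e \<in> {e. comeager T {h. (e, h) \<in> (\<Inter>z \<in> UNIV \<times> {p. fst p \<in> lists A}.
      if K (fst z) (snd z) then - box (snd z) \<union> orbit_in (fst z) else UNIV)}}"
    then have "comeager T {h. (e, h) \<in> (\<Inter>z \<in> UNIV \<times> {p. fst p \<in> lists A}.
      if K (fst z) (snd z) then - box (snd z) \<union> orbit_in (fst z) else UNIV)}" by simp
    then show "comeager T (H e)"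
    proof (rule comeager_mono)
      fix h assume h: "h \<in> {h. (e, h) \<in> (\<Inter>z \<in> UNIV \<times> {p. fst p \<in> lists A}.
        if K (fst z) (snd z) then - box (snd z) \<union> orbit_in (fst z) else UNIV)}"
      have "(e, h) \<in> orbit_in n" if "fst p \<in> lists A" "K n p" "(e, h) \<in> box p" for n p
        using INT_D[OF h[unfolded mem_Collect_eq], of "(n, p)"] that by simp
      then show "h \<in> H e" unfolding H_def by blast
    qed
  qed
  from comeager_Int[OF comeager_Int[OF comeager_range_eq[OF A(2)] this] comeager_all[OF E(1)]]
  have com3: "comeager (seqs A) ({e. range e = A} \<inter> {e. comeager T (H e)} \<inter> (\<Inter>k. - cyl (t k) \<union> E k))" .
  \<comment> \<open>Agreement with \<open>e0\<close> up to \<open>L k\<close> puts a sequence into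
    \<open>cyl (t j)\<close> for all \<open>j \<le> k\<close>; the summand \<open>k\<close> makes
    the agreement eventually exceed the length of any given condition.\<close>
  define L where "L k = k + (\<Sum>j\<le>k. length (t j))" for k
  have "\<exists>e. e \<in> cyl (map e0 [0..<L k]) \<and> range e = A \<and> comeager T (H e) \<and> (\<forall>j\<le>k. e \<in> E j)" for k
  proof -
    have "cyl (map e0 [0..<L k]) \<inter> {e. range e \<subseteq> A} \<noteq> {}"
      using e0(1) A(1) cyl_prefix[of e0 "L k"] by blast
    then obtain e where e1: "e \<in> cyl (map e0 [0..<L k]) \<inter> {e. range e \<subseteq> A}"
      and e2: "e \<in> {e. range e = A} \<inter> {e. comeager T (H e)} \<inter> (\<Inter>k. - cyl (t k) \<union> E k)"
      by (rule comeager_meets_open[OF completely_metrizable_seqs com3 openin_seqs_cyl])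
    have e: "e \<in> cyl (map e0 [0..<L k])" "range e = A" "comeager T (H e)"
      "\<And>j. e \<in> - cyl (t j) \<union> E j" using e1 e2 by simp_all
    have "e \<in> cyl (t j)" if "j \<le> k" for j
    proof -
      have "length (t j) \<le> (\<Sum>j\<le>k. length (t j))"
        using that by (intro member_le_sum) auto
      then show ?thesis
        using e(1) s(2)[of j] unfolding cyl_map_iff by (auto simp: cyl_def t_def L_def)
    qed
    then show ?thesis using e by blast
  qed
  then obtain en where en: "\<And>k. en k \<in> cyl (map e0 [0..<L k])" "\<And>k. range (en k) = A"
    "\<And>k. comeager T (H (en k))" "\<And>k j. j \<le> k \<Longrightarrow> en k \<in> E j"
    by metis
  \<comment> \<open>Consecutive sequences both lie in \<open>E k\<close>: this is why
    \<open>en k\<close> was required to lie in \<open>E j\<close> for all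
    \<open>j \<le> k\<close>.\<close>
  have "near (1 / 2 ^ k) (en k) (en (Suc k))" for k
    using E(2) en(4) by simp
  then obtain w where w: "\<And>k. w k \<in> carrier G" "\<And>k. d \<one> (w k) < 1 / 2 ^ k"
    "\<And>k. f (en (Suc k)) = \<phi> (w k) (f (en k))"
    unfolding near_def by metis
  define v where "v = rec_nat \<one> (\<lambda>k b. w k \<otimes> b)"
  have v: "v 0 = \<one>" "v (Suc k) = w k \<otimes> v k" for k by (simp_all add: v_def)
  have vG [simp]: "v k \<in> carrier G" for k by (induction k) (use w v in auto)
  have fv: "f (en k) = \<phi> (v k) (f (en 0))" for k
    by (induction k) (simp_all add: v act_one w act_mult)
  obtain l where l: "limitin mtopology (\<lambda>k. inv (v k)) l sequentially"
    using partial_products_converge[OF w(1,2) v] by blast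
  then have lG [simp]: "l \<in> carrier G" by (simp add: limitin_def)
  \<comment> \<open>Right translation preserves comeagerness, so one \<open>h\<close> can be generic
    for \<open>e0\<close> while all its countably many translates are generic for the respective
    \<open>en k\<close>.\<close>
  have "comeager T {h. h \<otimes> (inv l \<otimes> inv (v k)) \<in> H (en k)}" for k
    by (intro comeager_right_translate en) simp
  note com = comeager_Int[OF comeager_all[OF this] e0(3)]
  have ne: "topspace T \<noteq> {}" using one_closed by auto
  obtain h where h1: "h \<in> topspace T"
    and h2: "h \<in> (\<Inter>k. {h. h \<otimes> (inv l \<otimes> inv (v k)) \<in> H (en k)}) \<inter> H0 e0"
    by (rule comeager_meets_open[OF completely_metrizable_T com openin_topspace ne])
  have h: "h \<in> carrier G" "\<And>k. h \<otimes> (inv l \<otimes> inv (v k)) \<in> H (en k)"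
    "\<And>n. (e0, h) \<in> orbit_in n \<Longrightarrow> \<exists>p. fst p \<in> lists A0 \<and> K n p \<and> (e0, h) \<in> box p"
    using h1 h2 by (simp_all add: H0_def)
  have "\<phi> h (f e0) = \<phi> h (\<phi> (inv l) (f (en 0)))"
  proof (rule S_separates, simp_all add: h(1), intro allI impI)
    fix n assume "\<phi> h (f e0) \<in> S n"
    then have "(e0, h) \<in> orbit_in n" using h(1) by (simp add: orbit_in_def)
    then obtain p where "fst p \<in> lists A0 \<and> K n p \<and> (e0, h) \<in> box p"
      using h(3) by blast
    then have p: "fst p \<in> lists A0" "K n p" "e0 \<in> cyl (fst p)" "h \<in> B (snd p)"
      unfolding box_def by simp_all
    have "openin mtopology (B (snd p))" using base_open metric by simp
    then obtain \<epsilon> where \<epsilon>: "\<epsilon> > 0" "mball h \<epsilon> \<subseteq> B (snd p)"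
      using p(4) unfolding openin_mtopology by blast
    have "eventually (\<lambda>k. inv (v k) \<in> carrier G \<and> d (inv (v k)) l < \<epsilon>) sequentially"
      using l \<epsilon>(1) unfolding limitin_metric by blast
    then obtain k where k: "k \<ge> length (fst p)" "d (inv (v k)) l < \<epsilon>"
      unfolding eventually_sequentially by (meson nat_le_linear order_trans)
    \<comment> \<open>These elements tend to \<open>h\<close>, yet \<open>?b\<close> sends
      \<open>f (en k)\<close> to the same point \<open>h (inv l (f (en 0)))\<close> for every
      \<open>k\<close>.\<close>
    let ?b = "h \<otimes> (inv l \<otimes> inv (v k))"
    have "d ?b h = d ((h \<otimes> inv l) \<otimes> inv (v k)) ((h \<otimes> inv l) \<otimes> l)"
      using h(1) by (simp add: m_assoc)
    also have "\<dots> = d (inv (v k)) l" using h(1) by (intro left_invariant) auto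
    finally have "?b \<in> B (snd p)" using \<epsilon>(2) k(2) h(1) by (auto simp: commute)
    moreover have "en k \<in> cyl (fst p)"
      using en(1)[of k] p(3) k(1) unfolding cyl_map_iff by (auto simp: cyl_def L_def)
    ultimately have "(en k, ?b) \<in> box p" by (simp add: box_def)
    then have "(en k, ?b) \<in> orbit_in n"
      using h(2)[of k] p(1,2) lists_mono' unfolding H_def by blast
    then have "\<phi> ?b (f (en k)) \<in> S n" by (simp add: orbit_in_def)
    then show "\<phi> h (\<phi> (inv l) (f (en 0))) \<in> S n"
      using h(1) by (simp add: fv[of k] act_mult act_inv)
  qed
  then have "\<phi> (inv h) (\<phi> h (f e0)) = \<phi> (inv h) (\<phi> h (\<phi> (inv l) (f (en 0))))" by simp
  then have "f e0 = \<phi> (inv l) (f (en 0))" using h(1) by (simp add: act_inv)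
  then have "range (en 0) = range e0"
    using f_reduction[of e0 "en 0"] lG inv_closed by blast
  then show False using en(2)[of 0] e0(1) a A(1) by blast
qed

end

section \<open>Operators given by an orthonormal sequence\<close>

lemma scaleC_one [simp]: "1 *\<^sub>C x = (x :: 'h::complex_hilbert)"
  using scaleR_eq_scaleC[of 1 x] by simp

lemma scaleC_zero_left [simp]: "0 *\<^sub>C x = (0 :: 'h::complex_hilbert)"
  using scaleR_eq_scaleC[of 0 x] by simp

lemma scaleC_zero_right [simp]: "c *\<^sub>C 0 = (0 :: 'h::complex_hilbert)"
  using scaleC_add_right[of c 0 0] by simp

lemma scaleC_minus_left: "(- c) *\<^sub>C x = - (c *\<^sub>C (x :: 'h::complex_hilbert))"
  using scaleC_add_left[of "- c" c x] by (simp add: eq_neg_iff_add_eq_0)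

lemma scaleC_minus_right: "c *\<^sub>C (- x) = - (c *\<^sub>C (x :: 'h::complex_hilbert))"
  using scaleC_add_right[of c "- x" x] by (simp add: eq_neg_iff_add_eq_0)

lemma scaleC_diff_right: "c *\<^sub>C (x - y) = c *\<^sub>C x - c *\<^sub>C (y :: 'h::complex_hilbert)"
  using scaleC_add_right[of c x "- y"] by (simp add: scaleC_minus_right)

lemma scaleC_diff_left: "(b - c) *\<^sub>C x = b *\<^sub>C x - c *\<^sub>C (x :: 'h::complex_hilbert)"
  using scaleC_add_left[of b "- c" x] by (simp add: scaleC_minus_left)

lemma cinner_add_right: "cinner x (y + z) = cinner x y + cinner x (z :: 'h::complex_hilbert)"
  by (metis cinner_add_left cinner_commute complex_cnj_add)

lemma cinner_scaleC_right: "cinner x (c *\<^sub>C y) = cnj c * cinner x (y :: 'h::complex_hilbert)"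
  by (metis cinner_scaleC_left cinner_commute complex_cnj_mult)

lemma cinner_zero_left [simp]: "cinner 0 (x :: 'h::complex_hilbert) = 0"
  using cinner_scaleC_left[of 0 x x] by simp

lemma cinner_zero_right [simp]: "cinner (x :: 'h::complex_hilbert) 0 = 0"
  using cinner_scaleC_right[of x 0 x] by simp

lemma cinner_minus_left: "cinner (- x) (y :: 'h::complex_hilbert) = - cinner x y"
  using cinner_add_left[of "- x" x y] by (simp add: eq_neg_iff_add_eq_0)

lemma cinner_diff_left: "cinner (x - y) (z :: 'h::complex_hilbert) = cinner x z - cinner y z"
  using cinner_add_left[of x "- y" z] by (simp add: cinner_minus_left)

lemma cinner_diff_right: "cinner z (x - y :: 'h::complex_hilbert) = cinner z x - cinner z y"
  by (metis cinner_commute cinner_diff_left complex_cnj_diff)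

lemma cinner_sum_left: "cinner (\<Sum>i\<in>I. f i) (y :: 'h::complex_hilbert) = (\<Sum>i\<in>I. cinner (f i) y)"
  by (induction I rule: infinite_finite_induct) (simp_all add: cinner_add_left)

lemma cinner_sum_right: "cinner y (\<Sum>i\<in>I. f i :: 'h::complex_hilbert) = (\<Sum>i\<in>I. cinner y (f i))"
  by (induction I rule: infinite_finite_induct) (simp_all add: cinner_add_right)

lemma cinner_self: "cinner x x = complex_of_real ((norm (x :: 'h::complex_hilbert))\<^sup>2)"
proof -
  have "Im (cinner x x) = 0" using cinner_commute[of x x] by (metis Im_complex_of_real Reals_cnj_iff complex_is_Real_iff)
  moreover have "(norm x)\<^sup>2 = Re (cinner x x)"
    by (simp add: norm_eq_sqrt_cinner cinner_self_nonneg)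
  ultimately show ?thesis by (simp add: complex_eq_iff)
qed

lemma complex_mult_cnj_norm: "z * cnj z = (complex_of_real (cmod z))\<^sup>2"
  by (metis complex_norm_square of_real_power)

lemma norm_scaleC: "norm (c *\<^sub>C (x :: 'h::complex_hilbert)) = cmod c * norm x"
proof -
  have "complex_of_real ((norm (c *\<^sub>C x))\<^sup>2) = complex_of_real ((cmod c * norm x)\<^sup>2)"
  proof -
    have "complex_of_real ((norm (c *\<^sub>C x))\<^sup>2) = (c * cnj c) * cinner x x"
      unfolding cinner_self[symmetric] by (simp add: cinner_scaleC_left cinner_scaleC_right)
    then show ?thesis by (simp add: complex_mult_cnj_norm cinner_self power_mult_distrib)
  qed
  then have "(norm (c *\<^sub>C x))\<^sup>2 = (cmod c * norm x)\<^sup>2" by (simp only: of_real_eq_iff)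
  then show ?thesis by (simp add: power2_eq_iff_nonneg)
qed

lemma cinner_Cauchy_Schwarz: "cmod (cinner x y) \<le> norm x * norm (y :: 'h::complex_hilbert)"
proof (cases "y = 0")
  case False
  then have y: "norm y > 0" by simp
  \<comment> \<open>The coefficient of the orthogonal projection of \<open>x\<close> to the line of
    \<open>y\<close>; the remainder has nonnegative squared norm.\<close>
  define c where "c = cinner x y / complex_of_real ((norm y)\<^sup>2)"
  have cy: "c * complex_of_real ((norm y)\<^sup>2) = cinner x y" using y by (simp add: c_def)
  have "complex_of_real ((norm (x - c *\<^sub>C y))\<^sup>2) = cinner (x - c *\<^sub>C y) (x - c *\<^sub>C y)"
    by (simp add: cinner_self)
  also have "\<dots> = cinner x x - cnj c * cinner x y - c * cinner y x + c * cnj c * cinner y y"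
    by (simp add: cinner_diff_left cinner_diff_right cinner_scaleC_left cinner_scaleC_right algebra_simps)
  also have "c * cnj c * cinner y y = cnj c * cinner x y"
    unfolding cinner_self[of y] cy[symmetric] by (simp add: mult_ac)
  also have "c * cinner y x = complex_of_real ((cmod (cinner x y))\<^sup>2 / (norm y)\<^sup>2)"
    unfolding c_def cinner_commute[of y x] by (simp add: complex_mult_cnj_norm)
  also have "cinner x x - cnj c * cinner x y - complex_of_real ((cmod (cinner x y))\<^sup>2 / (norm y)\<^sup>2) +
      cnj c * cinner x y = complex_of_real ((norm x)\<^sup>2 - (cmod (cinner x y))\<^sup>2 / (norm y)\<^sup>2)"
    by (simp add: cinner_self)
  finally have "(norm (x - c *\<^sub>C y))\<^sup>2 = (norm x)\<^sup>2 - (cmod (cinner x y))\<^sup>2 / (norm y)\<^sup>2"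
    by (simp only: of_real_eq_iff)
  then have "(cmod (cinner x y))\<^sup>2 / (norm y)\<^sup>2 \<le> (norm x)\<^sup>2" by (metis diff_ge_0_iff_ge zero_le_power2)
  then have "(cmod (cinner x y))\<^sup>2 \<le> (norm x * norm y)\<^sup>2"
    using y by (simp add: divide_le_eq power_mult_distrib)
  then show ?thesis by (rule power2_le_imp_le) simp
qed simp

lemma bounded_linear_cinner_left: "bounded_linear (\<lambda>x :: 'h::complex_hilbert. cinner x y)"
  by (rule bounded_linear_intro[of _ "norm y"])
    (auto simp: cinner_add_left scaleR_eq_scaleC cinner_scaleC_left scaleR_conv_of_real cinner_Cauchy_Schwarz)

lemma bounded_linear_scaleC: "bounded_linear (\<lambda>x :: 'h::complex_hilbert. c *\<^sub>C x)"
  by (rule bounded_linear_intro[of _ "cmod c"])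
    (auto simp: scaleC_add_right scaleR_eq_scaleC scaleC_scaleC norm_scaleC mult.commute)

lemma cinner_eqI:
  assumes "\<And>y. cinner x y = cinner x' (y :: 'h::complex_hilbert)"
  shows "x = x'"
proof -
  have "cinner (x - x') (x - x') = 0" using assms by (simp add: cinner_diff_left)
  then show ?thesis by (simp add: cinner_self)
qed

lemma cinner_eqI_right:
  assumes "\<And>x. cinner x y = cinner x (y' :: 'h::complex_hilbert)"
  shows "y = y'"
  by (rule cinner_eqI) (metis assms cinner_commute)

section \<open>Orthonormal sequences and expansions\<close>

definition orthonormal :: "(nat \<Rightarrow> 'h::complex_hilbert) \<Rightarrow> bool" where
  "orthonormal b \<longleftrightarrow> (\<forall>i j. cinner (b i) (b j) = (if i = j then 1 else 0))"

text \<open>Gram-Schmidt: a finite list never spans, so a vector outside its span leaves a nonzero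
  remainder. The lists grow by dependent choice, and \<open>b\<close> reads off the entry added at
  each stage.\<close>

lemma orthonormal_exists:
  assumes "infinite_dimensional TYPE('h::complex_hilbert)"
  shows "\<exists>b :: nat \<Rightarrow> 'h. orthonormal b"
proof -
  define P where "P n l \<longleftrightarrow> length l = n \<and>
    (\<forall>i<n. \<forall>j<n. cinner (l ! i) (l ! j) = (if i = j then 1 else 0))" for n and l :: "'h list"
  have step: "\<exists>l'. P (Suc n) l' \<and> (\<exists>x. l' = l @ [x])" if P: "P n l" for n l
  proof -
    have len: "length l = n" and on: "\<And>i j. i < n \<Longrightarrow> j < n \<Longrightarrow> cinner (l ! i) (l ! j) = (if i = j then 1 else 0)"
      using P by (auto simp: P_def)
    have "module.span scaleC (set l) \<noteq> UNIV"
      using assms unfolding infinite_dimensional_def by blast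
    then obtain x where x: "x \<notin> module.span scaleC (set l)" by blast
    interpret module "scaleC :: complex \<Rightarrow> 'h \<Rightarrow> 'h" by (rule module_scaleC)
    define z where "z = x - (\<Sum>i<n. cinner x (l ! i) *\<^sub>C (l ! i))"
    have "(\<Sum>i<n. cinner x (l ! i) *\<^sub>C (l ! i)) \<in> span (set l)"
      using len by (intro span_sum span_scale span_base) auto
    then have "z \<noteq> 0" using x by (auto simp: z_def)
    have zl: "cinner z (l ! j) = 0" if "j < n" for j
    proof -
      have "(\<Sum>i<n. cinner x (l ! i) * cinner (l ! i) (l ! j)) = (\<Sum>i<n. if i = j then cinner x (l ! j) else 0)"
        using on that by (intro sum.cong) auto
      then show ?thesis
        using that by (simp add: z_def cinner_diff_left cinner_sum_left cinner_scaleC_left)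
    qed
    define y where "y = complex_of_real (1 / norm z) *\<^sub>C z"
    have "cinner y y = 1"
    proof -
      have "norm y = 1"
        using \<open>z \<noteq> 0\<close> unfolding y_def norm_scaleC norm_of_real by simp
      then show ?thesis by (simp add: cinner_self)
    qed
    moreover have yl: "cinner y (l ! j) = 0" if "j < n" for j
      using zl[OF that] by (simp add: y_def cinner_scaleC_left)
    moreover have "cinner (l ! j) y = 0" if "j < n" for j
      using yl[OF that] cinner_commute[of "l ! j" y] by simp
    ultimately have "P (Suc n) (l @ [y])"
      using len on by (auto simp: P_def nth_append less_Suc_eq)
    then show ?thesis by blast
  qed
  have "\<exists>f. \<forall>n. P n (f n) \<and> (\<exists>x. f (Suc n) = f n @ [x])"
  proof (rule dependent_nat_choice)
    show "\<exists>l. P 0 l" by (simp add: P_def)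
  qed (rule step)
  then obtain f where f: "\<And>n. P n (f n)" "\<And>n. \<exists>x. f (Suc n) = f n @ [x]" by blast
  have len: "length (f n) = n" for n using f(1) by (simp add: P_def)
  have pre: "i < n \<Longrightarrow> f (n + m) ! i = f n ! i" for i n m
  proof (induction m)
    case (Suc m)
    then show ?case using f(2)[of "n + m"] len[of "n + m"] by (auto simp: nth_append)
  qed simp
  define b where "b i = f (Suc i) ! i" for i
  have b: "b i = f n ! i" if "i < n" for i n
    using pre[of i "Suc i" "n - Suc i"] that by (simp add: b_def)
  have "cinner (b i) (b j) = (if i = j then 1 else 0)" for i j
    using f(1)[of "Suc (max i j)"] b[of i "Suc (max i j)"] b[of j "Suc (max i j)"]
    by (simp add: P_def less_Suc_eq_le)
  then show ?thesis unfolding orthonormal_def by blast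
qed

locale orthonormal_seq =
  fixes b :: "nat \<Rightarrow> 'h::complex_hilbert"
  assumes orthonormal: "orthonormal b"
begin

lemma cinner_b: "cinner (b i) (b j) = (if i = j then 1 else 0)"
  using orthonormal by (simp add: orthonormal_def)

lemma norm_sum_b:
  assumes "finite I"
  shows "(norm (\<Sum>i\<in>I. a i *\<^sub>C b i))\<^sup>2 = (\<Sum>i\<in>I. (cmod (a i))\<^sup>2)"
proof -
  have "complex_of_real ((norm (\<Sum>i\<in>I. a i *\<^sub>C b i))\<^sup>2) = (\<Sum>i\<in>I. \<Sum>j\<in>I. a i * (cnj (a j) * cinner (b i) (b j)))"
    unfolding cinner_self[symmetric]
    unfolding cinner_sum_left cinner_scaleC_left
    by (simp add: cinner_sum_right cinner_scaleC_right sum_distrib_left)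
  also have "\<dots> = (\<Sum>i\<in>I. a i * cnj (a i))"
  proof (rule sum.cong[OF refl])
    fix i assume "i \<in> I"
    have "(\<Sum>j\<in>I. a i * (cnj (a j) * cinner (b i) (b j))) = (\<Sum>j\<in>I. if j = i then a i * cnj (a i) else 0)"
      by (intro sum.cong) (auto simp: cinner_b)
    then show "(\<Sum>j\<in>I. a i * (cnj (a j) * cinner (b i) (b j))) = a i * cnj (a i)"
      using assms \<open>i \<in> I\<close> by simp
  qed
  also have "\<dots> = complex_of_real (\<Sum>i\<in>I. (cmod (a i))\<^sup>2)"
    by (simp add: complex_mult_cnj_norm)
  finally show ?thesis by (simp only: of_real_eq_iff)
qed

lemma Bessel:
  assumes "finite I"
  shows "(\<Sum>i\<in>I. (cmod (cinner x (b i)))\<^sup>2) \<le> (norm x)\<^sup>2"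
proof -
  let ?p = "\<Sum>i\<in>I. cinner x (b i) *\<^sub>C b i"
  let ?s = "\<Sum>i\<in>I. (cmod (cinner x (b i)))\<^sup>2"
  have 1: "cinner x ?p = complex_of_real ?s"
    by (simp add: cinner_sum_right cinner_scaleC_right mult.commute[of "cnj _"] complex_mult_cnj_norm)
  then have 2: "cinner ?p x = complex_of_real ?s"
    using cinner_commute[of ?p x] by simp
  have "complex_of_real ((norm (x - ?p))\<^sup>2) = cinner x x - cinner x ?p - cinner ?p x + cinner ?p ?p"
    unfolding cinner_self[of "x - ?p", symmetric] by (simp add: cinner_diff_left cinner_diff_right)
  also have "\<dots> = complex_of_real ((norm x)\<^sup>2 - ?s)"
    unfolding 1 2 cinner_self norm_sum_b[OF assms] by simp
  finally have "(norm (x - ?p))\<^sup>2 = (norm x)\<^sup>2 - ?s" by (simp only: of_real_eq_iff)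
  then show ?thesis by (metis diff_ge_0_iff_ge zero_le_power2)
qed

lemma summable_coeff:
  assumes "inj \<tau>"
  shows "summable (\<lambda>n. (cmod (cinner x (b (\<tau> n))))\<^sup>2)"
    and "(\<Sum>n. (cmod (cinner x (b (\<tau> n))))\<^sup>2) \<le> (norm x)\<^sup>2"
proof -
  have le: "(\<Sum>n<N. (cmod (cinner x (b (\<tau> n))))\<^sup>2) \<le> (norm x)\<^sup>2" for N
  proof -
    have "(\<Sum>n<N. (cmod (cinner x (b (\<tau> n))))\<^sup>2) = (\<Sum>i\<in>\<tau> ` {..<N}. (cmod (cinner x (b i)))\<^sup>2)"
      using assms by (subst sum.reindex) (auto intro: inj_on_subset)
    then show ?thesis using Bessel by simp
  qed
  show s: "summable (\<lambda>n. (cmod (cinner x (b (\<tau> n))))\<^sup>2)"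
    using le by (intro bounded_imp_summable[of _ "(norm x)\<^sup>2"]) (auto simp: lessThan_Suc_atMost[symmetric] simp del: sum.lessThan_Suc lessThan_Suc)
  show "(\<Sum>n. (cmod (cinner x (b (\<tau> n))))\<^sup>2) \<le> (norm x)\<^sup>2"
    using le by (intro suminf_le_const[OF s])
qed

definition synth :: "(nat \<Rightarrow> complex) \<Rightarrow> 'h" where
  "synth a = (\<Sum>n. a n *\<^sub>C b n)"

lemma summable_synth:
  assumes "summable (\<lambda>n. (cmod (a n))\<^sup>2)"
  shows "summable (\<lambda>n. a n *\<^sub>C b n)"
  unfolding summable_Cauchy
proof (intro allI impI)
  fix \<epsilon> :: real assume "\<epsilon> > 0"
  then obtain N where N: "\<And>m n. m \<ge> N \<Longrightarrow> norm (\<Sum>i=m..<n. (cmod (a i))\<^sup>2) < \<epsilon>\<^sup>2"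
    using assms unfolding summable_Cauchy by (metis zero_less_power)
  have "norm (\<Sum>i=m..<n. a i *\<^sub>C b i) < \<epsilon>" if "m \<ge> N" for m n
  proof (rule power2_less_imp_less)
    have "(\<Sum>i=m..<n. (cmod (a i))\<^sup>2) \<ge> 0" by (intro sum_nonneg) simp
    then show "(norm (\<Sum>i=m..<n. a i *\<^sub>C b i))\<^sup>2 < \<epsilon>\<^sup>2"
      using N[OF that, of n] by (simp add: norm_sum_b)
  qed (use \<open>\<epsilon> > 0\<close> in simp)
  then show "\<exists>N. \<forall>m\<ge>N. \<forall>n. norm (\<Sum>i=m..<n. a i *\<^sub>C b i) < \<epsilon>" by blast
qed

lemma norm_synth:
  assumes "summable (\<lambda>n. (cmod (a n))\<^sup>2)"
  shows "(norm (synth a))\<^sup>2 = (\<Sum>n. (cmod (a n))\<^sup>2)"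
proof -
  have "(\<lambda>N. (norm (\<Sum>n<N. a n *\<^sub>C b n))\<^sup>2) \<longlonglongrightarrow> (norm (synth a))\<^sup>2"
    unfolding synth_def by (intro tendsto_power tendsto_norm summable_LIMSEQ summable_synth assms)
  moreover have "(\<lambda>N. (norm (\<Sum>n<N. a n *\<^sub>C b n))\<^sup>2) \<longlonglongrightarrow> (\<Sum>n. (cmod (a n))\<^sup>2)"
    using summable_LIMSEQ[OF assms] by (simp add: norm_sum_b)
  ultimately show ?thesis by (rule LIMSEQ_unique)
qed

lemma cinner_synth_sums:
  assumes "summable (\<lambda>n. (cmod (a n))\<^sup>2)"
  shows "(\<lambda>n. a n * cinner (b n) y) sums cinner (synth a) y"
  using bounded_linear.sums[OF bounded_linear_cinner_left summable_sums[OF summable_synth[OF assms]], of y]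
  by (simp add: synth_def cinner_scaleC_left)

lemma cinner_synth_b:
  assumes "summable (\<lambda>n. (cmod (a n))\<^sup>2)"
  shows "cinner (synth a) (b k) = a k"
proof -
  have "(\<lambda>n. a n * cinner (b n) (b k)) = (\<lambda>n. if n = k then a n else 0)"
    by (auto simp: cinner_b)
  then show ?thesis
    using sums_unique2[OF cinner_synth_sums[OF assms, of "b k"] ] sums_single[of k a] by simp
qed

lemma synth_add:
  assumes "summable (\<lambda>n. (cmod (a n))\<^sup>2)" "summable (\<lambda>n. (cmod (a' n))\<^sup>2)"
  shows "synth (\<lambda>n. a n + a' n) = synth a + synth a'"
  unfolding synth_def using suminf_add[OF summable_synth summable_synth, OF assms]
  by (simp add: scaleC_add_left)

lemma synth_mult:
  assumes "summable (\<lambda>n. (cmod (a n))\<^sup>2)"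
  shows "synth (\<lambda>n. c * a n) = c *\<^sub>C synth a"
  unfolding synth_def using bounded_linear.suminf[OF bounded_linear_scaleC summable_synth[OF assms], of c]
  by (simp add: scaleC_scaleC)

lemma synth_zero [simp]: "synth (\<lambda>n. 0) = 0"
  by (simp add: synth_def)

section \<open>Diagonal and permutation operators\<close>

definition proj :: "'h \<Rightarrow> 'h" where
  "proj x = synth (\<lambda>n. cinner x (b n))"

text \<open>The operator that multiplies by \<open>c\<close> on the orthogonal complement of the sequence and maps
  \<open>b (\<tau> n)\<close> to \<open>m n *\<^sub>C b n\<close>. For \<open>\<tau> = id\<close> it is diagonal, for \<open>m = 1\<close> and \<open>c = 1\<close> it
  permutes the sequence.\<close>

definition weighted :: "complex \<Rightarrow> (nat \<Rightarrow> complex) \<Rightarrow> (nat \<Rightarrow> nat) \<Rightarrow> 'h \<Rightarrow> 'h" where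
  "weighted c m \<tau> x = c *\<^sub>C (x - proj x) + synth (\<lambda>n. m n * cinner x (b (\<tau> n)))"

lemma summable_weighted:
  assumes "bij \<tau>" "\<And>n. cmod (m n) \<le> C"
  shows "summable (\<lambda>n. (cmod (m n * cinner x (b (\<tau> n))))\<^sup>2)"
    and "(\<Sum>n. (cmod (m n * cinner x (b (\<tau> n))))\<^sup>2) \<le> C\<^sup>2 * (norm x)\<^sup>2"
proof -
  note s = summable_coeff[OF bij_is_inj[OF assms(1)], of x]
  have le: "(cmod (m n * cinner x (b (\<tau> n))))\<^sup>2 \<le> C\<^sup>2 * (cmod (cinner x (b (\<tau> n))))\<^sup>2" for n
    using assms(2)[of n] by (simp add: norm_mult power_mult_distrib mult_right_mono power_mono)
  show sm: "summable (\<lambda>n. (cmod (m n * cinner x (b (\<tau> n))))\<^sup>2)"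
    by (rule summable_comparison_test'[OF summable_mult[OF s(1), of "C\<^sup>2"], of 0]) (use le in simp)
  have "(\<Sum>n. (cmod (m n * cinner x (b (\<tau> n))))\<^sup>2) \<le> (\<Sum>n. C\<^sup>2 * (cmod (cinner x (b (\<tau> n))))\<^sup>2)"
    by (rule suminf_le[OF le sm summable_mult[OF s(1)]])
  also have "\<dots> = C\<^sup>2 * (\<Sum>n. (cmod (cinner x (b (\<tau> n))))\<^sup>2)"
    by (rule suminf_mult[OF s(1)])
  also have "\<dots> \<le> C\<^sup>2 * (norm x)\<^sup>2" using s(2) by (intro mult_left_mono) auto
  finally show "(\<Sum>n. (cmod (m n * cinner x (b (\<tau> n))))\<^sup>2) \<le> C\<^sup>2 * (norm x)\<^sup>2" .
qed

lemma summable_cinner: "summable (\<lambda>n. (cmod (cinner x (b n)))\<^sup>2)"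
  using summable_coeff(1)[of id x] by simp

lemma cinner_proj_b: "cinner (proj x) (b k) = cinner x (b k)"
  unfolding proj_def by (rule cinner_synth_b[OF summable_cinner])

lemma cinner_weighted_b:
  assumes "bij \<tau>" "\<And>n. cmod (m n) \<le> C"
  shows "cinner (weighted c m \<tau> x) (b k) = m k * cinner x (b (\<tau> k))"
  unfolding weighted_def cinner_add_left cinner_scaleC_left cinner_diff_left cinner_proj_b
    cinner_synth_b[OF summable_weighted(1)[OF assms]] by simp

lemma proj_weighted:
  assumes "bij \<tau>" "\<And>n. cmod (m n) \<le> C"
  shows "proj (weighted c m \<tau> x) = synth (\<lambda>n. m n * cinner x (b (\<tau> n)))"
  unfolding proj_def[of "weighted c m \<tau> x"] cinner_weighted_b[OF assms] ..

text \<open>The permutations compose in reverse order because coefficient \<open>n\<close> of an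
  image is read off coefficient \<open>\<tau> n\<close> of the argument.\<close>

lemma weighted_compose:
  assumes "bij \<tau>" "\<And>n. cmod (m n) \<le> C" "bij \<tau>'" "\<And>n. cmod (m' n) \<le> C'"
  shows "weighted c m \<tau> (weighted c' m' \<tau>' x) = weighted (c * c') (\<lambda>n. m n * m' (\<tau> n)) (\<tau>' \<circ> \<tau>) x"
proof -
  have "weighted c' m' \<tau>' x - proj (weighted c' m' \<tau>' x) = c' *\<^sub>C (x - proj x)"
    unfolding proj_weighted[OF assms(3,4)] by (simp add: weighted_def)
  then show ?thesis
    unfolding weighted_def[of c m] weighted_def[of "c * c'"] cinner_weighted_b[OF assms(3,4)]
    by (simp add: scaleC_scaleC mult.assoc)
qed

lemma weighted_id: "weighted 1 (\<lambda>_. 1) id x = x"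
  by (simp add: weighted_def proj_def)

lemma proj_add: "proj (x + y) = proj x + proj y"
  unfolding proj_def cinner_add_left by (rule synth_add[OF summable_cinner summable_cinner])

lemma proj_scaleC: "proj (c *\<^sub>C x) = c *\<^sub>C proj x"
  unfolding proj_def cinner_scaleC_left by (rule synth_mult[OF summable_cinner])

lemma norm_proj_le: "norm (proj x) \<le> norm x"
proof (rule power2_le_imp_le)
  show "(norm (proj x))\<^sup>2 \<le> (norm x)\<^sup>2"
    unfolding proj_def norm_synth[OF summable_cinner] using summable_coeff(2)[of id x] by simp
qed simp

lemma weighted_scaleC:
  assumes "bij \<tau>" "\<And>n. cmod (m n) \<le> C"
  shows "weighted c m \<tau> (r *\<^sub>C x) = r *\<^sub>C weighted c m \<tau> x"
proof -
  have "synth (\<lambda>n. m n * cinner (r *\<^sub>C x) (b (\<tau> n))) = r *\<^sub>C synth (\<lambda>n. m n * cinner x (b (\<tau> n)))"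
    unfolding synth_mult[OF summable_weighted(1)[OF assms], symmetric]
    by (simp add: cinner_scaleC_left mult.left_commute)
  then show ?thesis
    unfolding weighted_def
    by (simp add: proj_scaleC scaleC_add_right scaleC_diff_right scaleC_scaleC mult.commute)
qed

lemma bounded_linear_weighted:
  assumes "bij \<tau>" "\<And>n. cmod (m n) \<le> C"
  shows "bounded_linear (weighted c m \<tau>)"
\<comment> \<open>The factor 2 comes from bounding \<open>x - proj x\<close> by the triangle
  inequality.\<close>
proof (rule bounded_linear_intro[of _ "2 * cmod c + C"])
  fix x y
  have "synth (\<lambda>n. m n * cinner (x + y) (b (\<tau> n))) =
      synth (\<lambda>n. m n * cinner x (b (\<tau> n))) + synth (\<lambda>n. m n * cinner y (b (\<tau> n)))"
    unfolding synth_add[OF summable_weighted(1)[OF assms] summable_weighted(1)[OF assms], symmetric]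
    by (simp add: cinner_add_left distrib_left)
  moreover have "c *\<^sub>C (x + y - proj (x + y)) = c *\<^sub>C (x - proj x) + c *\<^sub>C (y - proj y)"
    unfolding scaleC_add_right[symmetric] by (simp add: proj_add algebra_simps)
  ultimately show "weighted c m \<tau> (x + y) = weighted c m \<tau> x + weighted c m \<tau> y"
    unfolding weighted_def by (simp add: algebra_simps)
next
  fix r :: real and x
  show "weighted c m \<tau> (r *\<^sub>R x) = r *\<^sub>R weighted c m \<tau> x"
    unfolding scaleR_eq_scaleC by (rule weighted_scaleC[OF assms])
next
  fix x
  have C: "0 \<le> C" using assms(2)[of 0] norm_ge_zero order_trans by blast
  have "norm (synth (\<lambda>n. m n * cinner x (b (\<tau> n)))) \<le> C * norm x"
  proof (rule power2_le_imp_le)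
    show "(norm (synth (\<lambda>n. m n * cinner x (b (\<tau> n)))))\<^sup>2 \<le> (C * norm x)\<^sup>2"
      unfolding norm_synth[OF summable_weighted(1)[OF assms]] power_mult_distrib
      by (rule summable_weighted(2)[OF assms])
  qed (use C in simp)
  moreover have "norm (c *\<^sub>C (x - proj x)) \<le> cmod c * (2 * norm x)"
    unfolding norm_scaleC using norm_triangle_ineq4[of x "proj x"] norm_proj_le[of x]
    by (intro mult_left_mono) auto
  ultimately show "norm (weighted c m \<tau> x) \<le> norm x * (2 * cmod c + C)"
    unfolding weighted_def using norm_triangle_ineq[of "c *\<^sub>C (x - proj x)"]
    by (smt (verit) distrib_left mult.commute mult.left_commute)
qed

text \<open>Absolute convergence permits the rearrangement behind the adjoint and supplies the
  majorant for continuity in the eigenvalues.\<close>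

lemma abs_summable_weighted:
  assumes "bij \<tau>" "\<And>n. cmod (m n) \<le> C"
  shows "summable (\<lambda>n. cmod (m n * cinner x (b (\<tau> n)) * cinner (b n) y))"
proof (rule summable_comparison_test')
  show "summable (\<lambda>n. (cmod (m n * cinner x (b (\<tau> n))))\<^sup>2 + (cmod (cinner y (b n)))\<^sup>2)"
    by (intro summable_add summable_weighted[OF assms] summable_cinner)
  fix n
  have sym: "cmod (cinner (b n) y) = cmod (cinner y (b n))"
    by (metis cinner_commute complex_mod_cnj)
  have "p * q \<le> p\<^sup>2 + q\<^sup>2" if "p \<ge> 0" "q \<ge> 0" for p q :: real
    using sum_squares_bound[of p q] mult_nonneg_nonneg[OF that] by linarith
  from this[of "cmod (m n * cinner x (b (\<tau> n)))" "cmod (cinner y (b n))"]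
  show "norm (cmod (m n * cinner x (b (\<tau> n)) * cinner (b n) y)) \<le>
      (cmod (m n * cinner x (b (\<tau> n))))\<^sup>2 + (cmod (cinner y (b n)))\<^sup>2"
    by (simp add: norm_mult sym)
qed

lemma cinner_weighted:
  assumes "bij \<tau>" "\<And>n. cmod (m n) \<le> C"
  shows "cinner (weighted c m \<tau> x) y =
    c * cinner (x - proj x) y + (\<Sum>n. m n * cinner x (b (\<tau> n)) * cinner (b n) y)"
  unfolding weighted_def cinner_add_left cinner_scaleC_left
  using sums_unique[OF cinner_synth_sums[OF summable_weighted(1)[OF assms]]] by simp

lemma cinner_proj: "cinner (proj x) y = cinner x (proj y)"
proof -
  have "(\<lambda>n. cnj (cinner y (b n) * cinner (b n) x)) sums cnj (cinner (proj y) x)"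
    using cinner_synth_sums[OF summable_cinner, of y x] unfolding proj_def sums_cnj .
  moreover have "cnj (cinner y (b n) * cinner (b n) x) = cinner x (b n) * cinner (b n) y" for n
    by (metis cinner_commute complex_cnj_mult mult.commute)
  ultimately have "(\<lambda>n. cinner x (b n) * cinner (b n) y) sums cinner x (proj y)"
    by (simp add: cinner_commute[of x "proj y"])
  moreover have "(\<lambda>n. cinner x (b n) * cinner (b n) y) sums cinner (proj x) y"
    unfolding proj_def by (rule cinner_synth_sums[OF summable_cinner])
  ultimately show ?thesis by (simp add: sums_unique2)
qed

text \<open>Moving the operator to the other side reorders the series of coefficients by the inverse
  of \<open>\<tau>\<close>; its unconditional sum is unchanged. On the complement it suffices that
  \<open>proj\<close> is symmetric.\<close>

lemma cinner_weighted_adjoint: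
  assumes "bij \<tau>" "\<And>n. cmod (m n) \<le> C"
  shows "cinner (weighted c m \<tau> x) y =
    cinner x (weighted (cnj c) (\<lambda>n. cnj (m (inv_into UNIV \<tau> n))) (inv_into UNIV \<tau>) y)"
proof -
  have inv: "bij (inv_into UNIV \<tau>)" "\<And>n. cmod (cnj (m (inv_into UNIV \<tau> n))) \<le> C"
    using assms by (auto simp: bij_imp_bij_inv)
  let ?f = "\<lambda>n. m n * cinner x (b (\<tau> n)) * cinner (b n) y"
  let ?g = "\<lambda>n. cnj (m (inv_into UNIV \<tau> n)) * cinner y (b (inv_into UNIV \<tau> n)) * cinner (b n) x"
  have fg: "cnj (?g n) = ?f (inv_into UNIV \<tau> n)" for n
    using bij_is_surj[OF assms(1)]
    by (simp add: surj_f_inv_f cinner_commute[of "b n" x] cinner_commute[of y "b (inv_into UNIV \<tau> n)"] mult_ac)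
  have g: "?g sums (\<Sum>n. ?g n)"
    using summable_norm_cancel[OF abs_summable_weighted[OF inv]] by (rule summable_sums)
  have "(?f has_sum (\<Sum>n. ?f n)) UNIV"
    by (rule norm_summable_imp_has_sum[OF abs_summable_weighted[OF assms]])
      (use summable_norm_cancel[OF abs_summable_weighted[OF assms]] in \<open>rule summable_sums\<close>)
  then have "((\<lambda>n. ?f (inv_into UNIV \<tau> n)) has_sum (\<Sum>n. ?f n)) UNIV"
    using has_sum_reindex_bij_betw[of "inv_into UNIV \<tau>" UNIV UNIV ?f] inv(1) by simp
  then have "(\<lambda>n. ?f (inv_into UNIV \<tau> n)) sums (\<Sum>n. ?f n)" by (rule has_sum_imp_sums)
  moreover have "(\<lambda>n. ?f (inv_into UNIV \<tau> n)) sums cnj (\<Sum>n. ?g n)"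
    using g unfolding fg[symmetric] sums_cnj .
  ultimately have sum: "(\<Sum>n. ?f n) = cnj (\<Sum>n. ?g n)" by (rule sums_unique2)
  have "cinner x (weighted (cnj c) (\<lambda>n. cnj (m (inv_into UNIV \<tau> n))) (inv_into UNIV \<tau>) y) =
      cnj (cinner (weighted (cnj c) (\<lambda>n. cnj (m (inv_into UNIV \<tau> n))) (inv_into UNIV \<tau>) y) x)"
    by (rule cinner_commute)
  also have "\<dots> = c * cinner x (y - proj y) + (\<Sum>n. ?f n)"
    unfolding cinner_weighted[OF inv] sum by (simp add: cinner_commute[of x "y - proj y"])
  also have "cinner x (y - proj y) = cinner (x - proj x) y"
    by (simp add: cinner_diff_left cinner_diff_right cinner_proj)
  finally show ?thesis by (simp add: cinner_weighted[OF assms])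
qed

definition weighted_op :: "complex \<Rightarrow> (nat \<Rightarrow> complex) \<Rightarrow> (nat \<Rightarrow> nat) \<Rightarrow> ('h \<Rightarrow>\<^sub>L 'h)" where
  "weighted_op c m \<tau> = Blinfun (weighted c m \<tau>)"

lemma apply_weighted_op:
  assumes "bij \<tau>" "\<And>n. cmod (m n) \<le> C"
  shows "blinfun_apply (weighted_op c m \<tau>) = weighted c m \<tau>"
  unfolding weighted_op_def by (rule bounded_linear_Blinfun_apply[OF bounded_linear_weighted[OF assms]])

lemma weighted_op_bounded:
  assumes "bij \<tau>" "\<And>n. cmod (m n) \<le> C"
  shows "weighted_op c m \<tau> \<in> bounded_operators"
  using apply_weighted_op[OF assms] weighted_scaleC[OF assms] by (simp add: bounded_operators_def)

lemma weighted_op_compose: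
  assumes "bij \<tau>" "\<And>n. cmod (m n) \<le> C" "bij \<tau>'" "\<And>n. cmod (m' n) \<le> C'"
  shows "weighted_op c m \<tau> o\<^sub>L weighted_op c' m' \<tau>' = weighted_op (c * c') (\<lambda>n. m n * m' (\<tau> n)) (\<tau>' \<circ> \<tau>)"
proof (rule blinfun_eqI)
  have "cmod (m n * m' (\<tau> n)) \<le> C * C'" for n
    unfolding norm_mult using assms(2)[of n] assms(4)[of "\<tau> n"]
    by (intro mult_mono) (auto intro: order_trans[OF norm_ge_zero])
  note ap = apply_weighted_op[OF bij_comp[OF assms(1,3)] this]
  show "blinfun_apply (weighted_op c m \<tau> o\<^sub>L weighted_op c' m' \<tau>') x =
      blinfun_apply (weighted_op (c * c') (\<lambda>n. m n * m' (\<tau> n)) (\<tau>' \<circ> \<tau>)) x" for x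
    by (simp add: ap apply_weighted_op[OF assms(1,2)] apply_weighted_op[OF assms(3,4)] weighted_compose[OF assms])
qed

lemma weighted_op_id: "weighted_op 1 (\<lambda>_. 1) id = id_blinfun"
  by (rule blinfun_eqI) (simp add: apply_weighted_op[of id _ 1] weighted_id)

lemma cadjoint_weighted_op:
  assumes "bij \<tau>" "\<And>n. cmod (m n) \<le> C"
  shows "cadjoint (weighted_op c m \<tau>) = weighted_op (cnj c) (\<lambda>n. cnj (m (inv_into UNIV \<tau> n))) (inv_into UNIV \<tau>)"
proof -
  have inv: "bij (inv_into UNIV \<tau>)" "\<And>n. cmod (cnj (m (inv_into UNIV \<tau> n))) \<le> C"
    using assms by (auto simp: bij_imp_bij_inv)
  show ?thesis
    unfolding cadjoint_def
  proof (rule the_equality)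
    show "weighted_op (cnj c) (\<lambda>n. cnj (m (inv_into UNIV \<tau> n))) (inv_into UNIV \<tau>) \<in> bounded_operators \<and>
      (\<forall>x y. cinner (blinfun_apply (weighted_op c m \<tau>) x) y =
        cinner x (blinfun_apply (weighted_op (cnj c) (\<lambda>n. cnj (m (inv_into UNIV \<tau> n))) (inv_into UNIV \<tau>)) y))"
      unfolding apply_weighted_op[OF assms] apply_weighted_op[OF inv]
      using weighted_op_bounded[of "inv_into UNIV \<tau>" "\<lambda>n. cnj (m (inv_into UNIV \<tau> n))" C "cnj c"] inv
        cinner_weighted_adjoint[of \<tau> m C c] assms by blast
    fix A :: "'h \<Rightarrow>\<^sub>L 'h"
    assume A: "A \<in> bounded_operators \<and>
      (\<forall>x y. cinner (blinfun_apply (weighted_op c m \<tau>) x) y = cinner x (blinfun_apply A y))"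
    show "A = weighted_op (cnj c) (\<lambda>n. cnj (m (inv_into UNIV \<tau> n))) (inv_into UNIV \<tau>)"
    proof (rule blinfun_eqI, rule cinner_eqI_right)
      fix y x
      show "cinner x (blinfun_apply A y) =
          cinner x (blinfun_apply (weighted_op (cnj c) (\<lambda>n. cnj (m (inv_into UNIV \<tau> n))) (inv_into UNIV \<tau>)) y)"
        using A cinner_weighted_adjoint[of \<tau> m C c x y] assms
        unfolding apply_weighted_op[OF assms] apply_weighted_op[OF inv] by simp
    qed
  qed
qed

lemma unitary_weighted_op:
  assumes "bij \<tau>" "cmod c = 1" "\<And>n. cmod (m n) = 1"
  shows "weighted_op c m \<tau> \<in> unitaries"
proof -
  have b: "cmod (m n) \<le> 1" "cmod (cnj (m (inv_into UNIV \<tau> n))) \<le> 1" for n using assms(3) by simp_all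
  have u: "z * cnj z = 1" "cnj z * z = 1" if "cmod z = 1" for z
    using that complex_norm_square[of z] by (simp_all add: mult.commute)
  have i: "inv_into UNIV \<tau> (\<tau> n) = n" "\<tau> (inv_into UNIV \<tau> n) = n" for n
    using assms(1) by (simp_all add: bij_is_inj bij_is_surj surj_f_inv_f)
  have io: "\<tau> \<circ> inv_into UNIV \<tau> = id" "inv_into UNIV \<tau> \<circ> \<tau> = id" using i by auto
  have "cadjoint (weighted_op c m \<tau>) o\<^sub>L weighted_op c m \<tau> = id_blinfun"
    unfolding cadjoint_weighted_op[OF assms(1) b(1)]
      weighted_op_compose[OF bij_imp_bij_inv[OF assms(1)] b(2) assms(1) b(1)]
    by (simp add: u[OF assms(3)] u[OF assms(2)] io weighted_op_id)
  moreover have "weighted_op c m \<tau> o\<^sub>L cadjoint (weighted_op c m \<tau>) = id_blinfun"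
    unfolding cadjoint_weighted_op[OF assms(1) b(1)]
      weighted_op_compose[OF assms(1) b(1) bij_imp_bij_inv[OF assms(1)] b(2)]
    by (simp add: u[OF assms(3)] u[OF assms(2)] i io weighted_op_id)
  ultimately show ?thesis
    using weighted_op_bounded[OF assms(1) b(1)] by (simp add: unitaries_def)
qed

lemma selfadjoint_weighted_op:
  assumes "cnj c = c" "\<And>n. cnj (m n) = m n" "\<And>n. cmod (m n) \<le> C"
  shows "weighted_op c m id \<in> selfadjoints"
  using cadjoint_weighted_op[of id m C c] weighted_op_bounded[of id m C c] assms
  by (simp add: selfadjoints_def inv_id)

lemma permute_weighted_op:
  assumes "bij \<tau>" "\<And>n. cmod (m n) \<le> C"
  shows "weighted_op 1 (\<lambda>_. 1) \<tau> o\<^sub>L weighted_op c m id o\<^sub>L cadjoint (weighted_op 1 (\<lambda>_. 1) \<tau>) =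
    weighted_op c (\<lambda>n. m (\<tau> n)) id"
proof -
  have 1: "cadjoint (weighted_op 1 (\<lambda>_. 1) \<tau>) = weighted_op 1 (\<lambda>_. 1) (inv_into UNIV \<tau>)"
    using cadjoint_weighted_op[OF assms(1), of "\<lambda>_. 1" 1 1] by simp
  have 2: "weighted_op 1 (\<lambda>_. 1) \<tau> o\<^sub>L weighted_op c m id = weighted_op c (\<lambda>n. m (\<tau> n)) \<tau>"
    using weighted_op_compose[OF assms(1), of "\<lambda>_. 1" 1 id m C 1 c] assms(2) by simp
  have "inv_into UNIV \<tau> \<circ> \<tau> = id" using assms(1) by (auto simp: bij_is_inj)
  then have 3: "weighted_op c (\<lambda>n. m (\<tau> n)) \<tau> o\<^sub>L weighted_op 1 (\<lambda>_. 1) (inv_into UNIV \<tau>) =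
      weighted_op c (\<lambda>n. m (\<tau> n)) id"
    using weighted_op_compose[OF assms(1), of "\<lambda>n. m (\<tau> n)" C "inv_into UNIV \<tau>" "\<lambda>_. 1" 1 c 1]
      bij_imp_bij_inv[OF assms(1)] assms(2) by simp
  show ?thesis unfolding 1 2 3 ..
qed

text \<open>Off the range of \<open>m\<close>, an eigenvector has all coefficients zero, so it lies
  in the orthogonal complement, where the operator is multiplication by \<open>c\<close>. Excluding
  \<open>\<mu> = c\<close> thus deals with an incomplete sequence.\<close>

lemma eigenvalue_weighted_op:
  assumes "\<And>n. cmod (m n) \<le> C" "\<mu> \<noteq> c"
  shows "(\<exists>x. x \<noteq> 0 \<and> blinfun_apply (weighted_op c m id) x = \<mu> *\<^sub>C x) \<longleftrightarrow> \<mu> \<in> range m"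
proof
  assume "\<mu> \<in> range m"
  then obtain k where k: "\<mu> = m k" by blast
  have syn: "synth (\<lambda>n. if n = k then a else 0) = a *\<^sub>C b k" for a
  proof -
    have "(\<lambda>n. (if n = k then a else 0) *\<^sub>C b n) = (\<lambda>n. if n = k then a *\<^sub>C b n else 0)" by auto
    then show ?thesis unfolding synth_def using sums_unique[OF sums_single[of k "\<lambda>n. a *\<^sub>C b n"]] by simp
  qed
  have "(\<lambda>n. m n * cinner (b k) (b n)) = (\<lambda>n. if n = k then m k else 0)"
    "(\<lambda>n. cinner (b k) (b n)) = (\<lambda>n. if n = k then 1 else 0)"
    by (auto simp: cinner_b)
  then have "weighted c m id (b k) = m k *\<^sub>C b k"
    by (simp add: weighted_def proj_def syn)
  moreover have "b k \<noteq> 0" using cinner_b[of k k] by auto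
  ultimately show "\<exists>x. x \<noteq> 0 \<and> blinfun_apply (weighted_op c m id) x = \<mu> *\<^sub>C x"
    using apply_weighted_op[of id m C c] assms(1) k by auto
next
  assume "\<exists>x. x \<noteq> 0 \<and> blinfun_apply (weighted_op c m id) x = \<mu> *\<^sub>C x"
  then obtain x where x: "x \<noteq> 0" "weighted c m id x = \<mu> *\<^sub>C x"
    using apply_weighted_op[of id m C c] assms(1) by auto
  show "\<mu> \<in> range m"
  proof (rule ccontr)
    assume \<mu>: "\<mu> \<notin> range m"
    have "cinner x (b k) = 0" for k
    proof -
      have "m k * cinner x (b k) = \<mu> * cinner x (b k)"
        using cinner_weighted_b[of id m C c x k] assms(1) x(2) by (auto simp: cinner_scaleC_left)
      moreover have "m k \<noteq> \<mu>" using \<mu> by blast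
      ultimately show ?thesis using mult_right_cancel by blast
    qed
    then have "weighted c m id x = c *\<^sub>C x" by (simp add: weighted_def proj_def)
    then have "(\<mu> - c) *\<^sub>C x = 0" using x(2) by (simp add: scaleC_diff_left)
    then have "cmod (\<mu> - c) * norm x = 0" by (metis norm_scaleC norm_zero)
    then show False using x(1) assms(2) by simp
  qed
qed

end

section \<open>Diagonal operators with infinite multiplicities\<close>

text \<open>Index \<open>prod_encode (i, j)\<close> carries the term \<open>e i\<close>, so each
  value occurs at infinitely many indices however often it occurs in \<open>e\<close>. Fibres over
  the same value are matched through their increasing enumerations.\<close>

lemma matching_exists:
  fixes e e' :: "nat \<Rightarrow> 'a"
  assumes "range e = range e'"
  shows "\<exists>\<tau>. bij \<tau> \<and> (\<forall>n. e' (fst (prod_decode n)) = e (fst (prod_decode (\<tau> n))))"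
proof -
  define \<pi> where "\<pi> n = fst (prod_decode n)" for n
  define I where "I e r = {n. e (\<pi> n) = r}" for e :: "nat \<Rightarrow> 'a" and r
  have inf: "infinite (I e r)" if re: "r \<in> range e" for e :: "nat \<Rightarrow> 'a" and r
  proof -
    obtain i where i: "e i = r" using re by blast
    have "inj (\<lambda>j. prod_encode (i, j))" by (rule injI) simp
    then have "infinite (range (\<lambda>j. prod_encode (i, j)))" by (rule range_inj_infinite)
    moreover have "range (\<lambda>j. prod_encode (i, j)) \<subseteq> I e r"
      using i by (auto simp: I_def \<pi>_def)
    ultimately show ?thesis by (rule infinite_super[rotated])
  qed
  have "\<exists>h. bij_betw h (I e' r) (I e r)" if "r \<in> range e" for r
  proof -
    have "infinite (I e' r)" "infinite (I e r)" using inf that assms by simp_all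
    from bij_betw_trans[OF bij_betw_inv_into[OF bij_enumerate[OF this(1)]] bij_enumerate[OF this(2)]]
    show ?thesis by blast
  qed
  then obtain h where h: "\<And>r. r \<in> range e \<Longrightarrow> bij_betw (h r) (I e' r) (I e r)" by metis
  define \<tau> where "\<tau> n = h (e' (\<pi> n)) n" for n
  have r: "e' (\<pi> n) \<in> range e" for n using assms by blast
  have mem: "n \<in> I e' (e' (\<pi> n))" for n by (simp add: I_def)
  have e\<tau>: "e (\<pi> (\<tau> n)) = e' (\<pi> n)" for n
    using bij_betwE[OF h[OF r[of n]]] mem[of n] by (auto simp: \<tau>_def I_def)
  have "inj \<tau>"
  proof (rule injI)
    fix n k assume eq: "\<tau> n = \<tau> k"
    then have "e' (\<pi> n) = e' (\<pi> k)" using e\<tau> by metis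
    then have "h (e' (\<pi> n)) n = h (e' (\<pi> n)) k" "k \<in> I e' (e' (\<pi> n))"
      using eq mem[of k] by (simp_all add: \<tau>_def)
    then show "n = k"
      using bij_betw_imp_inj_on[OF h[OF r[of n]]] mem[of n] by (meson inj_onD)
  qed
  moreover have "surj \<tau>"
    unfolding surj_def
  proof
    fix k
    have "k \<in> I e (e (\<pi> k))" by (simp add: I_def)
    moreover have "h (e (\<pi> k)) ` I e' (e (\<pi> k)) = I e (e (\<pi> k))"
      by (rule bij_betw_imp_surj_on[OF h]) blast
    ultimately obtain n where n: "n \<in> I e' (e (\<pi> k))" "k = h (e (\<pi> k)) n" by blast
    then have "\<tau> n = k" by (simp add: \<tau>_def I_def)
    then show "\<exists>n. k = \<tau> n" by metis
  qed
  ultimately show ?thesis using e\<tau> unfolding bij_def \<pi>_def by metis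
qed

lemma unitary_equivalence_eigenvalue:
  fixes u v :: "'h::complex_hilbert \<Rightarrow>\<^sub>L 'h"
  assumes "(u, v) \<in> unitary_equivalence S" "S \<subseteq> bounded_operators"
  shows "(\<exists>x. x \<noteq> 0 \<and> blinfun_apply u x = \<mu> *\<^sub>C x) \<longleftrightarrow> (\<exists>x. x \<noteq> 0 \<and> blinfun_apply v x = \<mu> *\<^sub>C x)"
proof -
  obtain w where w: "w \<in> unitaries" "v = w o\<^sub>L u o\<^sub>L cadjoint w"
    using assms(1) by (auto simp: unitary_equivalence_def)
  let ?w = "blinfun_apply w" and ?a = "blinfun_apply (cadjoint w)"
  have lin: "?w (c *\<^sub>C x) = c *\<^sub>C ?w x" for c x
    using w(1) by (simp add: unitaries_def bounded_operators_def)
  have aw: "?a (?w x) = x" and wa: "?w (?a x) = x" for x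
  proof -
    have "cadjoint w o\<^sub>L w = id_blinfun" "w o\<^sub>L cadjoint w = id_blinfun"
      using w(1) by (auto simp: unitaries_def)
    then have "blinfun_apply (cadjoint w o\<^sub>L w) x = x" "blinfun_apply (w o\<^sub>L cadjoint w) x = x"
      by simp_all
    then show "?a (?w x) = x" "?w (?a x) = x" by simp_all
  qed
  have lin': "?a (c *\<^sub>C x) = c *\<^sub>C ?a x" for c x
    by (metis aw wa lin)
  have v: "blinfun_apply v x = ?w (blinfun_apply u (?a x))" for x by (simp add: w(2))
  show ?thesis
  proof
    assume "\<exists>x. x \<noteq> 0 \<and> blinfun_apply u x = \<mu> *\<^sub>C x"
    then obtain x where x: "x \<noteq> 0" "blinfun_apply u x = \<mu> *\<^sub>C x" by blast
    then have "blinfun_apply v (?w x) = \<mu> *\<^sub>C ?w x" by (simp add: v aw lin)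
    moreover have "?w x \<noteq> 0" using x(1) aw by (metis blinfun.zero_right)
    ultimately show "\<exists>x. x \<noteq> 0 \<and> blinfun_apply v x = \<mu> *\<^sub>C x" by blast
  next
    assume "\<exists>x. x \<noteq> 0 \<and> blinfun_apply v x = \<mu> *\<^sub>C x"
    then obtain x where x: "x \<noteq> 0" "?w (blinfun_apply u (?a x)) = \<mu> *\<^sub>C x" by (auto simp: v)
    then have "blinfun_apply u (?a x) = \<mu> *\<^sub>C ?a x" by (metis aw lin')
    moreover have "?a x \<noteq> 0" using x(1) wa by (metis blinfun.zero_right)
    ultimately show "\<exists>x. x \<noteq> 0 \<and> blinfun_apply u x = \<mu> *\<^sub>C x" by blast
  qed
qed

lemma topspace_weak_operator_topology: "topspace weak_operator_topology = bounded_operators"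
proof -
  have "A \<in> \<Union>{{A \<in> bounded_operators. cinner (blinfun_apply A x) y \<in> U} | x y U. open U}"
    if "A \<in> bounded_operators" for A :: "'a \<Rightarrow>\<^sub>L 'a"
  proof (rule UnionI)
    show "A \<in> {A \<in> bounded_operators. cinner (blinfun_apply A 0) 0 \<in> UNIV}" using that by simp
  qed blast
  then show ?thesis unfolding weak_operator_topology_def by auto
qed

section \<open>Diagonal operators as a Borel function of a sequence of reals\<close>

text \<open>Serves the unitary and the selfadjoint case at once: \<open>\<psi>\<close> codes a real
  as an eigenvalue, and \<open>c\<close>, the value on the orthogonal complement, is kept apart from
  all codes so that it cannot disturb the comparison of eigenvalues.\<close>

locale diagonal_family = orthonormal_seq b for b :: "nat \<Rightarrow> 'h::complex_hilbert" +
  fixes \<psi> :: "real \<Rightarrow> complex" and c :: complex and C :: real and S :: "('h \<Rightarrow>\<^sub>L 'h) set"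
  assumes cont: "continuous_on UNIV \<psi>" and inj: "inj \<psi>" and bound: "\<And>r. cmod (\<psi> r) \<le> C"
    and c: "c \<notin> range \<psi>" and S: "S \<subseteq> bounded_operators"
    and diagonal_in: "\<And>e. weighted_op c (\<lambda>n. \<psi> (e (fst (prod_decode n)))) id \<in> S"
begin

definition diag :: "(nat \<Rightarrow> real) \<Rightarrow> ('h \<Rightarrow>\<^sub>L 'h)" where
  "diag e = weighted_op c (\<lambda>n. \<psi> (e (fst (prod_decode n)))) id"

text \<open>The set of eigenvalues among the codes recovers the range, and equal ranges give a
  permutation of the basis vectors that conjugates one operator into the other.\<close>

lemma diag_unitary_equivalence: "(diag e, diag e') \<in> unitary_equivalence S \<longleftrightarrow> range e = range e'"
proof
  assume eq: "(diag e, diag e') \<in> unitary_equivalence S"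
  have eig: "(\<exists>x. x \<noteq> 0 \<and> blinfun_apply (diag e) x = \<psi> r *\<^sub>C x) \<longleftrightarrow> r \<in> range e" for e r
  proof -
    have "\<psi> r \<noteq> c" using c by blast
    then have "(\<exists>x. x \<noteq> 0 \<and> blinfun_apply (diag e) x = \<psi> r *\<^sub>C x) \<longleftrightarrow>
        \<psi> r \<in> range (\<lambda>n. \<psi> (e (fst (prod_decode n))))"
      unfolding diag_def by (intro eigenvalue_weighted_op[of _ C]) (rule bound)
    also have "\<dots> \<longleftrightarrow> r \<in> range e"
    proof
      assume "r \<in> range e"
      then obtain i where "r = e i" by blast
      then have "\<psi> r = \<psi> (e (fst (prod_decode (prod_encode (i, 0)))))" by simp
      then show "\<psi> r \<in> range (\<lambda>n. \<psi> (e (fst (prod_decode n))))" by blast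
    qed (use inj in \<open>auto dest: injD\<close>)
    finally show ?thesis .
  qed
  have "r \<in> range e \<longleftrightarrow> r \<in> range e'" for r
    using unitary_equivalence_eigenvalue[OF eq S, of "\<psi> r"] unfolding eig .
  then show "range e = range e'" by blast
next
  assume "range e = range e'"
  then obtain \<tau> where \<tau>: "bij \<tau>" "\<And>n. e' (fst (prod_decode n)) = e (fst (prod_decode (\<tau> n)))"
    using matching_exists by blast
  let ?w = "weighted_op 1 (\<lambda>_. 1) \<tau>"
  have "diag e' = ?w o\<^sub>L diag e o\<^sub>L cadjoint ?w"
    unfolding diag_def using permute_weighted_op[OF \<tau>(1), of "\<lambda>n. \<psi> (e (fst (prod_decode n)))" C c] bound
    by (simp add: \<tau>(2))
  moreover have "?w \<in> unitaries" using \<tau>(1) by (intro unitary_weighted_op) auto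
  ultimately show "(diag e, diag e') \<in> unitary_equivalence S"
    using diagonal_in unfolding unitary_equivalence_def diag_def by blast
qed

text \<open>The series of the matrix coefficient converges uniformly in \<open>e\<close>, and each
  partial sum depends continuously on finitely many terms of \<open>e\<close>.\<close>

lemma continuous_diag: "continuous_on UNIV (\<lambda>e. cinner (blinfun_apply (diag e) x) y)"
proof -
  let ?f = "\<lambda>n e. \<psi> (e (fst (prod_decode n))) * cinner x (b n) * cinner (b n) y"
  have "cinner (blinfun_apply (diag e) x) y = c * cinner (x - proj x) y + (\<Sum>n. ?f n e)" for e
    unfolding diag_def
    using apply_weighted_op[of id "\<lambda>n. \<psi> (e (fst (prod_decode n)))" C c]
      cinner_weighted[of id "\<lambda>n. \<psi> (e (fst (prod_decode n)))" C c x y] bound by simp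
  moreover have "continuous_on UNIV (\<lambda>e :: nat \<Rightarrow> real. \<Sum>n. ?f n e)"
  proof (rule uniform_limit_theorem[OF _ Weierstrass_m_test])
    show "summable (\<lambda>n. C * cmod (cinner x (b n) * cinner (b n) y))"
      using abs_summable_weighted[of id "\<lambda>_. 1" 1 x y] by (intro summable_mult) simp
    show "norm (?f n e) \<le> C * cmod (cinner x (b n) * cinner (b n) y)" for n and e :: "nat \<Rightarrow> real"
      unfolding norm_mult mult.assoc using bound by (intro mult_right_mono) auto
    have "continuous_on UNIV (\<lambda>e :: nat \<Rightarrow> real. \<psi> (e i))" for i
      by (rule continuous_on_compose2[OF cont]) (auto intro: continuous_on_product_coordinates)
    then show "\<forall>\<^sub>F n in sequentially. continuous_on UNIV (\<lambda>e :: nat \<Rightarrow> real. \<Sum>i<n. ?f i e)"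
      by (intro always_eventually allI continuous_intros) auto
  qed simp
  ultimately show ?thesis by (simp add: continuous_intros)
qed

lemma diag_in: "diag e \<in> S"
  using diagonal_in by (simp add: diag_def)

text \<open>Here the usual topology of the reals is left behind: continuity gives Borel
  measurability on the countable product, whose Borel sets are generated by coordinates, and the
  \<sigma>-algebra with discrete factors contains these sets.\<close>

lemma measurable_diag:
  "diag \<in> Pi\<^sub>M UNIV (\<lambda>_. count_space UNIV) \<rightarrow>\<^sub>M borel_of (subtopology weak_operator_topology S)"
proof -
  have "continuous_map euclidean weak_operator_topology diag"
    unfolding weak_operator_topology_def
  proof (rule continuous_on_generated_topo)
    fix V :: "('h \<Rightarrow>\<^sub>L 'h) set"
    assume "V \<in> {{A \<in> bounded_operators. cinner (blinfun_apply A x) y \<in> U} | x y U. open U}"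
    then obtain x y U where V: "V = {A \<in> bounded_operators. cinner (blinfun_apply A x) y \<in> U}" "open U"
      by blast
    have "diag -` V \<inter> topspace euclidean = (\<lambda>e. cinner (blinfun_apply (diag e) x) y) -` U"
      using diag_in S by (auto simp: V)
    then show "openin euclidean (diag -` V \<inter> topspace euclidean)"
      using open_vimage[OF V(2) continuous_diag] by simp
  next
    show "diag ` topspace euclidean \<subseteq>
        \<Union>{{A \<in> bounded_operators. cinner (blinfun_apply A x) y \<in> U} | x y U. open U}"
      using diag_in S topspace_weak_operator_topology[where 'a='h]
      unfolding weak_operator_topology_def by auto
  qed
  then have cm: "continuous_map euclidean (subtopology weak_operator_topology S) diag"
    using diag_in by (simp add: continuous_map_in_subtopology image_subset_iff)
  have "diag \<in> borel \<rightarrow>\<^sub>M borel_of (subtopology weak_operator_topology S)"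
    unfolding borel_of_def
  proof (rule measurable_measure_of)
    show "{U. openin (subtopology weak_operator_topology S) U} \<subseteq>
        Pow (topspace (subtopology weak_operator_topology S))"
      using openin_subset by blast
    show "diag \<in> space borel \<rightarrow> topspace (subtopology weak_operator_topology S)"
      using cm by (auto simp: continuous_map_def)
    fix U assume "U \<in> {U. openin (subtopology weak_operator_topology S) U}"
    then have "open {e. diag e \<in> U}"
      using openin_continuous_map_preimage[OF cm] by fastforce
    then show "diag -` U \<inter> space borel \<in> sets borel" by (simp add: vimage_def)
  qed
  moreover have "(\<lambda>e. e) \<in> Pi\<^sub>M UNIV (\<lambda>_. count_space UNIV) \<rightarrow>\<^sub>M (Pi\<^sub>M UNIV (\<lambda>_. borel) :: (nat \<Rightarrow> real) measure)"
    by (rule measurable_PiM_single') (auto simp: space_PiM intro: measurable_compose[OF measurable_component_singleton])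
  then have "(\<lambda>e. e) \<in> Pi\<^sub>M UNIV (\<lambda>_. count_space UNIV) \<rightarrow>\<^sub>M (borel :: (nat \<Rightarrow> real) measure)"
    using measurable_cong_sets[OF refl sets_PiM_equal_borel] by blast
  ultimately show ?thesis using measurable_comp by fastforce
qed

end

section \<open>Bases, separating sequences and the final assembly\<close>

lemma second_countable_imp_base:
  assumes "second_countable T" "topspace T \<noteq> {}"
  shows "\<exists>B. countable_base T B"
proof -
  obtain \<B> where \<B>: "countable \<B> \<and> (\<forall>V \<in> \<B>. openin T V) \<and>
      (\<forall>V x. openin T V \<and> x \<in> V \<longrightarrow> (\<exists>B \<in> \<B>. x \<in> B \<and> B \<subseteq> V))"
    using assms(1) unfolding second_countable_def by blast
  \<comment> \<open>The empty set is removed because every index has to be a forcing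
    condition.\<close>
  let ?\<B> = "\<B> - {{}}"
  obtain x where "x \<in> topspace T" using assms(2) by blast
  then obtain V where "V \<in> \<B>" "x \<in> V" using \<B> by (meson openin_topspace)
  then have ne: "?\<B> \<noteq> {}" by blast
  have "range (from_nat_into ?\<B>) = ?\<B>" using ne \<B> by (intro range_from_nat_into) auto
  then have rg: "(\<exists>n. from_nat_into ?\<B> n = V) \<longleftrightarrow> V \<in> ?\<B>" for V
    by (metis rangeE rangeI)
  have "countable_base T (from_nat_into ?\<B>)"
  proof
    fix n
    show "openin T (from_nat_into ?\<B> n)" "from_nat_into ?\<B> n \<noteq> {}"
      using from_nat_into[OF ne, of n] \<B> by auto
    fix U x assume "openin T U" "x \<in> U"
    then obtain V where V: "V \<in> \<B>" "x \<in> V" "V \<subseteq> U" using \<B> by meson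
    then obtain n where "from_nat_into ?\<B> n = V" using rg by blast
    then show "\<exists>n. x \<in> from_nat_into ?\<B> n \<and> from_nat_into ?\<B> n \<subseteq> U" using V by blast
  qed
  then show ?thesis by blast
qed

text \<open>A countable base of a Polish topology generating the Borel sets works: in a T1 space
  some basic set contains \<open>x\<close> and misses a different \<open>y\<close>, which is
  separation in the one-sided form.\<close>

lemma standard_borel_separating_sequence:
  assumes "standard_borel_space X"
  obtains S :: "nat \<Rightarrow> 'x set" where "\<And>n. S n \<in> sets X"
    "\<And>x y. x \<in> space X \<Longrightarrow> y \<in> space X \<Longrightarrow> \<forall>n. x \<in> S n \<longrightarrow> y \<in> S n \<Longrightarrow> x = y"
proof (cases "space X = {}")
  case True
  then show thesis using that[of "\<lambda>_. {}"] by simp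
next
  case False
  obtain T where T: "polish_space T" "topspace T = space X" "sets X = sets (borel_of T)"
    using assms unfolding standard_borel_space_def by blast
  have met: "metrizable_space T"
    using T(1) completely_metrizable_imp_metrizable_space unfolding polish_space_def by blast
  then have "second_countable T"
    using T(1) separable_metrizable_imp_second_countable unfolding polish_space_def by blast
  then obtain B where "countable_base T B"
    using second_countable_imp_base False T(2) by metis
  then interpret countable_base T B .
  have "B n \<in> sets X" for n
    unfolding T(3) borel_of_def using openin_subset[of T] base_open[of n]
    by (intro in_measure_of) auto
  moreover have "x = y" if xy: "x \<in> space X" "y \<in> space X" "\<forall>n. x \<in> B n \<longrightarrow> y \<in> B n" for x y
  proof (rule ccontr)
    assume "x \<noteq> y"
    moreover have "t1_space T"
      using met metrizable_imp_t1_space by blast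
    ultimately obtain U where "openin T U" "x \<in> U" "y \<notin> U"
      using xy(1,2) T(2) unfolding t1_space_def by metis
    then show False using base xy(3) by blast
  qed
  ultimately show thesis by (rule that)
qed

lemma (in diagonal_family) not_borel_reducible:
  fixes G :: "('g, 'm) monoid_scheme" and T :: "'g topology"
    and X :: "'x measure" and \<phi> :: "'g \<Rightarrow> 'x \<Rightarrow> 'x"
  assumes cli: "cli_group G T" and X: "standard_borel_space X" and act: "borel_action G T X \<phi>"
  shows "\<not> borel_reducible (borel_of (subtopology weak_operator_topology S)) (unitary_equivalence S)
    X (orbit_equivalence G \<phi> (space X))"
proof
  assume "borel_reducible (borel_of (subtopology weak_operator_topology S)) (unitary_equivalence S)
    X (orbit_equivalence G \<phi> (space X))"
  then obtain F where F: "F \<in> borel_of (subtopology weak_operator_topology S) \<rightarrow>\<^sub>M X"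
    and "\<forall>u \<in> space (borel_of (subtopology weak_operator_topology S)).
      \<forall>v \<in> space (borel_of (subtopology weak_operator_topology S)).
      (u, v) \<in> unitary_equivalence S \<longleftrightarrow> (F u, F v) \<in> orbit_equivalence G \<phi> (space X)"
    unfolding borel_reducible_def by (elim bexE) (rule that)
  moreover have "space (borel_of (subtopology weak_operator_topology S)) = S"
    using S by (auto simp: borel_of_def space_measure_of_conv topspace_weak_operator_topology)
  ultimately have red: "\<And>u v. u \<in> S \<Longrightarrow> v \<in> S \<Longrightarrow>
      (u, v) \<in> unitary_equivalence S \<longleftrightarrow> (F u, F v) \<in> orbit_equivalence G \<phi> (space X)"
    by simp
  obtain d where d: "Metric_space (carrier G) d" "Metric_space.mtopology (carrier G) d = T"
    "Metric_space.mcomplete (carrier G) d"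
    "\<And>g x y. g \<in> carrier G \<Longrightarrow> x \<in> carrier G \<Longrightarrow> y \<in> carrier G \<Longrightarrow> d (g \<otimes>\<^bsub>G\<^esub> x) (g \<otimes>\<^bsub>G\<^esub> y) = d x y"
    using cli unfolding cli_group_def by blast
  interpret M: Metric_space "carrier G" d by (rule d(1))
  have top: "topological_group G T" and pol: "polish_space T"
    using cli by (auto simp: cli_group_def polish_group_def)
  have group: "group G" and tG: "topspace T = carrier G" using top by (auto simp: topological_group_def)
  have ne: "carrier G \<noteq> {}" using group.is_monoid[OF group] monoid.one_closed by blast
  have "second_countable T"
    using pol separable_metrizable_imp_second_countable completely_metrizable_imp_metrizable_space
    unfolding polish_space_def by blast
  then obtain B where "countable_base T B" using second_countable_imp_base tG ne by metis
  then interpret countable_base T B .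
  have "\<forall>n. \<exists>h. h \<in> B n" using base_nonempty by blast
  then obtain g where g: "\<And>n. g n \<in> B n" by metis
  have gG: "g n \<in> carrier G" for n using g[of n] base_open[of n] openin_subset tG by blast
  have dense: "\<exists>n. g n \<in> carrier G \<and> d (g n) w < \<epsilon>" if w: "w \<in> carrier G" "\<epsilon> > 0" for w \<epsilon>
  proof -
    have "openin T (M.mball w \<epsilon>)" using M.openin_mball d(2) by simp
    then obtain n where "B n \<subseteq> M.mball w \<epsilon>" using base M.centre_in_mball_iff w by blast
    then have "g n \<in> M.mball w \<epsilon>" using g by blast
    then show ?thesis using M.commute by auto
  qed
  obtain A :: "nat \<Rightarrow> 'x set" where A: "\<And>n. A n \<in> sets X"
    "\<And>x y. x \<in> space X \<Longrightarrow> y \<in> space X \<Longrightarrow> \<forall>n. x \<in> A n \<longrightarrow> y \<in> A n \<Longrightarrow> x = y"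
    by (rule standard_borel_separating_sequence[OF X]) blast
  have ga: "group_action G (space X) \<phi>" and am: "(\<lambda>(a, x). \<phi> a x) \<in> borel_of T \<Otimes>\<^sub>M X \<rightarrow>\<^sub>M X"
    using act by (auto simp: borel_action_def)
  have fm: "(\<lambda>e. F (diag e)) \<in> Pi\<^sub>M UNIV (\<lambda>_. count_space UNIV) \<rightarrow>\<^sub>M X"
    using measurable_comp[OF measurable_diag F] by (simp add: comp_def)
  have fX: "F (diag e) \<in> space X" for e
    using measurable_space[OF fm, of e] by (simp add: space_PiM)
  have fr: "(\<exists>a \<in> carrier G. F (diag e') = \<phi> a (F (diag e))) \<longleftrightarrow> range e = range e'" for e e'
    unfolding diag_unitary_equivalence[symmetric] red[OF diag_in diag_in]
    using fX by (auto simp: orbit_equivalence_def orbit_def)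
  interpret group_action G "space X" \<phi> by (rule ga)
  interpret cli_reduction G T B d X \<phi> "\<lambda>e. F (diag e)" A g
    by unfold_locales (fact top d(2) d(3) d(4) dense gG am A fm fr)+
  have "countable (UNIV :: real set)" by (rule countable_UNIV)
  then show False using uncountable_UNIV_real by blast
qed

theorem theorem2p11:
  fixes G :: "('g, 'm) monoid_scheme" and T :: "'g topology"
    and X :: "'x measure" and \<phi> :: "'g \<Rightarrow> 'x \<Rightarrow> 'x"
  assumes "separable_space (euclidean :: 'h::complex_hilbert topology)"
    and "infinite_dimensional TYPE('h)"
    and "cli_group G T"
    and "standard_borel_space X"
    and "borel_action G T X \<phi>"
  shows
    "\<not> borel_reducible
         (borel_of (subtopology weak_operator_topology (unitaries :: ('h \<Rightarrow>\<^sub>L 'h) set)))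
         (unitary_equivalence unitaries)
         X (orbit_equivalence G \<phi> (space X)) \<and>
     \<not> borel_reducible
         (borel_of (subtopology weak_operator_topology (selfadjoints :: ('h \<Rightarrow>\<^sub>L 'h) set)))
         (unitary_equivalence selfadjoints)
         X (orbit_equivalence G \<phi> (space X))"
proof -
  obtain b :: "nat \<Rightarrow> 'h" where "orthonormal b"
    using orthonormal_exists[OF assms(2)] by blast
  then interpret orthonormal_seq b by (rule orthonormal_seq.intro)
  have cos_pos: "0 < cos (arctan r)" for r :: real
    using arctan_lbound[of r] arctan_ubound[of r] by (intro cos_gt_zero_pi) auto
  \<comment> \<open>Angles strictly between \<open>- pi / 2\<close> and \<open>pi / 2\<close> have
    positive cosine, which leaves \<open>- 1\<close> free for the complement, and they are
    determined by their tangents.\<close>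
  interpret U: diagonal_family b "\<lambda>r. cis (arctan r)" "- 1" 1 unitaries
  proof
    show "continuous_on UNIV (\<lambda>r. cis (arctan r))" by (intro continuous_intros)
    show "inj (\<lambda>r. cis (arctan r))"
    proof (rule injI)
      fix r s :: real assume eq: "cis (arctan r) = cis (arctan s)"
      then have "sin (arctan r) = sin (arctan s)" "cos (arctan r) = cos (arctan s)"
        by (metis cis.simps)+
      then have "tan (arctan r) = tan (arctan s)" by (simp add: tan_def)
      then show "r = s" by (simp add: tan_arctan)
    qed
    show "- 1 \<notin> range (\<lambda>r. cis (arctan r))"
    proof
      assume "- 1 \<in> range (\<lambda>r. cis (arctan r))"
      then obtain r where "- 1 = cis (arctan r)" by blast
      then have "Re (- 1) = cos (arctan r)" by (metis cis.simps(1))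
      then show False using cos_pos[of r] by simp
    qed
    show "unitaries \<subseteq> (bounded_operators :: ('h \<Rightarrow>\<^sub>L 'h) set)" by (auto simp: unitaries_def)
    show "weighted_op (- 1) (\<lambda>n. cis (arctan (e (fst (prod_decode n))))) id \<in> unitaries" for e :: "nat \<Rightarrow> real"
      by (rule unitary_weighted_op) auto
  qed simp
  \<comment> \<open>Since \<open>pi / 2 < 2\<close>, the number \<open>2\<close> bounds all
    eigenvalues and is not one of them, so it serves both as the bound and as the value on the
    complement.\<close>
  interpret A: diagonal_family b "\<lambda>r. complex_of_real (arctan r)" 2 2 selfadjoints
  proof
    have bound: "\<bar>arctan r\<bar> < 2" for r
      using arctan_lbound[of r] arctan_ubound[of r] pi_less_4 by linarith
    then show b: "cmod (complex_of_real (arctan r)) \<le> 2" for r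
      by (simp add: less_imp_le)
    show "continuous_on UNIV (\<lambda>r. complex_of_real (arctan r))" by (intro continuous_intros)
    show "inj (\<lambda>r. complex_of_real (arctan r))" by (rule injI) (simp add: arctan_eq_iff)
    show "2 \<notin> range (\<lambda>r. complex_of_real (arctan r))"
    proof
      assume "2 \<in> range (\<lambda>r. complex_of_real (arctan r))"
      then obtain r where "2 = complex_of_real (arctan r)" by blast
      then have "arctan r = 2" by (metis of_real_eq_iff of_real_numeral)
      then show False using bound[of r] by simp
    qed
    show "selfadjoints \<subseteq> (bounded_operators :: ('h \<Rightarrow>\<^sub>L 'h) set)" by (auto simp: selfadjoints_def)
    show "weighted_op 2 (\<lambda>n. complex_of_real (arctan (e (fst (prod_decode n))))) id \<in> selfadjoints"
      for e :: "nat \<Rightarrow> real"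
      by (rule selfadjoint_weighted_op[of _ _ 2]) (use b in auto)
  qed
  show ?thesis
    using U.not_borel_reducible[OF assms(3-5)] A.not_borel_reducible[OF assms(3-5)] by blast
qed

end
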